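(* Let $\lambda,\mu\in\mathcal P_n$ with $\lambda\gtrdot\mu$, and let $A_{\lambda\mu}$ be the integral adjacent binomial coefficient of the family $\mathcal F$. (1) If $\mathcal F=A\mathrm J$, then $A_{\lambda\mu}\in\mathbb Z_{\geqslant0}[\tau]$; if $\mathcal F=B\mathrm J$, then $A_{\lambda\mu}\in\mathbb Z_{\geqslant0}[\tau,\alpha]$. (2) If $\mathcal F=A\mathrm M$ or $B\mathrm M$, then after the re-parametrization $q=1+\gamma$, $t=1+\gamma\tau$, $a=1+\gamma\alpha$, the coefficient $A_{\lambda\mu}$ is, up to a sign and up to multiplication by integer powers of $q=1+\gamma$, $t=1+\gamma\tau$ (and $a=1+\gamma\alpha$ for $B\mathrm M$), a polynomial with non-negative integer coefficients in the new parameters, i.e. an element of $\mathbb Z_{\geqslant0}[\gamma,\tau]$ for $A\mathrm M$ and of $\mathbb Z_{\geqslant0}[\gamma,\tau,\alpha]$ for $B\mathrm M$.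
   Context: Fix $n\geqslant1$. $\mathcal P_n=\{\lambda\in\mathbb Z^n:\lambda_1\geqslant\cdots\geqslant\lambda_n\geqslant0\}$, $|\lambda|=\lambda_1+\dots+\lambda_n$; $\lambda\supseteq\mu$ means $\lambda_i\geqslant\mu_i$ for all $i$; $\lambda\gtrdot\mu$ means $\lambda\supseteq\mu$ and $|\lambda|=|\mu|+1$. A partition is identified with its Ferrers diagram $\{(i,j):1\leqslant j\leqslant\lambda_i\}$; $\lambda'$ is the conjugate partition; for a box $s=(i,j)\in\lambda$, $a_\lambda(s)=\lambda_i-j$ and $l_\lambda(s)=\lambda'_j-i$. The four families $\mathcal F$ have the following data (base field $\mathbb F$, ring $\Lambda$, shifting map $\mathcal P_n\to\mathbb F^n$, $\lambda\mapsto\overline\lambda$), with indeterminate parameters: - $A\mathrm J$: $\mathbb F=\mathbb Q(\tau)$; $\Lambda=\mathbb F[x_1,\dots,x_n]^{S_n}$; $\overline\lambda_i=\lambda_i+(n-i)\tau$. - $B\mathrm J$: $\mathbb F=\mathbb Q(\tau,\alpha)$; $\Lambda=\mathbb F[x_1^2,\dots,x_n^2]^{S_n}$; $\overline\lambda_i=\lambda_i+(n-i)\tau+\alpha$. - $A\mathrm M$: $\mathbb F=\mathbb Q(q,t)$; $\Lambda=\mathbb F[x_1,\dots,x_n]^{S_n}$; $\overline\lambda_i=q^{\lambda_i}t^{n-i}$. - $B\mathrm M$: $\mathbb F=\mathbb Q(q,t,a)$; $\Lambda=\mathbb F[x_1+x_1^{-1},\dots,x_n+x_n^{-1}]^{S_n}$;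 $\overline\lambda_i=aq^{\lambda_i}t^{n-i}$. The degree of a Laurent polynomial is the maximum of $|\alpha_1|+\dots+|\alpha_n|$ over monomials $x^\alpha$ occurring in it. For $\mu\in\mathcal P_n$, the unital interpolation polynomial $h_\mu$ is the unique element of $\Lambda$ of degree at most $|\mu|$ (at most $2|\mu|$ when $\mathcal F=B\mathrm J$) with $h_\mu(\overline\lambda)=\delta_{\lambda\mu}$ for all $\lambda\in\mathcal P_n$ with $|\lambda|\leqslant|\mu|$ (existence and uniqueness are known). The monic interpolation polynomial $h_\mu^{\mathrm{monic}}$ is the scalar multiple of $h_\mu$ in which the coefficient of $x^\mu$ (of $x^{2\mu}$ for $B\mathrm J$) is $1$, and $H(\mu)=h_\mu^{\mathrm{monic}}(\overline\mu)$, so $h_\mu^{\mathrm{monic}}=H(\mu)h_\mu$. Put $c_\mu=\prod_{s\in\mu}c_\mu(s)$, where $c_\mu(s)=a_\mu(s)+\tau(l_\mu(s)+1)$ for $A\mathrm J,B\mathrm J$ and $c_\mu(s)=1-q^{a_\mu(s)}t^{l_\mu(s)+1}$ for $A\mathrm M,B\mathrm M$. The integral interpolation polynomial is $h_\mu^{\mathrm{int}}=c_\mu h_\mu^{\mathrm{monic}}=c_\mu H(\mu)h_\mu$. For $\lambda\gtrdot\mu$, the integral adjacent binomial coefficient is $A_{\lambda\mu}=h_\mu^{\mathrm{int}}(\overline\lambda)=c_\mu H(\mu)h_\mu(\overline\lambda)$. *)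

theory Defs
  imports
    "HOL-Library.Poly_Mapping"
    "HOL-Computational_Algebra.Polynomial_Factorial"
    "HOL-Combinatorics.Permutations"
begin

section \<open>Partitions with at most n parts\<close>

text \<open>
  A partition \<open>\<nu>\<close> is the function \<open>i \<mapsto> \<nu>\<^sub>i\<close>, with indices starting at 1; it is extended by 0
  outside \<open>{1..n}\<close>, so that equality of functions is equality of partitions.
\<close>

definition partitions :: "nat \<Rightarrow> (nat \<Rightarrow> nat) set" where
  "partitions n =
     {\<nu>. (\<forall>i\<in>{1..n}. \<forall>j\<in>{1..n}. i \<le> j \<longrightarrow> \<nu> j \<le> \<nu> i) \<and> (\<forall>i. i \<notin> {1..n} \<longrightarrow> \<nu> i = 0)}"

definition weight :: "nat \<Rightarrow> (nat \<Rightarrow> nat) \<Rightarrow> nat" where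
  "weight n \<nu> = (\<Sum>i=1..n. \<nu> i)"

definition covers :: "nat \<Rightarrow> (nat \<Rightarrow> nat) \<Rightarrow> (nat \<Rightarrow> nat) \<Rightarrow> bool" where
  "covers n \<nu> \<mu> \<longleftrightarrow> (\<forall>i\<in>{1..n}. \<mu> i \<le> \<nu> i) \<and> weight n \<nu> = weight n \<mu> + 1"

definition diagram :: "nat \<Rightarrow> (nat \<Rightarrow> nat) \<Rightarrow> (nat \<times> nat) set" where
  "diagram n \<nu> = {(i, j). i \<in> {1..n} \<and> 1 \<le> j \<and> j \<le> \<nu> i}"

definition conj_part :: "nat \<Rightarrow> (nat \<Rightarrow> nat) \<Rightarrow> nat \<Rightarrow> nat" where
  "conj_part n \<nu> j = card {i \<in> {1..n}. j \<le> \<nu> i}"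

text \<open>Both subtractions are exact for boxes of the diagram.\<close>

definition arm :: "(nat \<Rightarrow> nat) \<Rightarrow> nat \<times> nat \<Rightarrow> nat" where
  "arm \<nu> s = \<nu> (fst s) - snd s"

definition leg :: "nat \<Rightarrow> (nat \<Rightarrow> nat) \<Rightarrow> nat \<times> nat \<Rightarrow> nat" where
  "leg n \<nu> s = conj_part n \<nu> (snd s) - fst s"

section \<open>Laurent polynomials\<close>

text \<open>
  A monomial \<open>x\<^sup>\<alpha>\<close> is its finitely supported exponent vector, and a Laurent polynomial is the finitely
  supported map of its coefficients. The product of \<open>poly_mapping\<close> is then the usual product.
\<close>

type_synonym expo = "nat \<Rightarrow>\<^sub>0 int"
type_synonym 'a laurent = "expo \<Rightarrow>\<^sub>0 'a"

definition const :: "'a::field \<Rightarrow> 'a laurent" where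
  "const c = Poly_Mapping.single 0 c"

definition var_pow :: "nat \<Rightarrow> int \<Rightarrow> 'a::field laurent" where
  "var_pow i k = Poly_Mapping.single (Poly_Mapping.single i k) 1"

definition ldegree :: "'a::field laurent \<Rightarrow> nat" where
  "ldegree f = Max (insert 0
     ((\<lambda>\<alpha>. \<Sum>i\<in>Poly_Mapping.keys \<alpha>. nat \<bar>Poly_Mapping.lookup \<alpha> i\<bar>) ` Poly_Mapping.keys f))"

definition leval :: "'a::field laurent \<Rightarrow> (nat \<Rightarrow> 'a) \<Rightarrow> 'a" where
  "leval f v = (\<Sum>\<alpha>\<in>Poly_Mapping.keys f. Poly_Mapping.lookup f \<alpha> *
     (\<Prod>i\<in>Poly_Mapping.keys \<alpha>. v i powi Poly_Mapping.lookup \<alpha> i))"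

definition lsymmetric :: "nat \<Rightarrow> 'a::field laurent \<Rightarrow> bool" where
  "lsymmetric n f \<longleftrightarrow> (\<forall>\<sigma>. \<sigma> permutes {1..n} \<longrightarrow>
     (\<forall>\<alpha>. Poly_Mapping.lookup f (Poly_Mapping.map_key \<sigma> \<alpha>) = Poly_Mapping.lookup f \<alpha>))"

text \<open>
  \<open>adjoin R G\<close> is \<open>R[G]\<close>, the closure of \<open>R \<union> G\<close> under sums and products, for a
  subring or subsemiring \<open>R\<close> of a commutative ring.
\<close>

inductive_set adjoin :: "'a::comm_semiring_1 set \<Rightarrow> 'a set \<Rightarrow> 'a set" for R G where
  base: "r \<in> R \<Longrightarrow> r \<in> adjoin R G"
| gen: "g \<in> G \<Longrightarrow> g \<in> adjoin R G"
| add: "f \<in> adjoin R G \<Longrightarrow> g \<in> adjoin R G \<Longrightarrow> f + g \<in> adjoin R G"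
| mult: "f \<in> adjoin R G \<Longrightarrow> g \<in> adjoin R G \<Longrightarrow> f * g \<in> adjoin R G"

section \<open>Interpolation polynomials of a family\<close>

text \<open>
  The ring \<open>\<Lambda>\<close> of a family consists of the symmetric elements of the algebra generated by
  \<open>y\<^sub>1, \<dots>, y\<^sub>n\<close> over the base field, where \<open>y\<^sub>i = generator i\<close>. The degree bound for \<open>h\<^sub>\<mu>\<close>
  is \<open>deg_factor * |\<mu>|\<close> and its leading monomial is \<open>x\<close> to the power \<open>deg_factor * \<mu>\<close>. The value
  \<open>box_factor a l\<close> is \<open>c\<^sub>\<mu>(s)\<close> for a box \<open>s\<close> of arm \<open>a\<close> and leg \<open>l\<close>.
\<close>

record (overloaded) 'a family =
  generator :: "nat \<Rightarrow> 'a laurent"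
  deg_factor :: nat
  shift :: "nat \<Rightarrow> (nat \<Rightarrow> nat) \<Rightarrow> nat \<Rightarrow> 'a"
  box_factor :: "nat \<Rightarrow> nat \<Rightarrow> 'a"

definition Lam :: "'a::field family \<Rightarrow> nat \<Rightarrow> 'a laurent set" where
  "Lam F n = {f \<in> adjoin (range const) (generator F ` {1..n}). lsymmetric n f}"

definition h_unital :: "'a::field family \<Rightarrow> nat \<Rightarrow> (nat \<Rightarrow> nat) \<Rightarrow> 'a laurent" where
  "h_unital F n \<mu> = (THE h. h \<in> Lam F n \<and> ldegree h \<le> deg_factor F * weight n \<mu> \<and>
     (\<forall>\<nu>\<in>partitions n. weight n \<nu> \<le> weight n \<mu> \<longrightarrow>
        leval h (shift F n \<nu>) = (if \<nu> = \<mu> then 1 else 0)))"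

definition lead_expo :: "'a::field family \<Rightarrow> nat \<Rightarrow> (nat \<Rightarrow> nat) \<Rightarrow> expo" where
  "lead_expo F n \<mu> = (\<Sum>i=1..n. Poly_Mapping.single i (int (deg_factor F * \<mu> i)))"

definition h_monic :: "'a::field family \<Rightarrow> nat \<Rightarrow> (nat \<Rightarrow> nat) \<Rightarrow> 'a laurent" where
  "h_monic F n \<mu> = (THE g. (\<exists>c. g = const c * h_unital F n \<mu>) \<and>
     Poly_Mapping.lookup g (lead_expo F n \<mu>) = 1)"

definition c_coeff :: "'a::field family \<Rightarrow> nat \<Rightarrow> (nat \<Rightarrow> nat) \<Rightarrow> 'a" where
  "c_coeff F n \<mu> = (\<Prod>s\<in>diagram n \<mu>. box_factor F (arm \<mu> s) (leg n \<mu> s))"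

definition h_int :: "'a::field family \<Rightarrow> nat \<Rightarrow> (nat \<Rightarrow> nat) \<Rightarrow> 'a laurent" where
  "h_int F n \<mu> = const (c_coeff F n \<mu>) * h_monic F n \<mu>"

definition adj_coeff ::
  "'a::field family \<Rightarrow> nat \<Rightarrow> (nat \<Rightarrow> nat) \<Rightarrow> (nat \<Rightarrow> nat) \<Rightarrow> 'a" where
  "adj_coeff F n \<nu> \<mu> = leval (h_int F n \<mu>) (shift F n \<nu>)"

section \<open>The four families\<close>

text \<open>
  Fields of rational functions are fraction fields of iterated polynomial rings, for example
  \<open>\<rat>(\<tau>, \<alpha>)\<close> is the fraction field of \<open>\<rat>[\<tau>][\<alpha>]\<close>.
\<close>

definition AJ_tau :: "rat poly fract" where "AJ_tau = to_fract [:0, 1:]"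

definition AJ :: "rat poly fract family" where
  "AJ = \<lparr>
     generator = (\<lambda>i. var_pow i 1),
     deg_factor = 1,
     shift = (\<lambda>n \<nu> i. of_nat (\<nu> i) + of_nat (n - i) * AJ_tau),
     box_factor = (\<lambda>a l. of_nat a + AJ_tau * of_nat (l + 1)) \<rparr>"

definition BJ_tau :: "rat poly poly fract" where "BJ_tau = to_fract [:[:0, 1:]:]"
definition BJ_alpha :: "rat poly poly fract" where "BJ_alpha = to_fract [:0, 1:]"

definition BJ :: "rat poly poly fract family" where
  "BJ = \<lparr>
     generator = (\<lambda>i. var_pow i 2),
     deg_factor = 2,
     shift = (\<lambda>n \<nu> i. of_nat (\<nu> i) + of_nat (n - i) * BJ_tau + BJ_alpha),
     box_factor = (\<lambda>a l. of_nat a + BJ_tau * of_nat (l + 1)) \<rparr>"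

definition AM_q :: "rat poly poly fract" where "AM_q = to_fract [:[:0, 1:]:]"
definition AM_t :: "rat poly poly fract" where "AM_t = to_fract [:0, 1:]"

definition AM :: "rat poly poly fract family" where
  "AM = \<lparr>
     generator = (\<lambda>i. var_pow i 1),
     deg_factor = 1,
     shift = (\<lambda>n \<nu> i. AM_q ^ \<nu> i * AM_t ^ (n - i)),
     box_factor = (\<lambda>a l. 1 - AM_q ^ a * AM_t ^ (l + 1)) \<rparr>"

definition BM_q :: "rat poly poly poly fract" where "BM_q = to_fract [:[:[:0, 1:]:]:]"
definition BM_t :: "rat poly poly poly fract" where "BM_t = to_fract [:[:0, 1:]:]"
definition BM_a :: "rat poly poly poly fract" where "BM_a = to_fract [:0, 1:]"

definition BM :: "rat poly poly poly fract family" where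
  "BM = \<lparr>
     generator = (\<lambda>i. var_pow i 1 + var_pow i (-1)),
     deg_factor = 1,
     shift = (\<lambda>n \<nu> i. BM_a * BM_q ^ \<nu> i * BM_t ^ (n - i)),
     box_factor = (\<lambda>a l. 1 - BM_q ^ a * BM_t ^ (l + 1)) \<rparr>"

text \<open>
  The new parameters \<open>\<gamma>, \<tau>, \<alpha>\<close> are the solutions, in the base field, of \<open>q = 1 + \<gamma>\<close>,
  \<open>t = 1 + \<gamma> \<tau>\<close>, \<open>a = 1 + \<gamma> \<alpha>\<close>. They are again algebraically independent generators of that
  field, so \<open>adjoin \<nat>\<close> of them is the semiring of polynomials in them with
  non-negative integer coefficients.
\<close>

definition AM_gamma :: "rat poly poly fract" where "AM_gamma = AM_q - 1"
definition AM_tau :: "rat poly poly fract" where "AM_tau = (AM_t - 1) / AM_gamma"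

definition BM_gamma :: "rat poly poly poly fract" where "BM_gamma = BM_q - 1"
definition BM_tau :: "rat poly poly poly fract" where "BM_tau = (BM_t - 1) / BM_gamma"
definition BM_alpha :: "rat poly poly poly fract" where "BM_alpha = (BM_a - 1) / BM_gamma"

lemma AM_gamma_nonzero: "AM_gamma \<noteq> 0"
proof -
  have "[:[:0, 1:]:] - 1 \<noteq> (0 :: rat poly poly)"
    by (simp add: one_pCons)
  hence "to_fract ([:[:0, 1:]:] - 1 :: rat poly poly) \<noteq> 0"
    by (subst to_fract_eq_0_iff)
  thus ?thesis
    unfolding AM_gamma_def AM_q_def to_fract_diff to_fract_1 .
qed

lemma BM_gamma_nonzero: "BM_gamma \<noteq> 0"
proof -
  have "[:[:[:0, 1:]:]:] - 1 \<noteq> (0 :: rat poly poly poly)"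
    by (simp add: one_pCons)
  hence "to_fract ([:[:[:0, 1:]:]:] - 1 :: rat poly poly poly) \<noteq> 0"
    by (subst to_fract_eq_0_iff)
  thus ?thesis
    unfolding BM_gamma_def BM_q_def to_fract_diff to_fract_1 .
qed

lemma AM_reparametrization:
  "AM_q = 1 + AM_gamma" "AM_t = 1 + AM_gamma * AM_tau"
  using AM_gamma_nonzero by (simp_all add: AM_gamma_def AM_tau_def)

lemma BM_reparametrization:
  "BM_q = 1 + BM_gamma" "BM_t = 1 + BM_gamma * BM_tau" "BM_a = 1 + BM_gamma * BM_alpha"
  using BM_gamma_nonzero by (simp_all add: BM_gamma_def BM_tau_def BM_alpha_def)

end

theory Submission
  imports Defs "Jordan_Normal_Form.Determinant"
begin

text \<open>
  In the variables \<open>y\<^sub>i\<close> (the generators of the family) every \<open>\<Lambda>\<close> is a ring of symmetric polynomials, and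
  the interpolation nodes are \<open>y\<^sub>i = Y \<lambda>\<^sub>i (n - i)\<close> for an injective grid \<open>Y\<close>. For any such grid the monic
  interpolation polynomial is multiplied by \<open>\<Prod>i. y\<^sub>i - Y 0 0\<close> when a full column is added to \<open>\<mu>\<close> and
  extends the polynomial in \<open>n - 1\<close> variables when \<open>\<mu>\<^sub>n = 0\<close>. This gives \<open>H(\<mu>)\<close> as a product, and it
  reduces \<open>A\<^bsub>\<lambda>\<mu>\<^esub>\<close> to the case \<open>\<mu>\<^sub>n = 0\<close>, \<open>\<lambda> = \<mu> + e\<^sub>n\<close>.

  In that case a difference operator is used, whose summand for \<open>I \<subseteq> {1..n}\<close> evaluates its argument at the
  node of the partition with the boxes of the rows in \<open>I\<close> removed (the summand vanishes if that is no
  partition). It does not raise degrees, because its product with the Vandermonde determinant is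
  an antisymmetrized polynomial, hence maps an interpolation polynomial of one grid to a
  multiple of one of another grid. A free parameter of the operator is chosen so that only the
  summand \<open>I = {n}\<close> survives at \<open>\<lambda>\<close>; comparing with the value at \<open>\<mu>\<close> yields a product formula whose denominators
  cancel against \<open>c\<^sub>\<mu> H(\<mu>)\<close>.
\<close>

section \<open>Symmetric functions and alternants\<close>

text \<open>Arbitrary injective grids are used because removing a column or an empty row replaces
  \<open>Y k m\<close> by \<open>Y (k + 1) m\<close> or \<open>Y k (m + 1)\<close>: the induction
  leaves every single family but stays in this class. A new box in an empty last row blocks both
  reductions, since \<mu> has no full column and \<lambda> has no empty row; only there is another
  tool needed. The weights of the operator have denominators. They are balanced so that keeping a
  box and removing it together give a polynomial in the node, row by row; this is all that has to be
  checked for a new type of grid. Positivity never comes from comparing sums. Every value is a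
  product, so the target set needs closure under multiplication only. In the product formula a row
  of \<mu> contributes a quotient. Up to units, its denominator is the factor of
  \<open>c\<^sub>\<mu>\<close> at the first box of that row, times, for quadratic grids, a factor of
  H(\<mu>) belonging to the same row.\<close>

definition esym :: "nat \<Rightarrow> nat \<Rightarrow> (nat \<Rightarrow> 'a::field) \<Rightarrow> 'a" where
  "esym n k y = coeff (\<Prod>i=1..n. [:1, - y i:]) k"

lemma esym_0 [simp]: "esym n 0 y = 1"
  by (simp add: esym_def coeff_0_power poly_prod flip: poly_0_coeff_0)

lemma esym_zero_Suc [simp]: "esym 0 (Suc k) y = 0"
  by (simp add: esym_def coeff_1)

lemma esym_Suc_Suc: "esym (Suc n) (Suc k) y = esym n (Suc k) y - y (Suc n) * esym n k y"
proof -
  have "(\<Prod>i=1..Suc n. [:1, - y i:]) = [:1, - y (Suc n):] * (\<Prod>i=1..n. [:1, - y i:])"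
    by (simp add: mult.commute)
  then show ?thesis
    by (simp add: esym_def)
qed

lemma esym_eq_0: "n < k \<Longrightarrow> esym n k y = 0"
proof (induction n arbitrary: k)
  case 0
  then show ?case by (cases k) auto
next
  case (Suc n)
  then show ?case by (cases k) (auto simp: esym_Suc_Suc)
qed

lemma esym_cong: "(\<And>i. i \<in> {1..n} \<Longrightarrow> y i = z i) \<Longrightarrow> esym n k y = esym n k z"
  unfolding esym_def by (rule arg_cong[where f = "\<lambda>p. coeff p k"], rule prod.cong) auto

lemma esym_permutes:
  assumes "p permutes {1..n}"
  shows "esym n k (\<lambda>i. y (p i)) = esym n k y"
  unfolding esym_def by (subst prod.permute[OF assms, of "\<lambda>i. [:1, - y i:]"]) (simp add: o_def)

text \<open>Vieta's formula without signs: \<open>esym\<close> is (-1)^k times the k-th elementary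
  symmetric polynomial.\<close>

lemma prod_diff_eq_esym: "(\<Prod>i=1..n. z - y i) = (\<Sum>k\<le>n. esym n k y * z ^ (n - k))"
proof (induction n)
  case 0
  then show ?case by simp
next
  case (Suc n)
  have a: "(\<Sum>k\<le>n. esym n k y * z ^ (Suc n - k)) = z ^ Suc n + (\<Sum>k\<le>n. esym n (Suc k) y * z ^ (n - k))"
  proof -
    have "(\<Sum>k\<le>n. esym n k y * z ^ (Suc n - k)) = (\<Sum>k\<le>Suc n. esym n k y * z ^ (Suc n - k))"
      by (simp add: esym_eq_0)
    also have "\<dots> = z ^ Suc n + (\<Sum>k\<le>n. esym n (Suc k) y * z ^ (n - k))"
      by (subst sum.atMost_Suc_shift) simp
    finally show ?thesis .
  qed
  have "(\<Prod>i=1..Suc n. z - y i) = (z - y (Suc n)) * (\<Sum>k\<le>n. esym n k y * z ^ (n - k))"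
    using Suc by (simp add: mult.commute)
  also have "\<dots> = (\<Sum>k\<le>n. esym n k y * z ^ (Suc n - k)) - (\<Sum>k\<le>n. y (Suc n) * esym n k y * z ^ (n - k))"
  proof -
    have "z * (\<Sum>k\<le>n. esym n k y * z ^ (n - k)) = (\<Sum>k\<le>n. esym n k y * z ^ (Suc n - k))"
      unfolding sum_distrib_left by (rule sum.cong) (auto simp: Suc_diff_le)
    then show ?thesis
      by (simp add: left_diff_distrib sum_distrib_left mult.assoc sum_subtractf)
  qed
  also have "\<dots> = z ^ Suc n + (\<Sum>k\<le>n. esym (Suc n) (Suc k) y * z ^ (n - k))"
    unfolding a by (simp add: esym_Suc_Suc algebra_simps sum_subtractf)
  also have "\<dots> = (\<Sum>k\<le>Suc n. esym (Suc n) k y * z ^ (Suc n - k))"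
    by (subst sum.atMost_Suc_shift) simp
  finally show ?case .
qed

text \<open>A degree filtration: constants satisfy every bound \<open>d\<close>. Generating the
  functions from \<open>esym\<close>, instead of requiring invariance, turns the lift to one more
  variable and the comparison with \<open>polyfun\<close> into inductions over generators.\<close>

inductive symfun :: "nat \<Rightarrow> nat \<Rightarrow> ((nat \<Rightarrow> 'a::field) \<Rightarrow> 'a) \<Rightarrow> bool" for n where
  symfun_const: "symfun n d (\<lambda>y. c)"
| symfun_esym: "symfun n k (esym n k)"
| symfun_add: "symfun n d f \<Longrightarrow> symfun n d g \<Longrightarrow> symfun n d (\<lambda>y. f y + g y)"
| symfun_mult: "symfun n d f \<Longrightarrow> symfun n e g \<Longrightarrow> symfun n (d + e) (\<lambda>y. f y * g y)"

lemma symfun_weaken: "symfun n d f \<Longrightarrow> d \<le> e \<Longrightarrow> symfun n e f"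
  using symfun_mult[of n d f "e - d" "\<lambda>_. 1"] symfun_const[of n "e - d" 1] by simp

lemma symfun_scale: "symfun n d f \<Longrightarrow> symfun n d (\<lambda>y. c * f y)"
  using symfun_mult[OF symfun_const[of n 0 c]] by fastforce

lemma symfun_diff: "symfun n d f \<Longrightarrow> symfun n d g \<Longrightarrow> symfun n d (\<lambda>y. f y - g y)"
  using symfun_add[OF _ symfun_scale[of n d g "-1"]] by fastforce

lemma symfun_sum: "(\<And>a. a \<in> A \<Longrightarrow> symfun n d (f a)) \<Longrightarrow> symfun n d (\<lambda>y. \<Sum>a\<in>A. f a y)"
  by (induction A rule: infinite_finite_induct) (auto intro: symfun_const symfun_add)

lemma symfun_prod:
  "(\<And>a. a \<in> A \<Longrightarrow> symfun n (d a) (f a)) \<Longrightarrow> symfun n (\<Sum>a\<in>A. d a) (\<lambda>y. \<Prod>a\<in>A. f a y)"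
  by (induction A rule: infinite_finite_induct) (auto intro: symfun_const symfun_mult)

lemma symfun_cong:
  "symfun n d f \<Longrightarrow> (\<And>i. i \<in> {1..n} \<Longrightarrow> y i = z i) \<Longrightarrow> f y = f z"
  by (induction rule: symfun.induct) (metis esym_cong | simp)+

lemma symfun_permutes:
  "symfun n d f \<Longrightarrow> p permutes {1..n} \<Longrightarrow> f (\<lambda>i. y (p i)) = f y"
  by (induction rule: symfun.induct) (simp_all only: esym_permutes)

lemma symfun_prod_diff: "symfun n n (\<lambda>y. \<Prod>i=1..n. c - y i)"
  unfolding prod_diff_eq_esym
proof (rule symfun_sum)
  fix k assume "k \<in> {..n}"
  then show "symfun n n (\<lambda>y. esym n k y * c ^ (n - k))"
    using symfun_weaken[OF symfun_scale[OF symfun_esym[of n k], where c = "c ^ (n - k)"], of n]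
    by (simp add: mult.commute)
qed

text \<open>Restriction to the hyperplane \<open>y (Suc n) = c\<close> is onto, degree by degree. By
  the recursion for \<open>esym\<close>, the function \<open>esym n (Suc k)\<close> is the
  restriction of \<open>esym (Suc n) (Suc k)\<close> plus \<open>c\<close> times a lift of
  \<open>esym n k\<close>.\<close>

lemma symfun_lift:
  assumes "symfun n d f"
  shows "\<exists>g. symfun (Suc n) d g \<and> (\<forall>y. y (Suc n) = c \<longrightarrow> g y = f y)"
  using assms
proof (induction rule: symfun.induct)
  case (symfun_const d c)
  then show ?case using symfun.symfun_const by blast
next
  case (symfun_esym k)
  then show ?case
  proof (induction k)
    case 0
    have "esym n 0 = (\<lambda>y. 1)" by auto
    then show ?case by (auto intro!: exI[of _ "\<lambda>y. 1"] symfun_const)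
  next
    case (Suc k)
    then obtain g where g: "symfun (Suc n) k g" "\<forall>y. y (Suc n) = c \<longrightarrow> g y = esym n k y"
      by blast
    show ?case
      using g symfun_weaken[OF symfun_scale[OF g(1), of c], of "Suc k"]
      by (intro exI[of _ "\<lambda>y. esym (Suc n) (Suc k) y + c * g y"])
        (auto intro: symfun_add symfun.symfun_esym, simp add: esym_Suc_Suc)
  qed
next
  case (symfun_add d f g)
  then obtain f' g' where "symfun (Suc n) d f'" "symfun (Suc n) d g'"
    "\<forall>y. y (Suc n) = c \<longrightarrow> f' y = f y" "\<forall>y. y (Suc n) = c \<longrightarrow> g' y = g y" by blast
  then show ?case
    by (intro exI[of _ "\<lambda>y. f' y + g' y"]) (auto intro: symfun.symfun_add)
next
  case (symfun_mult d f e g)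
  then obtain f' g' where "symfun (Suc n) d f'" "symfun (Suc n) e g'"
    "\<forall>y. y (Suc n) = c \<longrightarrow> f' y = f y" "\<forall>y. y (Suc n) = c \<longrightarrow> g' y = g y" by blast
  then show ?case
    by (intro exI[of _ "\<lambda>y. f' y * g' y"]) (auto intro: symfun.symfun_mult)
qed

section \<open>Polynomial functions with a degree bound\<close>

definition monomial :: "nat \<Rightarrow> (nat \<Rightarrow> nat) \<Rightarrow> (nat \<Rightarrow> 'a::field) \<Rightarrow> 'a" where
  "monomial n b y = (\<Prod>i=1..n. y i ^ b i)"

inductive polyfun :: "nat \<Rightarrow> nat \<Rightarrow> ((nat \<Rightarrow> 'a::field) \<Rightarrow> 'a) \<Rightarrow> bool" for n d where
  polyfun_monomial: "weight n b \<le> d \<Longrightarrow> polyfun n d (\<lambda>y. c * monomial n b y)"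
| polyfun_add: "polyfun n d f \<Longrightarrow> polyfun n d g \<Longrightarrow> polyfun n d (\<lambda>y. f y + g y)"

lemma polyfun_const: "polyfun n d (\<lambda>y. c)"
  using polyfun_monomial[of n "\<lambda>_. 0" d c] by (simp add: weight_def monomial_def)

lemma polyfun_weaken: "polyfun n d f \<Longrightarrow> d \<le> e \<Longrightarrow> polyfun n e f"
  by (induction rule: polyfun.induct) (auto intro: polyfun.intros)

lemma monomial_mult: "monomial n b y * monomial n b' y = monomial n (\<lambda>i. b i + b' i) y"
  by (simp add: monomial_def power_add prod.distrib)

lemma weight_add: "weight n (\<lambda>i. b i + b' i) = weight n b + weight n b'"
  by (simp add: weight_def sum.distrib)

lemma polyfun_monomial_mult:
  assumes "polyfun n d f" "weight n b \<le> e"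
  shows "polyfun n (d + e) (\<lambda>y. f y * (c * monomial n b y))"
  using assms
proof (induction rule: polyfun.induct)
  case (polyfun_monomial b' c')
  have "polyfun n (d + e) (\<lambda>y. (c' * c) * monomial n (\<lambda>i. b' i + b i) y)"
    using polyfun_monomial by (intro polyfun.intros) (auto simp: weight_add)
  then show ?case by (simp add: monomial_mult[symmetric] algebra_simps)
next
  case (polyfun_add f g)
  then show ?case using polyfun.polyfun_add by (fastforce simp: algebra_simps)
qed

lemma polyfun_mult:
  assumes "polyfun n d f" "polyfun n e g"
  shows "polyfun n (d + e) (\<lambda>y. f y * g y)"
  using assms(2)
proof (induction rule: polyfun.induct)
  case (polyfun_monomial b c)
  then show ?case using polyfun_monomial_mult[OF assms(1)] by blast
next
  case (polyfun_add g h)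
  then show ?case using polyfun.polyfun_add by (fastforce simp: algebra_simps)
qed

lemma polyfun_sum: "(\<And>a. a \<in> A \<Longrightarrow> polyfun n d (f a)) \<Longrightarrow> polyfun n d (\<lambda>y. \<Sum>a\<in>A. f a y)"
  by (induction A rule: infinite_finite_induct) (auto intro: polyfun_const polyfun_add)

lemma polyfun_prod:
  "(\<And>a. a \<in> A \<Longrightarrow> polyfun n (d a) (f a)) \<Longrightarrow> polyfun n (\<Sum>a\<in>A. d a) (\<lambda>y. \<Prod>a\<in>A. f a y)"
  by (induction A rule: infinite_finite_induct) (auto intro: polyfun_const polyfun_mult)

lemma polyfun_var:
  assumes "i \<in> {1..n}"
  shows "polyfun n 1 (\<lambda>y. y i)"
proof -
  have "weight n (\<lambda>j. if j = i then 1 else 0) \<le> 1"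
    using assms by (simp add: weight_def)
  from polyfun_monomial[OF this, of 1] show ?thesis
    using assms by (simp add: monomial_def if_distrib cong: if_cong)
qed

lemma polyfun_power: "polyfun n d f \<Longrightarrow> polyfun n (k * d) (\<lambda>y. f y ^ k)"
  using polyfun_prod[of "{..<k}" n "\<lambda>_. d" "\<lambda>_. f"] by simp

lemma polyfun_poly:
  assumes "i \<in> {1..n}"
  shows "polyfun n (degree p) (\<lambda>y. poly p (y i))"
  unfolding poly_altdef
proof (rule polyfun_sum)
  fix k assume "k \<in> {..degree p}"
  then show "polyfun n (degree p) (\<lambda>y. coeff p k * y i ^ k)"
    using polyfun_mult[OF polyfun_const[of n 0] polyfun_power[OF polyfun_var[OF assms]]]
    by (auto intro: polyfun_weaken)
qed

lemma polyfun_esym: "polyfun n k (esym n k :: (nat \<Rightarrow> 'a::field) \<Rightarrow> 'a)"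
proof -
  \<comment> \<open>The ambient number \<open>m\<close> of variables stays fixed while
    \<open>n\<close> grows in the induction.\<close>
  have "polyfun m k (esym n k :: (nat \<Rightarrow> 'a) \<Rightarrow> 'a)" if "n \<le> m" for m
    using that
  proof (induction n arbitrary: k)
    case 0
    then show ?case
    proof (cases k)
      case 0
      have "esym 0 0 = (\<lambda>y :: nat \<Rightarrow> 'a. 1)" by auto
      then show ?thesis unfolding 0 by (simp add: polyfun_const)
    next
      case (Suc k')
      then have "esym 0 k = (\<lambda>y :: nat \<Rightarrow> 'a. 0)" by auto
      then show ?thesis by (simp add: polyfun_const)
    qed
  next
    case (Suc n)
    show ?case
    proof (cases k)
      case 0
      have "esym (Suc n) 0 = (\<lambda>y :: nat \<Rightarrow> 'a. 1)" by auto
      then show ?thesis unfolding 0 by (simp add: polyfun_const)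
    next
      case [simp]: (Suc k')
      have eq: "esym (Suc n) k = (\<lambda>y :: nat \<Rightarrow> 'a. esym n k y + (-1) * (y (Suc n) * esym n k' y))"
        by (auto simp: esym_Suc_Suc)
      have "polyfun m (0 + (1 + k')) (\<lambda>y :: nat \<Rightarrow> 'a. (-1) * (y (Suc n) * esym n k' y))"
        using Suc.prems Suc.IH by (intro polyfun_mult polyfun_const polyfun_var) auto
      then show ?thesis
        unfolding eq using Suc.prems Suc.IH by (intro polyfun_add) auto
    qed
  qed
  then show ?thesis by simp
qed

lemma symfun_imp_polyfun: "symfun n d f \<Longrightarrow> polyfun n d f"
  by (induction rule: symfun.induct)
    (auto intro: polyfun_const polyfun_esym polyfun_add polyfun_mult)

section \<open>Vandermonde determinants and quotients of alternants\<close>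

definition vandermonde :: "nat \<Rightarrow> (nat \<Rightarrow> 'a::field) \<Rightarrow> 'a" where
  "vandermonde n y = (\<Prod>j=1..n. \<Prod>i=1..<j. y j - y i)"

lemma det_eq_sum_permutes:
  fixes a :: "nat \<Rightarrow> nat \<Rightarrow> 'a::comm_ring_1"
  shows "det (mat n n (\<lambda>(i, j). a (Suc i) (Suc j))) =
    (\<Sum>p | p permutes {1..n}. of_int (sign p) * (\<Prod>i=1..n. a i (p i)))"
proof -
  have bij: "bij_betw Suc {0..<n} {1..n}"
    by (simp add: bij_betw_def atLeastLessThanSuc_atLeastAtMost)
  let ?g = "\<lambda>p x. if x \<in> {1..n} then Suc (p (inv_into {0..<n} Suc x)) else x"
  have inv: "inv_into {0..<n} Suc (Suc i) = i" if "i \<in> {0..<n}" for i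
    using that by (simp add: inv_into_f_f)
  have g: "?g p = map_permutation {0..<n} Suc p" for p
    using bij by (auto simp: map_permutation_def restrict_id_def fun_eq_iff bij_betw_def)
  have "(\<Sum>p | p permutes {1..n}. of_int (sign p) * (\<Prod>i=1..n. a i (p i))) =
    (\<Sum>p | p permutes {0..<n}. of_int (sign (?g p)) * (\<Prod>i=1..n. a i (?g p i)))"
    by (rule sum.reindex_bij_betw[OF bij_betw_permutations[OF bij], symmetric])
  also have "\<dots> = (\<Sum>p | p permutes {0..<n}. of_int (sign p) * (\<Prod>i=0..<n. a (Suc i) (Suc (p i))))"
  proof (rule sum.cong)
    fix p assume "p \<in> {p. p permutes {0..<n}}"
    then have p: "p permutes {0..<n}" by simp
    have "sign (?g p) = sign p"
      unfolding g by (rule sign_map_permutation) (use p in auto)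
    moreover have "(\<Prod>i=1..n. a i (?g p i)) = (\<Prod>i=0..<n. a (Suc i) (?g p (Suc i)))"
      by (rule prod.reindex_bij_betw[OF bij, symmetric])
    moreover have "\<dots> = (\<Prod>i=0..<n. a (Suc i) (Suc (p i)))"
      by (rule prod.cong) (auto simp: inv)
    ultimately show "of_int (sign (?g p)) * (\<Prod>i=1..n. a i (?g p i)) =
        of_int (sign p) * (\<Prod>i=0..<n. a (Suc i) (Suc (p i)))" by simp
  qed simp
  also have "\<dots> = det (mat n n (\<lambda>(i, j). a (Suc i) (Suc j)))"
    by (subst det_def'[where n = n]) (auto intro!: sum.cong prod.cong simp: permutes_in_image)
  finally show ?thesis ..
qed

text \<open>Row operations replace the powers by Newton polynomials. \<open>U\<close> is
  unitriangular, its rows being their coefficients. The Newton polynomial of degree \<open>l\<close>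
  vanishes at \<open>y (Suc j)\<close> for \<open>j < l\<close>, so \<open>N\<close> is triangular
  and its diagonal gives the product.\<close>

lemma det_vandermonde: "det (mat n n (\<lambda>(i, j). y (Suc j) ^ i)) = vandermonde n y"
proof -
  define V where "V = mat n n (\<lambda>(i, j). y (Suc j) ^ i)"
  define U where "U = mat n n (\<lambda>(l, m). if m \<le> l then esym l (l - m) y else 0)"
  define N where "N = mat n n (\<lambda>(l, j). \<Prod>i=1..l. y (Suc j) - y i)"
  have "N = U * V"
  proof (rule eq_matI)
    fix l j assume lj: "l < dim_row (U * V)" "j < dim_col (U * V)"
    then have lj': "l < n" "j < n" by (auto simp: U_def V_def)
    have "(U * V) $$ (l, j) = (\<Sum>m=0..<n. (if m \<le> l then esym l (l - m) y else 0) * y (Suc j) ^ m)"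
      using lj' by (simp add: U_def V_def scalar_prod_def)
    also have "\<dots> = (\<Sum>m\<le>l. esym l (l - m) y * y (Suc j) ^ m)"
      by (rule sum.mono_neutral_cong_right) (use lj' in auto)
    also have "\<dots> = (\<Sum>k\<le>l. esym l k y * y (Suc j) ^ (l - k))"
      by (rule sum.reindex_bij_witness[of _ "\<lambda>k. l - k" "\<lambda>k. l - k"]) auto
    also have "\<dots> = N $$ (l, j)"
      using lj' by (simp add: N_def flip: prod_diff_eq_esym)
    finally show "N $$ (l, j) = (U * V) $$ (l, j)" ..
  qed (auto simp: N_def U_def V_def)
  then have "det N = det U * det V"
    by (simp add: U_def V_def det_mult[where n = n])
  also have "det U = prod_list (diag_mat U)"
    by (rule det_lower_triangular[where n = n]) (auto simp: U_def)
  also have "diag_mat U = map (\<lambda>i. 1) [0..<n]"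
    by (auto simp: diag_mat_def U_def)
  also have "prod_list \<dots> = (1::'a)"
    by (induction n) auto
  finally have "det V = det N" by simp
  also have "det N = prod_list (diag_mat N)"
    by (rule det_upper_triangular[where n = n]) (auto simp: N_def upper_triangular_def intro!: bexI)
  also have "diag_mat N = map (\<lambda>j. \<Prod>i=1..j. y (Suc j) - y i) [0..<n]"
    by (auto simp: diag_mat_def N_def)
  also have "prod_list \<dots> = (\<Prod>j=0..<n. \<Prod>i=1..j. y (Suc j) - y i)"
    by (subst prod.distinct_set_conv_list[symmetric]) auto
  also have "\<dots> = (\<Prod>j=1..n. \<Prod>i=1..<j. y j - y i)"
    by (rule prod.reindex_bij_witness[of _ "\<lambda>j. j - 1" Suc]) (auto simp: atLeastLessThanSuc_atLeastAtMost simp del: prod.op_ivl_Suc)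
  finally show ?thesis by (simp add: V_def vandermonde_def)
qed

text \<open>The coefficient of \<open>z\<^sup>l\<close> in the remainder of \<open>z\<^sup>b\<close> modulo \<open>(z - y\<^sub>1) \<dots> (z - y\<^sub>n)\<close>.\<close>

primrec remainder_coeff :: "nat \<Rightarrow> nat \<Rightarrow> nat \<Rightarrow> (nat \<Rightarrow> 'a::field) \<Rightarrow> 'a" where
  "remainder_coeff n 0 l = (\<lambda>y. if l = 0 then 1 else 0)"
| "remainder_coeff n (Suc b) l = (\<lambda>y. (if l = 0 then 0 else remainder_coeff n b (l - 1) y)
     - remainder_coeff n b (n - 1) y * esym n (n - l) y)"

lemma power_eq_remainder:
  assumes j: "j \<in> {1..n}"
  shows "y j ^ b = (\<Sum>l<n. remainder_coeff n b l y * y j ^ l)"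
proof (induction b)
  case 0
  have "(\<Sum>l<n. remainder_coeff n 0 l y * y j ^ l) = (\<Sum>l\<in>{0}. remainder_coeff n 0 l y * y j ^ l)"
    by (rule sum.mono_neutral_right) (use j in auto)
  then show ?case by simp
next
  case (Suc b)
  obtain m where m: "n = Suc m" using j by (cases n) auto
  have "(\<Prod>i=1..n. y j - y i) = 0" using j by (intro prod_zero) auto
  then have "(\<Sum>k\<le>n. esym n k y * y j ^ (n - k)) = 0"
    by (simp only: prod_diff_eq_esym)
  also have "(\<Sum>k\<le>n. esym n k y * y j ^ (n - k)) = (\<Sum>l\<le>n. esym n (n - l) y * y j ^ l)"
    by (rule sum.reindex_bij_witness[of _ "\<lambda>k. n - k" "\<lambda>k. n - k"]) auto
  also have "\<dots> = (\<Sum>l<n. esym n (n - l) y * y j ^ l) + y j ^ n"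
    by (simp add: lessThan_Suc_atMost[symmetric])
  finally have yn: "y j ^ n = - (\<Sum>l<n. esym n (n - l) y * y j ^ l)"
    by (simp add: eq_neg_iff_add_eq_0 add.commute)
  let ?r = "\<lambda>l. remainder_coeff n b l y"
  have "(\<Sum>l<n. remainder_coeff n (Suc b) l y * y j ^ l) =
      (\<Sum>l<n. (if l = 0 then 0 else ?r (l - 1)) * y j ^ l) + ?r (n - 1) * y j ^ n"
    unfolding yn by (simp add: left_diff_distrib sum_subtractf sum_distrib_left mult.assoc)
  also have "(\<Sum>l<n. (if l = 0 then 0 else ?r (l - 1)) * y j ^ l) = (\<Sum>l<m. ?r l * y j ^ Suc l)"
    unfolding m by (subst sum.lessThan_Suc_shift) simp
  also have "\<dots> + ?r (n - 1) * y j ^ n = (\<Sum>l<n. ?r l * y j ^ Suc l)"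
    by (simp add: m)
  also have "\<dots> = y j * (\<Sum>l<n. ?r l * y j ^ l)"
    by (simp add: sum_distrib_left mult_ac)
  finally show ?case using Suc by simp
qed

text \<open>Each step of the recursion raises the degree by one. The range \<open>b < l\<close>,
  where \<open>b - l\<close> truncates, has to be recorded as vanishing: otherwise the factor
  \<open>esym n (n - l)\<close> would push the degree bound beyond \<open>Suc b - l\<close>.\<close>

lemma symfun_remainder_coeff:
  fixes dummy :: "'a::field"
  assumes "l < n"
  shows "(b < l \<longrightarrow> remainder_coeff n b l = (\<lambda>y :: nat \<Rightarrow> 'a. 0)) \<and>
    (l \<le> b \<longrightarrow> symfun n (b - l) (remainder_coeff n b l :: (nat \<Rightarrow> 'a) \<Rightarrow> 'a))"
  using assms
proof (induction b arbitrary: l)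
  case 0
  then show ?case by (auto intro: symfun_const)
next
  case (Suc b)
  have last: "(b < n - 1 \<longrightarrow> remainder_coeff n b (n - 1) = (\<lambda>y :: nat \<Rightarrow> 'a. 0)) \<and>
    (n - 1 \<le> b \<longrightarrow> symfun n (b - (n - 1)) (remainder_coeff n b (n - 1) :: (nat \<Rightarrow> 'a) \<Rightarrow> 'a))"
    using Suc by (intro Suc.IH) auto
  show ?case
  proof (intro conjI impI)
    assume "Suc b < l"
    then have "b < l - 1" "b < n - 1" "l \<noteq> 0" using Suc.prems by auto
    then show "remainder_coeff n (Suc b) l = (\<lambda>y :: nat \<Rightarrow> 'a. 0)"
      using last Suc.IH[of "l - 1"] Suc.prems by simp
  next
    assume l: "l \<le> Suc b"
    have 1: "symfun n (Suc b - l) (\<lambda>y :: nat \<Rightarrow> 'a. if l = 0 then 0 else remainder_coeff n b (l - 1) y)"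
    proof (cases "l = 0")
      case True
      then show ?thesis by (simp add: symfun_const)
    next
      case False
      then have "symfun n (b - (l - 1)) (remainder_coeff n b (l - 1) :: (nat \<Rightarrow> 'a) \<Rightarrow> 'a)"
        using Suc.IH[of "l - 1"] Suc.prems l by auto
      with False show ?thesis by (simp add: Suc_diff_le)
    qed
    have 2: "symfun n (Suc b - l) (\<lambda>y :: nat \<Rightarrow> 'a. remainder_coeff n b (n - 1) y * esym n (n - l) y)"
    proof (cases "b < n - 1")
      case True
      then show ?thesis using last by (simp add: symfun_const)
    next
      case False
      then have "symfun n ((b - (n - 1)) + (n - l))
          (\<lambda>y :: nat \<Rightarrow> 'a. remainder_coeff n b (n - 1) y * esym n (n - l) y)"
        using last by (intro symfun_mult symfun_esym) auto
      moreover have "(b - (n - 1)) + (n - l) = Suc b - l"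
        using False Suc.prems by auto
      ultimately show ?thesis by simp
    qed
    show "symfun n (Suc b - l) (remainder_coeff n (Suc b) l :: (nat \<Rightarrow> 'a) \<Rightarrow> 'a)"
      using symfun_diff[OF 1 2] by simp
  qed
qed

text \<open>Modulo the polynomial with roots \<open>y 1\<close>, ..., \<open>y n\<close> every power
  is a combination of powers below \<open>n\<close>, so the alternant matrix is \<open>C\<close>
  times a Vandermonde matrix. The quotient is the explicit determinant of \<open>C\<close>, which
  shows symmetry and degree without any division of polynomials.\<close>

lemma alternant_eq_vandermonde_mult:
  assumes b: "weight n b \<le> d + (\<Sum>i=1..n. i - 1)"
  shows "\<exists>g. symfun n d g \<and> (\<forall>y :: nat \<Rightarrow> 'a::field.
    (\<Sum>p | p permutes {1..n}. of_int (sign p) * monomial n b (\<lambda>i. y (p i))) = vandermonde n y * g y)"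
proof -
  let ?r = "remainder_coeff n :: nat \<Rightarrow> nat \<Rightarrow> (nat \<Rightarrow> 'a) \<Rightarrow> 'a"
  define g where "g y = (\<Sum>p | p permutes {1..n}. of_int (sign p) * (\<Prod>i=1..n. ?r (b i) (p i - 1) y))" for y
  have "(\<Sum>p | p permutes {1..n}. of_int (sign p) * monomial n b (\<lambda>i. y (p i))) = vandermonde n y * g y" for y
  proof -
    define A where "A = mat n n (\<lambda>(i, j). y (Suc j) ^ b (Suc i))"
    define C where "C = mat n n (\<lambda>(i, l). ?r (b (Suc i)) l y)"
    define V where "V = mat n n (\<lambda>(l, j). y (Suc j) ^ l)"
    have "A = C * V"
    proof (rule eq_matI)
      fix i j assume "i < dim_row (C * V)" "j < dim_col (C * V)"
      then have ij: "i < n" "j < n" by (auto simp: C_def V_def)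
      then have "(C * V) $$ (i, j) = (\<Sum>l<n. ?r (b (Suc i)) l y * y (Suc j) ^ l)"
        by (simp add: C_def V_def scalar_prod_def atLeast0LessThan)
      also have "\<dots> = A $$ (i, j)"
        using ij power_eq_remainder[of "Suc j" n y "b (Suc i)"] by (simp add: A_def)
      finally show "A $$ (i, j) = (C * V) $$ (i, j)" ..
    qed (auto simp: A_def C_def V_def)
    then have "det A = det C * det V"
      by (simp add: C_def V_def det_mult[where n = n])
    moreover have "det V = vandermonde n y"
      unfolding V_def by (rule det_vandermonde)
    moreover have "det C = g y"
      using det_eq_sum_permutes[of n "\<lambda>i j. ?r (b i) (j - 1) y"] by (simp add: C_def g_def)
    moreover have "det A = (\<Sum>p | p permutes {1..n}. of_int (sign p) * monomial n b (\<lambda>i. y (p i)))"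
      using det_eq_sum_permutes[of n "\<lambda>i j. y j ^ b i"] by (simp add: A_def monomial_def)
    ultimately show ?thesis by simp
  qed
  moreover have "symfun n d g"
    unfolding g_def
  proof (rule symfun_sum, rule symfun_scale)
    fix p assume "p \<in> {p. p permutes {1..n}}"
    then have p: "p permutes {1..n}" by simp
    show "symfun n d (\<lambda>y. \<Prod>i=1..n. ?r (b i) (p i - 1) y)"
    proof (cases "\<exists>i\<in>{1..n}. b i < p i - 1")
      case True
      then obtain i where i: "i \<in> {1..n}" "b i < p i - 1" by blast
      have "p i \<in> {1..n}" using p i(1) by (simp only: permutes_in_image)
      then have "p i - 1 < n" by auto
      then have "?r (b i) (p i - 1) = (\<lambda>y. 0)"
        using symfun_remainder_coeff[of "p i - 1" n "b i"] i by blast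
      then have "(\<Prod>i=1..n. ?r (b i) (p i - 1) y) = 0" for y
        using i(1) by (intro prod_zero bexI[of _ i]) auto
      then show ?thesis by (simp only: symfun_const)
    next
      case False
      have "symfun n (\<Sum>i=1..n. b i - (p i - 1)) (\<lambda>y. \<Prod>i=1..n. ?r (b i) (p i - 1) y)"
      proof (rule symfun_prod)
        fix i assume i: "i \<in> {1..n}"
        then have "p i \<in> {1..n}" using p by (simp only: permutes_in_image)
        then have "p i - 1 < n" by auto
        moreover have "p i - 1 \<le> b i" using False i by (simp add: not_less)
        ultimately show "symfun n (b i - (p i - 1)) (?r (b i) (p i - 1))"
          using symfun_remainder_coeff[of "p i - 1" n "b i"] by blast
      qed
      \<comment> \<open>No difference truncates in this case, so a Leibniz term has degree
        \<open>weight n b\<close> minus the degree of the Vandermonde determinant, whatever the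
        permutation.\<close>
      moreover have "(\<Sum>i=1..n. b i - (p i - 1)) \<le> d"
      proof -
        have "(\<Sum>i=1..n. b i - (p i - 1)) + (\<Sum>i=1..n. p i - 1) = (\<Sum>i=1..n. b i)"
          unfolding sum.distrib[symmetric] by (rule sum.cong) (use False in \<open>auto simp: not_less\<close>)
        moreover have "(\<Sum>i=1..n. p i - 1) = (\<Sum>i=1..n. i - 1)"
          using sum.permute[OF p, of "\<lambda>i. i - 1"] by (simp add: o_def)
        ultimately show ?thesis using b by (simp add: weight_def)
      qed
      ultimately show ?thesis by (rule symfun_weaken)
    qed
  qed
  ultimately show ?thesis by blast
qed

lemma antisymmetrization_eq_vandermonde_mult:
  assumes "polyfun n (d + (\<Sum>i=1..n. i - 1)) F"
  shows "\<exists>g. symfun n d g \<and> (\<forall>y :: nat \<Rightarrow> 'a::field.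
    (\<Sum>p | p permutes {1..n}. of_int (sign p) * F (\<lambda>i. y (p i)))
    = vandermonde n y * g y)"
  using assms
proof (induction rule: polyfun.induct)
  case (polyfun_monomial b c)
  then obtain g where "symfun n d g"
    "\<And>y :: nat \<Rightarrow> 'a. (\<Sum>p | p permutes {1..n}. of_int (sign p) * monomial n b (\<lambda>i. y (p i))) = vandermonde n y * g y"
    using alternant_eq_vandermonde_mult[of n b d] by blast
  then show ?case
    by (intro exI[of _ "\<lambda>y. c * g y"])
      (simp add: symfun_scale mult.left_commute[of _ c] flip: sum_distrib_left)
next
  case (polyfun_add F G)
  then obtain f g where "symfun n d f" "symfun n d g"
    "\<And>y. (\<Sum>p | p permutes {1..n}. of_int (sign p) * F (\<lambda>i. y (p i))) = vandermonde n y * f y"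
    "\<And>y. (\<Sum>p | p permutes {1..n}. of_int (sign p) * G (\<lambda>i. y (p i))) = vandermonde n y * g y"
    by blast
  then show ?case
    by (intro exI[of _ "\<lambda>y. f y + g y"]) (simp add: symfun_add distrib_left sum.distrib)
qed

section \<open>A difference operator\<close>

lemma prod_if_subset:
  assumes "finite A" "X \<subseteq> A"
  shows "(\<Prod>i\<in>X. f i) * (\<Prod>i\<in>A - X. g i) = (\<Prod>i\<in>A. if i \<in> X then f i else g i)"
proof -
  have "(\<Prod>i\<in>A. if i \<in> X then f i else g i) = (\<Prod>i\<in>A \<inter> {i. i \<in> X}. f i) * (\<Prod>i\<in>A \<inter> - {i. i \<in> X}. g i)"
    using assms(1) by (rule prod.If_cases)
  moreover have "A \<inter> {i. i \<in> X} = X" "A \<inter> - {i. i \<in> X} = A - X" using assms by auto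
  ultimately show ?thesis by simp
qed

text \<open>The operator in question is the sum over \<open>I\<close> of the weights times the
  Vandermonde determinant of \<open>row\<close> times \<open>f\<close> at \<open>arg\<close>,
  divided by the Vandermonde determinant of \<open>y\<close>. The exponent \<open>p\<close> is a
  power in a Vandermonde term, \<open>r\<close> one in a monomial of \<open>f\<close>. The
  assumption, made for all \<open>p\<close> and \<open>r\<close>, controls only the sum of the two
  cases; each alone may have poles.\<close>

locale shift_operator =
  fixes D :: "'x set" and y :: "'x \<Rightarrow> 'a::field"
    and wt :: "bool \<Rightarrow> 'x \<Rightarrow> 'a" and row :: "bool \<Rightarrow> 'x \<Rightarrow> 'a" and arg :: "bool \<Rightarrow> 'x \<Rightarrow> 'a"
  assumes one_variable: "\<exists>L. degree L \<le> p + r \<and> (\<forall>x\<in>D. poly L (y x) =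
    wt True x * row True x ^ p * arg True x ^ r + wt False x * row False x ^ p * arg False x ^ r)"
begin

text \<open>Only the diagonal term of the Vandermonde determinant of \<open>row\<close> is treated
  here. It factors over the rows, and expanding the product of two-term sums creates the sum over
  \<open>I\<close>. The other terms arise by antisymmetrization.\<close>

lemma polyfun_image:
  assumes "polyfun n d f"
  shows "\<exists>F. polyfun n (d + (\<Sum>i=1..n. i - 1)) F \<and> (\<forall>x. (\<forall>i\<in>{1..n}. x i \<in> D) \<longrightarrow>
    F (\<lambda>i. y (x i)) = (\<Sum>I\<in>Pow {1..n}. (\<Prod>i=1..n. wt (i \<in> I) (x i) * row (i \<in> I) (x i) ^ (i - 1))
      * f (\<lambda>i. arg (i \<in> I) (x i))))"
  using assms
proof (induction rule: polyfun.induct)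
  case (polyfun_monomial b c)
  obtain L where L: "\<And>p r. degree (L p r) \<le> p + r"
    "\<And>p r x. x \<in> D \<Longrightarrow> poly (L p r) (y x) =
      wt True x * row True x ^ p * arg True x ^ r + wt False x * row False x ^ p * arg False x ^ r"
    using one_variable by metis
  define F where "F z = c * (\<Prod>i=1..n. poly (L (i - 1) (b i)) (z i))" for z
  have "polyfun n (0 + (\<Sum>i=1..n. degree (L (i - 1) (b i)))) F"
    unfolding F_def by (intro polyfun_mult polyfun_const polyfun_prod polyfun_poly)
  moreover have "0 + (\<Sum>i=1..n. degree (L (i - 1) (b i))) \<le> d + (\<Sum>i=1..n. i - 1)"
  proof -
    have "(\<Sum>i=1..n. degree (L (i - 1) (b i))) \<le> (\<Sum>i=1..n. i - 1 + b i)"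
      by (intro sum_mono L)
    also have "\<dots> = (\<Sum>i=1..n. i - 1) + weight n b"
      unfolding sum.distrib weight_def ..
    finally show ?thesis using polyfun_monomial by simp
  qed
  ultimately have 1: "polyfun n (d + (\<Sum>i=1..n. i - 1)) F" by (rule polyfun_weaken)
  have "F (\<lambda>i. y (x i)) = (\<Sum>I\<in>Pow {1..n}. (\<Prod>i=1..n. wt (i \<in> I) (x i) * row (i \<in> I) (x i) ^ (i - 1))
      * (c * monomial n b (\<lambda>i. arg (i \<in> I) (x i))))" if x: "\<forall>i\<in>{1..n}. x i \<in> D" for x
  proof -
    let ?t = "\<lambda>e i. wt e (x i) * row e (x i) ^ (i - 1) * arg e (x i) ^ b i"
    have "(\<Prod>i=1..n. poly (L (i - 1) (b i)) (y (x i))) = (\<Prod>i=1..n. ?t True i + ?t False i)"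
      by (rule prod.cong) (use x L(2) in auto)
    also have "\<dots> = (\<Sum>I\<in>Pow {1..n}. (\<Prod>i\<in>I. ?t True i) * (\<Prod>i\<in>{1..n}-I. ?t False i))"
      by (rule prod_add) simp
    also have "\<dots> = (\<Sum>I\<in>Pow {1..n}. \<Prod>i=1..n. ?t (i \<in> I) i)"
      by (rule sum.cong) (auto simp: prod_if_subset intro!: prod.cong)
    finally show ?thesis
      by (simp add: F_def sum_distrib_left monomial_def prod.distrib mult_ac)
  qed
  with 1 show ?case by blast
next
  case (polyfun_add f g)
  then obtain F G where "polyfun n (d + (\<Sum>i=1..n. i - 1)) F" "polyfun n (d + (\<Sum>i=1..n. i - 1)) G"
    "\<And>x. (\<forall>i\<in>{1..n}. x i \<in> D) \<Longrightarrow>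
    F (\<lambda>i. y (x i)) = (\<Sum>I\<in>Pow {1..n}. (\<Prod>i=1..n. wt (i \<in> I) (x i) * row (i \<in> I) (x i) ^ (i - 1))
      * f (\<lambda>i. arg (i \<in> I) (x i)))"
    "\<And>x. (\<forall>i\<in>{1..n}. x i \<in> D) \<Longrightarrow>
    G (\<lambda>i. y (x i)) = (\<Sum>I\<in>Pow {1..n}. (\<Prod>i=1..n. wt (i \<in> I) (x i) * row (i \<in> I) (x i) ^ (i - 1))
      * g (\<lambda>i. arg (i \<in> I) (x i)))" by blast
  then show ?case
    by (intro exI[of _ "\<lambda>z. F z + G z"]) (simp add: polyfun.polyfun_add sum.distrib distrib_left)
qed

lemma vandermonde_eq_sum:
  "vandermonde n (z :: nat \<Rightarrow> 'a) =
    (\<Sum>p | p permutes {1..n}. of_int (sign p) * (\<Prod>i=1..n. z (p i) ^ (i - 1)))"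
  using det_eq_sum_permutes[of n "\<lambda>i j. z j ^ (i - 1)"] det_vandermonde[of n z] by simp

lemma symfun_image:
  assumes f: "symfun n d f"
  shows "\<exists>g. symfun n d g \<and> (\<forall>x. (\<forall>i\<in>{1..n}. x i \<in> D) \<longrightarrow>
    vandermonde n (\<lambda>i. y (x i)) * g (\<lambda>i. y (x i)) =
    (\<Sum>I\<in>Pow {1..n}. (\<Prod>i=1..n. wt (i \<in> I) (x i)) * vandermonde n (\<lambda>i. row (i \<in> I) (x i))
      * f (\<lambda>i. arg (i \<in> I) (x i))))"
proof -
  obtain F where F: "polyfun n (d + (\<Sum>i=1..n. i - 1)) F"
    "\<And>x. (\<forall>i\<in>{1..n}. x i \<in> D) \<Longrightarrow>
    F (\<lambda>i. y (x i)) = (\<Sum>I\<in>Pow {1..n}. (\<Prod>i=1..n. wt (i \<in> I) (x i) * row (i \<in> I) (x i) ^ (i - 1))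
      * f (\<lambda>i. arg (i \<in> I) (x i)))"
    using polyfun_image[OF symfun_imp_polyfun[OF f]] by blast
  obtain g where g: "symfun n d g"
    "\<And>z. (\<Sum>p | p permutes {1..n}. of_int (sign p) * F (\<lambda>i. z (p i))) = vandermonde n z * g z"
    using antisymmetrization_eq_vandermonde_mult[OF F(1)] by blast
  have "vandermonde n (\<lambda>i. y (x i)) * g (\<lambda>i. y (x i)) =
    (\<Sum>I\<in>Pow {1..n}. (\<Prod>i=1..n. wt (i \<in> I) (x i)) * vandermonde n (\<lambda>i. row (i \<in> I) (x i))
      * f (\<lambda>i. arg (i \<in> I) (x i)))" if x: "\<forall>i\<in>{1..n}. x i \<in> D" for x
  proof -
    let ?w = "\<lambda>I. \<Prod>i=1..n. wt (i \<in> I) (x i)"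
    let ?f = "\<lambda>I. f (\<lambda>i. arg (i \<in> I) (x i))"
    have F_term: "F (\<lambda>i. y (x (p i))) =
        (\<Sum>I\<in>Pow {1..n}. ?w I * (\<Prod>i=1..n. row (p i \<in> I) (x (p i)) ^ (i - 1)) * ?f I)"
      if p: "p permutes {1..n}" for p
    proof -
      have xp: "\<forall>i\<in>{1..n}. x (p i) \<in> D"
        using x permutes_in_image[OF p] by blast
      have "F (\<lambda>i. y (x (p i))) =
        (\<Sum>I\<in>Pow {1..n}. (\<Prod>i=1..n. wt (i \<in> I) (x (p i)) * row (i \<in> I) (x (p i)) ^ (i - 1))
          * f (\<lambda>i. arg (i \<in> I) (x (p i))))"
        using F(2)[OF xp] .
      \<comment> \<open>A permutation of the points is absorbed by replacing \<open>I\<close> by its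
        image. Afterwards the weights and \<open>f\<close> do not depend on \<open>p\<close>, and
        the signed sum rebuilds the Vandermonde determinant of \<open>row\<close>.\<close>
      also have "\<dots> = (\<Sum>I\<in>Pow {1..n}. (\<Prod>i=1..n. wt (p i \<in> I) (x (p i)) * row (p i \<in> I) (x (p i)) ^ (i - 1))
          * f (\<lambda>i. arg (p i \<in> I) (x (p i))))"
      proof (rule sum.reindex_bij_witness[of _ "\<lambda>I. Hilbert_Choice.inv p ` I" "\<lambda>I. p ` I"])
        fix I assume I: "I \<in> Pow {1..n}"
        show "Hilbert_Choice.inv p ` p ` I = I" "p ` Hilbert_Choice.inv p ` I = I"
          using p by (auto simp: image_image permutes_inverses)
        show "p ` I \<in> Pow {1..n}" "Hilbert_Choice.inv p ` I \<in> Pow {1..n}"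
          using I image_mono[of I "{1..n}"] permutes_image[OF p] permutes_image[OF permutes_inv[OF p]]
          by (metis PowD PowI)+
        have "p i \<in> p ` I \<longleftrightarrow> i \<in> I" for i
          using permutes_inj[OF p] by (auto dest: injD)
        then show "(\<Prod>i=1..n. wt (p i \<in> p ` I) (x (p i)) * row (p i \<in> p ` I) (x (p i)) ^ (i - 1))
          * f (\<lambda>i. arg (p i \<in> p ` I) (x (p i))) =
          (\<Prod>i=1..n. wt (i \<in> I) (x (p i)) * row (i \<in> I) (x (p i)) ^ (i - 1))
          * f (\<lambda>i. arg (i \<in> I) (x (p i)))" by simp
      qed
      also have "\<dots> = (\<Sum>I\<in>Pow {1..n}. ?w I * (\<Prod>i=1..n. row (p i \<in> I) (x (p i)) ^ (i - 1)) * ?f I)"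
      proof (rule sum.cong)
        fix I
        have "f (\<lambda>i. arg (p i \<in> I) (x (p i))) = ?f I"
          using symfun_permutes[OF f p, of "\<lambda>i. arg (i \<in> I) (x i)"] .
        moreover have "(\<Prod>i=1..n. wt (p i \<in> I) (x (p i))) = ?w I"
          using prod.permute[OF p, of "\<lambda>i. wt (i \<in> I) (x i)"] by (simp add: o_def)
        ultimately show "(\<Prod>i=1..n. wt (p i \<in> I) (x (p i)) * row (p i \<in> I) (x (p i)) ^ (i - 1))
          * f (\<lambda>i. arg (p i \<in> I) (x (p i))) = ?w I * (\<Prod>i=1..n. row (p i \<in> I) (x (p i)) ^ (i - 1)) * ?f I"
          by (simp add: prod.distrib)
      qed simp
      finally show ?thesis .
    qed
    have "vandermonde n (\<lambda>i. y (x i)) * g (\<lambda>i. y (x i)) =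
      (\<Sum>p | p permutes {1..n}. of_int (sign p) * F (\<lambda>i. y (x (p i))))"
      using g(2)[of "\<lambda>i. y (x i)"] by simp
    also have "\<dots> = (\<Sum>p | p permutes {1..n}. \<Sum>I\<in>Pow {1..n}.
        of_int (sign p) * (?w I * (\<Prod>i=1..n. row (p i \<in> I) (x (p i)) ^ (i - 1)) * ?f I))"
      by (rule sum.cong) (auto simp: F_term sum_distrib_left)
    also have "\<dots> = (\<Sum>I\<in>Pow {1..n}. \<Sum>p | p permutes {1..n}.
        of_int (sign p) * (?w I * (\<Prod>i=1..n. row (p i \<in> I) (x (p i)) ^ (i - 1)) * ?f I))"
      by (rule sum.swap)
    also have "\<dots> = (\<Sum>I\<in>Pow {1..n}. ?w I * vandermonde n (\<lambda>i. row (i \<in> I) (x i)) * ?f I)"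
      by (rule sum.cong) (auto simp: vandermonde_eq_sum sum_distrib_left sum_distrib_right mult_ac)
    finally show ?thesis .
  qed
  with g(1) show ?thesis by blast
qed

end


section \<open>Injective grids and functions dual to a partition\<close>

definition grid_point :: "nat \<Rightarrow> (nat \<Rightarrow> nat \<Rightarrow> 'a) \<Rightarrow> (nat \<Rightarrow> nat) \<Rightarrow> nat \<Rightarrow> 'a" where
  "grid_point n Y \<nu> = (\<lambda>i. Y (\<nu> i) (n - i))"

definition inj_grid :: "(nat \<Rightarrow> nat \<Rightarrow> 'a) \<Rightarrow> bool" where
  "inj_grid Y \<longleftrightarrow> (\<forall>k m k' m'. Y k m = Y k' m' \<longrightarrow> k = k' \<and> m = m')"

text \<open>The interpolation polynomial up to a nonzero scalar. With the scale left open, the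
  difference operator maps such functions to such functions; by \<open>dual_at_unique\<close>
  nothing but the scale is open.\<close>

definition dual_at :: "nat \<Rightarrow> (nat \<Rightarrow> nat \<Rightarrow> 'a::field) \<Rightarrow> (nat \<Rightarrow> nat) \<Rightarrow> ((nat \<Rightarrow> 'a) \<Rightarrow> 'a) \<Rightarrow> bool" where
  "dual_at n Y \<mu> f \<longleftrightarrow> symfun n (weight n \<mu>) f \<and> f (grid_point n Y \<mu>) \<noteq> 0 \<and>
    (\<forall>\<nu>\<in>partitions n. weight n \<nu> \<le> weight n \<mu> \<longrightarrow> \<nu> \<noteq> \<mu> \<longrightarrow> f (grid_point n Y \<nu>) = 0)"

lemma vandermonde_eq_0:
  assumes "1 \<le> i" "i < j" "j \<le> n" "z i = z j"
  shows "vandermonde n z = 0"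
proof -
  have "(\<Prod>i=1..<j. z j - z i) = 0"
    using assms by (intro prod_zero bexI[of _ i]) auto
  moreover have "j \<in> {1..n}" using assms by auto
  ultimately show ?thesis
    unfolding vandermonde_def by (meson prod_zero finite_atLeastAtMost)
qed

lemma vandermonde_nonzero:
  assumes "\<And>i j. 1 \<le> i \<Longrightarrow> i < j \<Longrightarrow> j \<le> n \<Longrightarrow> z i \<noteq> z j"
  shows "vandermonde n z \<noteq> 0"
  using assms by (fastforce simp: vandermonde_def)

lemma vandermonde_Suc:
  "vandermonde (Suc n) z = vandermonde n z * (\<Prod>i=1..n. z (Suc n) - z i)"
  by (simp add: vandermonde_def atLeastLessThanSuc_atLeastAtMost del: prod.op_ivl_Suc)

lemma vandermonde_cong:
  "(\<And>i. i \<in> {1..n} \<Longrightarrow> y i = z i) \<Longrightarrow> vandermonde n y = vandermonde n z"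
  unfolding vandermonde_def by (intro prod.cong refl) auto

lemma partitionsI:
  assumes "\<And>i. 1 \<le> i \<Longrightarrow> i < n \<Longrightarrow> \<nu> (Suc i) \<le> \<nu> i" "\<And>i. i \<notin> {1..n} \<Longrightarrow> \<nu> i = 0"
  shows "\<nu> \<in> partitions n"
proof -
  have "\<nu> j \<le> \<nu> i" if "i \<le> j" "1 \<le> i" "j \<le> n" for i j
    using that(1) that(2,3)
  proof (induction j rule: dec_induct)
    case (step j)
    then show ?case using assms(1)[of j] by auto
  qed simp
  then show ?thesis using assms(2) by (auto simp: partitions_def)
qed

lemma partitions_antimono: "\<nu> \<in> partitions n \<Longrightarrow> 1 \<le> i \<Longrightarrow> i \<le> j \<Longrightarrow> j \<le> n \<Longrightarrow> \<nu> j \<le> \<nu> i"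
  by (auto simp: partitions_def)

lemma partitions_outside: "\<nu> \<in> partitions n \<Longrightarrow> i \<notin> {1..n} \<Longrightarrow> \<nu> i = 0"
  by (auto simp: partitions_def)

lemma vandermonde_grid_point_nonzero:
  "inj_grid Y \<Longrightarrow> vandermonde n (grid_point n Y \<nu>) \<noteq> 0"
  by (intro vandermonde_nonzero) (auto simp: inj_grid_def grid_point_def, metis diff_is_0_eq diff_less_mono2 less_irrefl not_less order.strict_trans1)

text \<open>Eliminates \<open>f\<close> from two evaluations by cross multiplication, without
  dividing by \<open>f\<close> or by the common factors \<open>P\<close> and
  \<open>R\<close>.\<close>

lemma cross_cancel:
  fixes V :: "'a::field"
  assumes "V * a * g = P * w * (R * r) * f" "V * a' * g' = P * w' * (R * r') * f"
  shows "V * (g' * (w * (r * a'))) = V * (g * (w' * (r' * a)))"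
proof -
  have "V * (g' * (w * (r * a'))) = (V * a' * g') * (w * r)" by (simp add: mult_ac)
  also have "\<dots> = (V * a * g) * (w' * r')" unfolding assms by (simp add: mult_ac)
  finally show ?thesis by (simp add: mult_ac)
qed

text \<open>The elements \<open>True\<close> and \<open>False\<close> of \<open>bool\<close> stand for removing a box from a row and for keeping the row.\<close>

locale grid_operator =
  shift_operator UNIV "\<lambda>(k, m). Y k m" wt row arg
  for Y :: "nat \<Rightarrow> nat \<Rightarrow> 'a::field_char_0" and wt row arg :: "bool \<Rightarrow> nat \<times> nat \<Rightarrow> 'a" +
  fixes Y' :: "nat \<Rightarrow> nat \<Rightarrow> 'a"
  assumes inj: "inj_grid Y"
    and arg_False: "arg False (k, m) = Y' k m"
    and arg_True: "arg True (Suc k, m) = Y' k m"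
    and row_True: "row True (k, Suc m) = row False (k, m)"
    and row_inj: "inj_grid (\<lambda>k m. row False (k, m))"
    and wt_True: "wt True (0, 0) = 0"
    and wt_False: "wt False (k, m) = 0 \<longleftrightarrow> k = 1 \<and> m = 0"
begin

text \<open>If row \<open>i\<close> loses a box and the equally long row \<open>Suc i\<close> does
  not, \<open>row_True\<close> makes two arguments of the Vandermonde determinant equal. So if an
  empty row loses a box, all rows below it do as well, down to the last one, where
  \<open>wt True (0, 0) = 0\<close>.\<close>

lemma remove_boxes:
  assumes \<nu>: "\<nu> \<in> partitions n" and I: "I \<subseteq> {1..n}"
    and wt: "(\<Prod>i=1..n. wt (i \<in> I) (\<nu> i, n - i)) \<noteq> 0"
    and vd: "vandermonde n (\<lambda>i. row (i \<in> I) (\<nu> i, n - i)) \<noteq> 0"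
  defines "\<nu>' \<equiv> \<lambda>i. \<nu> i - (if i \<in> I then 1 else 0)"
  shows "\<nu>' \<in> partitions n" "weight n \<nu>' + card I = weight n \<nu>"
    "\<And>i. i \<in> {1..n} \<Longrightarrow> arg (i \<in> I) (\<nu> i, n - i) = grid_point n Y' \<nu>' i"
proof -
  have next_in: "Suc i \<in> I" if "i \<in> I" "i < n" "\<nu> (Suc i) = \<nu> i" for i
  proof (rule ccontr)
    assume "Suc i \<notin> I"
    moreover have "n - i = Suc (n - Suc i)" using that by simp
    ultimately have "row (i \<in> I) (\<nu> i, n - i) = row (Suc i \<in> I) (\<nu> (Suc i), n - Suc i)"
      using that row_True by simp
    then have "vandermonde n (\<lambda>i. row (i \<in> I) (\<nu> i, n - i)) = 0"
      using that I by (intro vandermonde_eq_0[of i "Suc i"]) auto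
    with vd show False ..
  qed
  have pos: "0 < \<nu> i" if "i \<in> I" for i
  proof (rule ccontr)
    assume "\<not> 0 < \<nu> i"
    have "i \<le> n" using that I by auto
    have "n \<in> I \<and> \<nu> n = 0"
      using \<open>i \<le> n\<close>
    proof (induction rule: dec_induct)
      case base
      then show ?case using that \<open>\<not> 0 < \<nu> i\<close> by simp
    next
      case (step j)
      then have "\<nu> (Suc j) = 0" using partitions_antimono[OF \<nu>, of j "Suc j"] I by fastforce
      then show ?case using next_in[of j] step by simp
    qed
    then have "wt (n \<in> I) (\<nu> n, n - n) = 0" using wt_True by simp
    then have "(\<Prod>i=1..n. wt (i \<in> I) (\<nu> i, n - i)) = 0"
      using that I by (intro prod_zero bexI[of _ n]) auto
    with wt show False ..
  qed
  show "\<nu>' \<in> partitions n"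
  proof (rule partitionsI)
    fix i assume i: "1 \<le> i" "i < n"
    have "\<nu> (Suc i) \<le> \<nu> i" using partitions_antimono[OF \<nu>, of i "Suc i"] i by simp
    then show "\<nu>' (Suc i) \<le> \<nu>' i"
      unfolding \<nu>'_def using next_in[of i] i by (cases "\<nu> (Suc i) = \<nu> i") auto
  qed (auto simp: \<nu>'_def partitions_outside[OF \<nu>])
  have "weight n \<nu>' + (\<Sum>i=1..n. if i \<in> I then 1 else 0) = weight n \<nu>"
    unfolding weight_def sum.distrib[symmetric]
    by (rule sum.cong) (use pos in \<open>auto simp: \<nu>'_def\<close>)
  also have "(\<Sum>i=1..n. if i \<in> I then 1 else 0) = card ({1..n} \<inter> I)"
    by (simp flip: sum.inter_restrict)
  also have "{1..n} \<inter> I = I" using I by auto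
  finally show "weight n \<nu>' + card I = weight n \<nu>" .
  show "arg (i \<in> I) (\<nu> i, n - i) = grid_point n Y' \<nu>' i" if "i \<in> {1..n}" for i
  proof (cases "i \<in> I")
    case True
    then obtain k where "\<nu> i = Suc k" using pos by (metis gr0_implies_Suc)
    then show ?thesis using True by (simp add: grid_point_def \<nu>'_def arg_True)
  next
    case False
    then show ?thesis by (simp add: grid_point_def \<nu>'_def arg_False)
  qed
qed

text \<open>The image \<open>g\<close> has one surviving summand at \<mu>, for
  \<open>I = {}\<close>, and one at \<mu> with the new box, for \<open>I = {Suc n}\<close>. Both
  contain the same value of \<open>f\<close>, namely the one at \<mu>, so the quotient of the two
  values of \<open>g\<close> is explicit. It is stated multiplied out.\<close>

lemma dual_at_image:
  assumes \<mu>: "\<mu> \<in> partitions (Suc n)" "\<mu> (Suc n) = 0"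
    and lam: "\<mu>(Suc n := 1) \<in> partitions (Suc n)"
    and f: "dual_at (Suc n) Y' \<mu> f"
  shows "\<exists>g. dual_at (Suc n) Y \<mu> g \<and>
    g (grid_point (Suc n) Y (\<mu>(Suc n := 1))) * (wt False (0, 0) * (\<Prod>i=1..n.
      (row False (0, 0) - row False (\<mu> i, Suc n - i)) * (Y 1 0 - Y (\<mu> i) (Suc n - i)))) =
    g (grid_point (Suc n) Y \<mu>) * (wt True (1, 0) * (\<Prod>i=1..n.
      (row True (1, 0) - row False (\<mu> i, Suc n - i)) * (Y 0 0 - Y (\<mu> i) (Suc n - i))))"
proof -
  let ?N = "Suc n" and ?d = "weight (Suc n) \<mu>"
  define lam where "lam = \<mu>(Suc n := 1)"
  have f_sym: "symfun ?N ?d f" and f_\<mu>: "f (grid_point ?N Y' \<mu>) \<noteq> 0"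
    and f_0: "\<And>\<nu>. \<nu> \<in> partitions ?N \<Longrightarrow> weight ?N \<nu> \<le> ?d \<Longrightarrow> \<nu> \<noteq> \<mu> \<Longrightarrow> f (grid_point ?N Y' \<nu>) = 0"
    using f by (auto simp: dual_at_def)
  let ?w = "\<lambda>\<nu> I. \<Prod>i=1..?N. wt (i \<in> I) (\<nu> i, ?N - i)"
  let ?v = "\<lambda>\<nu> I. vandermonde ?N (\<lambda>i. row (i \<in> I) (\<nu> i, ?N - i))"
  let ?f = "\<lambda>\<nu> I. f (\<lambda>i. arg (i \<in> I) (\<nu> i, ?N - i))"
  let ?t = "\<lambda>\<nu> I. ?w \<nu> I * ?v \<nu> I * ?f \<nu> I"
  obtain g where g: "symfun ?N ?d g"
    "\<And>\<nu>. vandermonde ?N (grid_point ?N Y \<nu>) * g (grid_point ?N Y \<nu>) = (\<Sum>I\<in>Pow {1..?N}. ?t \<nu> I)"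
  proof -
    obtain g where "symfun ?N ?d g" "\<And>x. vandermonde ?N (\<lambda>i. case x i of (k, m) \<Rightarrow> Y k m) *
      g (\<lambda>i. case x i of (k, m) \<Rightarrow> Y k m) =
      (\<Sum>I\<in>Pow {1..?N}. (\<Prod>i=1..?N. wt (i \<in> I) (x i)) * vandermonde ?N (\<lambda>i. row (i \<in> I) (x i))
      * f (\<lambda>i. arg (i \<in> I) (x i)))"
      using symfun_image[OF f_sym] by auto
    from this(1) this(2)[of "\<lambda>i. (_ i, ?N - i)"] show ?thesis
      by (intro that[of g]) (simp_all add: grid_point_def)
  qed
  \<comment> \<open>In both cases of the condition, removing the boxes leaves a partition of weight
    at most \<open>?d\<close> other than \<mu>, and \<open>f\<close> vanishes there.\<close>
  have term_0: "?t \<nu> I = 0"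
    if \<nu>: "\<nu> \<in> partitions ?N" and I: "I \<subseteq> {1..?N}" and "weight ?N \<nu> < ?d + card I \<or> weight ?N \<nu> = ?d \<and> \<nu> \<noteq> \<mu>"
    for \<nu> I
  proof (rule ccontr)
    assume t: "?t \<nu> I \<noteq> 0"
    then have nz: "?w \<nu> I \<noteq> 0" "?v \<nu> I \<noteq> 0" "?f \<nu> I \<noteq> 0" by auto
    define \<nu>' where "\<nu>' = (\<lambda>i. \<nu> i - (if i \<in> I then 1 else 0))"
    note rb = remove_boxes[OF \<nu> I nz(1,2), folded \<nu>'_def]
    have "finite I" using I finite_subset by blast
    have "?f \<nu> I = f (grid_point ?N Y' \<nu>')"
      by (rule symfun_cong[OF f_sym rb(3)])
    moreover have "weight ?N \<nu>' \<le> ?d \<and> \<nu>' \<noteq> \<mu>"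
    proof (cases "I = {}")
      case True
      then have "\<nu>' = \<nu>" by (simp add: \<nu>'_def)
      then show ?thesis using that(3) True by auto
    next
      case False
      then have "0 < card I" using \<open>finite I\<close> by (simp add: card_gt_0_iff)
      then have "weight ?N \<nu>' < ?d" using that(3) rb(2) by auto
      then show ?thesis by auto
    qed
    ultimately show False using f_0[OF rb(1)] nz(3) by auto
  qed
  have vanish: "g (grid_point ?N Y \<nu>) = 0"
    if "\<nu> \<in> partitions ?N" "weight ?N \<nu> \<le> ?d" "\<nu> \<noteq> \<mu>" for \<nu>
  proof -
    have "(\<Sum>I\<in>Pow {1..?N}. ?t \<nu> I) = 0"
    proof (rule sum.neutral, intro ballI)
      fix I assume "I \<in> Pow {1..?N}"
      then show "?t \<nu> I = 0" using that by (intro term_0) auto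
    qed
    then show ?thesis using g(2)[of \<nu>] vandermonde_grid_point_nonzero[OF inj] by simp
  qed
  define P where "P = (\<Prod>i=1..n. wt False (\<mu> i, ?N - i))"
  define VY where "VY = vandermonde n (grid_point ?N Y \<mu>)"
  define VR where "VR = vandermonde n (\<lambda>i. row False (\<mu> i, ?N - i))"
  have P0: "P \<noteq> 0"
    unfolding P_def using wt_False by (auto simp: Suc_diff_le)
  have "VY \<noteq> 0"
    using vandermonde_grid_point_nonzero[OF inj, of ?N \<mu>] by (auto simp: VY_def vandermonde_Suc)
  have vR: "vandermonde ?N (\<lambda>i. row False (\<mu> i, ?N - i)) \<noteq> 0"
    using vandermonde_grid_point_nonzero[OF row_inj, of ?N \<mu>] by (simp add: grid_point_def)
  have at_\<mu>: "VY * (\<Prod>i=1..n. Y 0 0 - Y (\<mu> i) (?N - i)) * g (grid_point ?N Y \<mu>) =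
    P * wt False (0, 0) * (VR * (\<Prod>i=1..n. row False (0, 0) - row False (\<mu> i, ?N - i))) * f (grid_point ?N Y' \<mu>)"
  proof -
    have "(\<Sum>I\<in>Pow {1..?N}. ?t \<mu> I) = (\<Sum>I\<in>{{}}. ?t \<mu> I)"
    proof (rule sum.mono_neutral_right)
      show "\<forall>I\<in>Pow {1..?N} - {{}}. ?t \<mu> I = 0"
      proof
        fix I assume I: "I \<in> Pow {1..?N} - {{}}"
        then have "finite I" using finite_subset by blast
        with I have "0 < card I" by (simp add: card_gt_0_iff)
        then show "?t \<mu> I = 0" using I \<mu> by (intro term_0) auto
      qed
    qed auto
    also have "\<dots> = P * wt False (0, 0) * (VR * (\<Prod>i=1..n. row False (0, 0) - row False (\<mu> i, ?N - i))) * ?f \<mu> {}"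
      using \<mu>(2) by (simp add: P_def VR_def vandermonde_Suc)
    also have "?f \<mu> {} = f (grid_point ?N Y' \<mu>)"
      by (simp add: grid_point_def arg_False)
    finally show ?thesis
      using g(2)[of \<mu>] \<mu>(2) by (simp add: vandermonde_Suc VY_def grid_point_def mult.assoc)
  qed
  have at_lam: "VY * (\<Prod>i=1..n. Y 1 0 - Y (\<mu> i) (?N - i)) * g (grid_point ?N Y lam) =
    P * wt True (1, 0) * (VR * (\<Prod>i=1..n. row True (1, 0) - row False (\<mu> i, ?N - i))) * f (grid_point ?N Y' \<mu>)"
  proof -
    have lam_part: "lam \<in> partitions ?N" using lam by (simp add: lam_def)
    have lam_weight: "weight ?N lam = ?d + 1" using \<mu>(2) by (simp add: weight_def lam_def)
    have "(\<Sum>I\<in>Pow {1..?N}. ?t lam I) = (\<Sum>I\<in>{{?N}}. ?t lam I)"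
    proof (rule sum.mono_neutral_right)
      show "\<forall>I\<in>Pow {1..?N} - {{?N}}. ?t lam I = 0"
      proof
        fix I assume I: "I \<in> Pow {1..?N} - {{?N}}"
        show "?t lam I = 0"
        \<comment> \<open>If \<open>I\<close> contains \<open>?N\<close> and a further row, at least
          two boxes are removed and the weight drops below that of \<mu>. If \<open>?N\<close> is
          not in \<open>I\<close>, the last row of length 1 is kept, and that is the zero of
          \<open>wt False\<close>.\<close>
        proof (cases "?N \<in> I")
          case True
          have "finite I" using I finite_subset by blast
          moreover have "card {?N} < card I"
            by (rule psubset_card_mono) (use True I \<open>finite I\<close> in auto)
          ultimately show ?thesis using I lam_weight by (intro term_0[OF lam_part]) auto
        next
          case False
          then have "wt (?N \<in> I) (lam ?N, ?N - ?N) = 0" using wt_False by (simp add: lam_def)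
          then have "?w lam I = 0" by (intro prod_zero bexI[of _ ?N]) auto
          then show ?thesis by simp
        qed
      qed
    qed auto
    also have "\<dots> = P * wt True (1, 0) * (VR * (\<Prod>i=1..n. row True (1, 0) - row False (\<mu> i, ?N - i))) * ?f lam {?N}"
    proof -
      have "?w lam {?N} = P * wt True (1, 0)"
        by (simp add: P_def lam_def)
      moreover have "?v lam {?N} = VR * (\<Prod>i=1..n. row True (1, 0) - row False (\<mu> i, ?N - i))"
        unfolding vandermonde_Suc VR_def
        by (intro arg_cong2[of _ _ _ _ "(*)"] vandermonde_cong prod.cong) (auto simp: lam_def)
      ultimately show ?thesis by simp
    qed
    also have "?f lam {?N} = f (grid_point ?N Y' \<mu>)"
      by (rule symfun_cong[OF f_sym])
        (use \<mu>(2) arg_True[of 0] in \<open>auto simp: grid_point_def arg_False lam_def\<close>)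
    finally have "vandermonde ?N (grid_point ?N Y lam) * g (grid_point ?N Y lam) =
      P * wt True (1, 0) * (VR * (\<Prod>i=1..n. row True (1, 0) - row False (\<mu> i, ?N - i))) * f (grid_point ?N Y' \<mu>)"
      unfolding g(2)[of lam] .
    also have "vandermonde ?N (grid_point ?N Y lam) = VY * (\<Prod>i=1..n. Y 1 0 - Y (\<mu> i) (?N - i))"
      unfolding vandermonde_Suc VY_def
      by (intro arg_cong2[of _ _ _ _ "(*)"] vandermonde_cong prod.cong) (auto simp: lam_def grid_point_def)
    finally show ?thesis .
  qed
  have "g (grid_point ?N Y \<mu>) \<noteq> 0"
    using at_\<mu> P0 f_\<mu> vR \<mu>(2) wt_False[of 0 0] by (auto simp: VR_def vandermonde_Suc)
  with g(1) vanish have "dual_at ?N Y \<mu> g" by (simp add: dual_at_def)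
  moreover have "VY * (g (grid_point ?N Y lam) * (wt False (0, 0) * (\<Prod>i=1..n.
      (row False (0, 0) - row False (\<mu> i, ?N - i)) * (Y 1 0 - Y (\<mu> i) (?N - i))))) =
    VY * (g (grid_point ?N Y \<mu>) * (wt True (1, 0) * (\<Prod>i=1..n.
      (row True (1, 0) - row False (\<mu> i, ?N - i)) * (Y 0 0 - Y (\<mu> i) (?N - i)))))"
    unfolding prod.distrib by (rule cross_cancel[OF at_\<mu> at_lam])
  ultimately show ?thesis
    using \<open>VY \<noteq> 0\<close> unfolding lam_def by auto
qed

end

section \<open>Monic interpolation functions\<close>

text \<open>Vanishing outside \<open>{1..n}\<close> makes distinct elements distinct monomials, so
  that coefficients can be unique.\<close>

definition exponents :: "nat \<Rightarrow> nat \<Rightarrow> (nat \<Rightarrow> nat) set" where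
  "exponents n d = {b. (\<forall>i. i \<notin> {1..n} \<longrightarrow> b i = 0) \<and> weight n b \<le> d}"

definition expansion :: "nat \<Rightarrow> nat \<Rightarrow> ((nat \<Rightarrow> nat) \<Rightarrow> 'a) \<Rightarrow> (nat \<Rightarrow> 'a::field) \<Rightarrow> 'a" where
  "expansion n d c y = (\<Sum>b\<in>exponents n d. c b * monomial n b y)"

lemma le_weight: "i \<in> {1..n} \<Longrightarrow> b i \<le> weight n b"
  unfolding weight_def by (rule member_le_sum) auto

lemma finite_exponents [simp]: "finite (exponents n d)"
proof (rule finite_subset)
  show "exponents n d \<subseteq> {b. \<forall>i. (i \<in> {1..n} \<longrightarrow> b i \<in> {..d}) \<and> (i \<notin> {1..n} \<longrightarrow> b i = 0)}"
  proof
    fix b assume "b \<in> exponents n d"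
    then have b: "\<And>i. i \<notin> {1..n} \<Longrightarrow> b i = 0" "weight n b \<le> d" by (auto simp: exponents_def)
    have "b i \<le> d" if "i \<in> {1..n}" for i
      using le_weight[OF that, of b] b(2) by (rule order_trans)
    with b(1) show "b \<in> {b. \<forall>i. (i \<in> {1..n} \<longrightarrow> b i \<in> {..d}) \<and> (i \<notin> {1..n} \<longrightarrow> b i = 0)}" by blast
  qed
qed (rule finite_set_of_finite_funs, auto)

lemma partitions_exponents: "\<nu> \<in> partitions n \<Longrightarrow> weight n \<nu> \<le> d \<Longrightarrow> \<nu> \<in> exponents n d"
  by (auto simp: partitions_def exponents_def)

lemma finite_partitions [simp]: "finite {\<nu> \<in> partitions n. weight n \<nu> \<le> d}"
  by (rule finite_subset[OF _ finite_exponents[of n d]]) (auto intro: partitions_exponents)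

lemma monomial_cong: "(\<And>i. i \<in> {1..n} \<Longrightarrow> b i = b' i) \<Longrightarrow> monomial n b y = monomial n b' y"
  unfolding monomial_def by (rule prod.cong) auto

lemma weight_cong: "(\<And>i. i \<in> {1..n} \<Longrightarrow> b i = b' i) \<Longrightarrow> weight n b = weight n b'"
  unfolding weight_def by (rule sum.cong) auto

lemma polyfun_expansion:
  "polyfun n d f \<Longrightarrow> \<exists>c. f = expansion n d c"
proof (induction rule: polyfun.induct)
  case (polyfun_monomial b c)
  define b' where "b' = (\<lambda>i. if i \<in> {1..n} then b i else 0)"
  have "b' \<in> exponents n d"
    using polyfun_monomial weight_cong[of n b b'] by (auto simp: exponents_def b'_def)
  moreover have "monomial n b' = (monomial n b :: (nat \<Rightarrow> 'a) \<Rightarrow> 'a)"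
    by (intro ext monomial_cong) (simp add: b'_def)
  ultimately show ?case
    by (intro exI[of _ "\<lambda>x. if x = b' then c else 0"])
      (auto simp: expansion_def if_distrib[of "\<lambda>x. x * _"] cong: if_cong)
next
  case (polyfun_add f g)
  then obtain c c' where "f = expansion n d c" "g = expansion n d c'" by blast
  then show ?case
    by (intro exI[of _ "\<lambda>b. c b + c' b"]) (auto simp: expansion_def distrib_right sum.distrib)
qed

lemma expansion_mono:
  assumes "d \<le> e"
  shows "expansion n d c = expansion n e (\<lambda>b. if weight n b \<le> d then c b else 0)"
proof
  fix y
  show "expansion n d c y = expansion n e (\<lambda>b. if weight n b \<le> d then c b else 0) y"
    unfolding expansion_def
    by (rule sum.mono_neutral_cong_left[OF finite_exponents]) (use assms in \<open>auto simp: exponents_def\<close>)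
qed

lemma weight_Suc_fun_upd: "weight (Suc n) (b(Suc n := k)) = weight n b + k"
  using weight_cong[of n "b(Suc n := k)" b] by (simp add: weight_def)

lemma expansion_Suc:
  "expansion (Suc n) d c y =
    (\<Sum>k\<le>d. (\<Sum>b\<in>exponents n (d - k). c (b(Suc n := k)) * monomial n b y) * y (Suc n) ^ k)"
proof -
  have m: "monomial (Suc n) (b(Suc n := k)) y = monomial n b y * y (Suc n) ^ k" for b k
    using monomial_cong[of n "b(Suc n := k)" b y] by (simp add: monomial_def)
  have "expansion (Suc n) d c y = (\<Sum>(k, b)\<in>Sigma {..d} (\<lambda>k. exponents n (d - k)).
      c (b(Suc n := k)) * monomial (Suc n) (b(Suc n := k)) y)"
    unfolding expansion_def
  proof (rule sum.reindex_bij_witness[of _ "\<lambda>(k, b). b(Suc n := k)" "\<lambda>b. (b (Suc n), b(Suc n := 0))"])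
    fix b assume b: "b \<in> exponents (Suc n) d"
    have "weight (Suc n) ((b(Suc n := 0))(Suc n := b (Suc n))) = weight n (b(Suc n := 0)) + b (Suc n)"
      by (rule weight_Suc_fun_upd)
    then show "(b (Suc n), b(Suc n := 0)) \<in> Sigma {..d} (\<lambda>k. exponents n (d - k))"
      using b by (auto simp: exponents_def)
  next
    fix p assume "p \<in> Sigma {..d} (\<lambda>k. exponents n (d - k))"
    then show "(case p of (k, b) \<Rightarrow> b(Suc n := k)) \<in> exponents (Suc n) d"
      by (auto simp: exponents_def weight_Suc_fun_upd)
    show "((case p of (k, b) \<Rightarrow> b(Suc n := k)) (Suc n), (case p of (k, b) \<Rightarrow> b(Suc n := k))(Suc n := 0)) = p"
      using \<open>p \<in> _\<close> by (auto simp: exponents_def fun_eq_iff)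
  qed auto
  also have "\<dots> = (\<Sum>k\<le>d. \<Sum>b\<in>exponents n (d - k). c (b(Suc n := k)) * monomial (Suc n) (b(Suc n := k)) y)"
    by (rule sum.Sigma[symmetric]) auto
  finally show ?thesis
    by (simp add: m sum_distrib_right mult.assoc)
qed

text \<open>Coefficients are recovered from the function because a field of characteristic 0 is
  infinite. With all variables but the last one fixed, the expansion is a univariate polynomial that
  vanishes everywhere.\<close>

lemma expansion_eq_0:
  fixes c :: "(nat \<Rightarrow> nat) \<Rightarrow> 'a::field_char_0"
  assumes "\<And>y. expansion n d c y = 0" "b \<in> exponents n d"
  shows "c b = 0"
  using assms
proof (induction n arbitrary: d c b)
  case 0
  have "exponents 0 d = {\<lambda>_. 0}" by (auto simp: exponents_def weight_def)
  then show ?case using 0 by (simp add: expansion_def monomial_def)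
next
  case (Suc n)
  define k where "k = b (Suc n)"
  define b' where "b' = b(Suc n := 0)"
  have b: "b = b'(Suc n := k)" by (simp add: b'_def k_def)
  have "weight (Suc n) (b'(Suc n := k)) \<le> d"
    using Suc.prems(2) unfolding b[symmetric] by (simp add: exponents_def)
  then have "weight n b' + k \<le> d" by (simp only: weight_Suc_fun_upd)
  then have b': "b' \<in> exponents n (d - k)" and k: "k \<le> d"
    using Suc.prems(2) by (auto simp: exponents_def b'_def)
  have "expansion n (d - k) (\<lambda>b. c (b(Suc n := k))) y = 0" for y :: "nat \<Rightarrow> 'a"
  proof -
    define q where "q k = (\<Sum>b\<in>exponents n (d - k). c (b(Suc n := k)) * monomial n b y)" for k
    define p where "p = (\<Sum>k\<le>d. monom (q k) k)"
    have "poly p z = 0" for z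
    proof -
      have "monomial n b (y(Suc n := z)) = monomial n b y" for b
        unfolding monomial_def by (rule prod.cong) auto
      then have "expansion (Suc n) d c (y(Suc n := z)) = poly p z"
        by (simp add: expansion_Suc p_def q_def poly_sum poly_monom)
      then show ?thesis using Suc.prems(1) by simp
    qed
    then have "p = 0" by (simp flip: poly_all_0_iff_0)
    moreover have "coeff p k = q k" using k by (simp add: p_def coeff_sum)
    ultimately show ?thesis by (simp add: q_def expansion_def)
  qed
  from Suc.IH[OF this b'] show ?case by (simp add: b)
qed

lemma expansion_inject:
  fixes c :: "(nat \<Rightarrow> nat) \<Rightarrow> 'a::field_char_0"
  assumes "expansion n d c = expansion n d c'" "b \<in> exponents n d"
  shows "c b = c' b"
proof -
  have "expansion n d (\<lambda>b. c b - c' b) y = expansion n d c y - expansion n d c' y" for y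
    by (simp add: expansion_def left_diff_distrib sum_subtractf)
  then show ?thesis
    using expansion_eq_0[of n d "\<lambda>b. c b - c' b" b] assms by simp
qed

text \<open>For a partition \<mu> over a field of characteristic 0 the coefficient at \<mu> does not
  depend on the choice of \<open>c\<close>, by \<open>expansion_inject\<close>.\<close>

definition monic_at :: "nat \<Rightarrow> (nat \<Rightarrow> nat) \<Rightarrow> ((nat \<Rightarrow> 'a::field) \<Rightarrow> 'a) \<Rightarrow> bool" where
  "monic_at n \<mu> f \<longleftrightarrow> (\<exists>c. f = expansion n (weight n \<mu>) c \<and> c \<mu> = 1)"

definition interpolates :: "nat \<Rightarrow> (nat \<Rightarrow> nat \<Rightarrow> 'a::field) \<Rightarrow> (nat \<Rightarrow> nat) \<Rightarrow> ((nat \<Rightarrow> 'a) \<Rightarrow> 'a) \<Rightarrow> bool" where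
  "interpolates n Y \<mu> f \<longleftrightarrow> dual_at n Y \<mu> f \<and> monic_at n \<mu> f"

lemma expansion_add: "expansion n d (\<lambda>b. c b + c' b) y = expansion n d c y + expansion n d c' y"
  by (simp add: expansion_def distrib_right sum.distrib)

section \<open>Multiplication by a full column\<close>

lemma prod_diff_leading:
  assumes "n \<le> m"
  shows "\<exists>r. polyfun m (n - 1) r \<and> (\<forall>y :: nat \<Rightarrow> 'a::field.
    (\<Prod>i=1..n. y i - a) = (\<Prod>i=1..n. y i) + r y)"
  using assms
proof (induction n)
  case 0
  then show ?case by (auto intro!: exI[of _ "\<lambda>_. 0"] polyfun_const)
next
  case (Suc n)
  then obtain r where r: "polyfun m (n - 1) r"
    "\<And>y :: nat \<Rightarrow> 'a. (\<Prod>i=1..n. y i - a) = (\<Prod>i=1..n. y i) + r y" by auto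
  \<comment> \<open>For \<open>n = 0\<close> the bound \<open>n - 1\<close> truncates to 0, and
    \<open>r y * (y (Suc n) - a)\<close> would only get the bound 1 instead of 0. The case
    distinction avoids this, since \<open>r\<close> is then the zero function.\<close>
  have r': "polyfun m n (\<lambda>y. if n = 0 then 0 else r y * (y (Suc n) - a))"
  proof (cases "n = 0")
    case False
    have "polyfun m ((n - 1) + 1) (\<lambda>y. r y * (y (Suc n) + (- a)))"
      using Suc.prems by (intro polyfun_mult r polyfun_add polyfun_var polyfun_const) auto
    with False show ?thesis by simp
  qed (auto intro: polyfun_const)
  have "polyfun m ((\<Sum>i=1..n. 1) + 0) (\<lambda>y. (\<Prod>i=1..n. y i) * (- a))"
    using Suc.prems by (intro polyfun_mult polyfun_prod polyfun_var polyfun_const) auto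
  with r' have "polyfun m n (\<lambda>y. (if n = 0 then 0 else r y * (y (Suc n) - a)) + (\<Prod>i=1..n. y i) * (- a))"
    by (intro polyfun_add) auto
  moreover have "n = 0 \<Longrightarrow> r y = 0" for y using r(2)[of y] by simp
  ultimately show ?case
    by (intro exI[of _ "\<lambda>y. (if n = 0 then 0 else r y * (y (Suc n) - a)) + (\<Prod>i=1..n. y i) * (- a)"])
      (simp add: r(2)[unfolded One_nat_def], simp add: algebra_simps)
qed

lemma weight_Suc: "weight n (\<lambda>i. Suc (\<nu> i)) = weight n \<nu> + n"
  by (simp add: weight_def sum_Suc)

text \<open>The product of the variables raises every exponent by a column and carries the
  coefficient at \<nu> to \<mu>. The remaining part of the factor has degree at most
  \<open>n - 1\<close>, so its product with \<open>f\<close> stays below the weight of \<mu>; this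
  uses \<open>0 < n\<close>.\<close>

lemma monic_at_add_column:
  assumes f: "monic_at n \<nu> f" and n: "0 < n" and \<nu>: "\<forall>i. i \<notin> {1..n} \<longrightarrow> \<nu> i = 0"
  defines "\<mu> \<equiv> \<lambda>i. if i \<in> {1..n} then Suc (\<nu> i) else 0"
  shows "monic_at n \<mu> (\<lambda>y. (\<Prod>i=1..n. y i - a) * f y)"
proof -
  let ?d = "weight n \<nu>"
  have wt: "weight n \<mu> = ?d + n"
    using weight_cong[of n \<mu> "\<lambda>i. Suc (\<nu> i)"] by (simp add: \<mu>_def weight_Suc)
  obtain c where c: "f = expansion n ?d c" "c \<nu> = 1" using f by (auto simp: monic_at_def)
  obtain r where r: "polyfun n (n - 1) r"
    "\<And>y. (\<Prod>i=1..n. y i - a) = (\<Prod>i=1..n. y i) + r y" using prod_diff_leading[of n n a] by blast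
  have f_poly: "polyfun n ?d f"
    unfolding c expansion_def by (intro polyfun_sum polyfun_monomial) (auto simp: exponents_def)
  obtain c' where c': "(\<lambda>y. r y * f y) = expansion n (n - 1 + ?d) c'"
    using polyfun_expansion[OF polyfun_mult[OF r(1) f_poly]] by blast
  let ?up = "\<lambda>b i. if i \<in> {1..n} then Suc (b i) else 0"
  let ?c1 = "\<lambda>b. if \<forall>i\<in>{1..n}. 0 < b i then c (\<lambda>i. b i - 1) else 0"
  let ?c2 = "\<lambda>b. if weight n b \<le> n - 1 + ?d then c' b else 0"
  have 1: "(\<Prod>i=1..n. y i) * f y = expansion n (?d + n) ?c1 y" for y
  proof -
    have "(\<Prod>i=1..n. y i) * f y = (\<Sum>b\<in>exponents n ?d. c b * monomial n (?up b) y)"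
    proof -
      have "(\<Prod>i=1..n. y i) * monomial n b y = monomial n (?up b) y" for b
        unfolding monomial_def prod.distrib[symmetric] by (rule prod.cong) auto
      then show ?thesis
        by (simp add: c(1) expansion_def sum_distrib_left mult.left_commute)
    qed
    also have "\<dots> = (\<Sum>b\<in>{b\<in>exponents n (?d + n). \<forall>i\<in>{1..n}. 0 < b i}. c (\<lambda>i. b i - 1) * monomial n b y)"
    proof (rule sum.reindex_bij_witness[of _ "\<lambda>b i. b i - 1" ?up])
      fix b assume b: "b \<in> exponents n ?d"
      then show "(\<lambda>i. ?up b i - 1) = b" by (auto simp: exponents_def)
      then show "c (\<lambda>i. ?up b i - 1) * monomial n (?up b) y = c b * monomial n (?up b) y" by simp
      show "?up b \<in> {b\<in>exponents n (?d + n). \<forall>i\<in>{1..n}. 0 < b i}"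
        using b weight_cong[of n "?up b" "\<lambda>i. Suc (b i)"] weight_Suc[of n b] by (auto simp: exponents_def)
    next
      fix b assume b: "b \<in> {b\<in>exponents n (?d + n). \<forall>i\<in>{1..n}. 0 < b i}"
      then show up: "?up (\<lambda>i. b i - 1) = b" by (auto simp: exponents_def)
      have "weight n b = weight n (\<lambda>i. b i - 1) + n"
        using weight_cong[of n b "\<lambda>i. Suc (b i - 1)"] weight_Suc[of n "\<lambda>i. b i - 1"] b by auto
      then show "(\<lambda>i. b i - 1) \<in> exponents n ?d" using b by (auto simp: exponents_def)
    qed
    also have "\<dots> = expansion n (?d + n) ?c1 y"
      unfolding expansion_def by (rule sum.mono_neutral_cong_left) auto
    finally show ?thesis .
  qed
  have 2: "r y * f y = expansion n (?d + n) ?c2 y" for y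
  proof -
    have "r y * f y = expansion n (n - 1 + ?d) c' y" using c' by metis
    also have "\<dots> = expansion n (?d + n) ?c2 y" by (subst expansion_mono[of _ "?d + n"]) auto
    finally show ?thesis .
  qed
  have "(\<lambda>y. (\<Prod>i=1..n. y i - a) * f y) = expansion n (weight n \<mu>) (\<lambda>b. ?c1 b + ?c2 b)"
    by (simp only: fun_eq_iff r(2) distrib_right 1 2 wt expansion_add simp_thms)
  moreover have "?c1 \<mu> + ?c2 \<mu> = 1"
  proof -
    have "(\<lambda>i. \<mu> i - 1) = \<nu>" using \<nu> by (auto simp: \<mu>_def)
    then show ?thesis using c(2) n wt by (auto simp: \<mu>_def)
  qed
  ultimately show ?thesis unfolding monic_at_def by blast
qed

lemma remove_column:
  assumes "\<mu> \<in> partitions n" "0 < n" "0 < \<mu> n"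
  shows "(\<lambda>i. \<mu> i - 1) \<in> partitions n" "weight n \<mu> = weight n (\<lambda>i. \<mu> i - 1) + n"
    "\<And>i. i \<in> {1..n} \<Longrightarrow> 0 < \<mu> i"
proof -
  show pos: "0 < \<mu> i" if "i \<in> {1..n}" for i
    using partitions_antimono[OF assms(1), of i n] that assms by auto
  show "(\<lambda>i. \<mu> i - 1) \<in> partitions n"
    using assms(1) by (auto simp: partitions_def diff_le_mono)
  show "weight n \<mu> = weight n (\<lambda>i. \<mu> i - 1) + n"
    unfolding weight_Suc[symmetric] by (rule weight_cong) (use pos in force)
qed

lemma inj_grid_shift:
  assumes "inj_grid Y"
  shows "inj_grid (\<lambda>k m. Y (k + a) (m + b))"
  using assms unfolding inj_grid_def by (metis add_right_cancel)

text \<open>At a partition with empty last row the factor for \<open>i = n\<close> is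
  \<open>Y 0 0 - Y 0 0\<close>. At any other partition, \<open>f\<close> is evaluated at the
  partition without its first column on the shifted grid, where its own vanishing conditions
  apply.\<close>

lemma interpolates_add_column:
  assumes Y: "inj_grid Y" and \<mu>: "\<mu> \<in> partitions n" "0 < n" "0 < \<mu> n"
    and f: "interpolates n (\<lambda>k m. Y (k + 1) m) (\<lambda>i. \<mu> i - 1) f"
  shows "interpolates n Y \<mu> (\<lambda>y. (\<Prod>i=1..n. y i - Y 0 0) * f y)"
proof -
  let ?g = "\<lambda>y. (\<Prod>i=1..n. y i - Y 0 0) * f y"
  note rc = remove_column[OF \<mu>]
  have sf: "symfun n (weight n (\<lambda>i. \<mu> i - 1)) f" using f by (simp add: interpolates_def dual_at_def)
  have "symfun n n (\<lambda>y. (-1) ^ n * (\<Prod>i=1..n. Y 0 0 - y i))"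
    by (intro symfun_scale symfun_prod_diff)
  moreover have "(-1) ^ n * (\<Prod>i=1..n. Y 0 0 - y i) = (\<Prod>i=1..n. y i - Y 0 0)" for y :: "nat \<Rightarrow> 'a"
    using prod.distrib[of "\<lambda>_. -1" "\<lambda>i. Y 0 0 - y i" "{1..n}"] by simp
  ultimately have "symfun n n (\<lambda>y. \<Prod>i=1..n. y i - Y 0 0)" by simp
  from symfun_mult[OF this sf] have 1: "symfun n (weight n \<mu>) ?g" by (simp add: rc(2) add.commute)
  have shifted: "?g (grid_point n Y \<nu>) = (\<Prod>i=1..n. Y (\<nu> i) (n - i) - Y 0 0) *
      f (grid_point n (\<lambda>k m. Y (k + 1) m) (\<lambda>i. \<nu> i - 1))"
    if "\<And>i. i \<in> {1..n} \<Longrightarrow> 0 < \<nu> i" for \<nu>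
    using symfun_cong[OF sf, of "grid_point n Y \<nu>" "grid_point n (\<lambda>k m. Y (k + 1) m) (\<lambda>i. \<nu> i - 1)"] that
    by (auto simp: grid_point_def)
  have "?g (grid_point n Y \<mu>) = (\<Prod>i=1..n. Y (\<mu> i) (n - i) - Y 0 0) *
      f (grid_point n (\<lambda>k m. Y (k + 1) m) (\<lambda>i. \<mu> i - 1))"
    by (rule shifted) (rule rc(3))
  also have "\<dots> \<noteq> 0"
  proof -
    have "Y (\<mu> i) (n - i) \<noteq> Y 0 0" if "i \<in> {1..n}" for i
      using Y rc(3)[OF that] unfolding inj_grid_def by (metis less_irrefl)
    then show ?thesis using f by (auto simp: interpolates_def dual_at_def)
  qed
  finally have "?g (grid_point n Y \<mu>) \<noteq> 0" .
  moreover have "?g (grid_point n Y \<nu>) = 0"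
    if \<nu>: "\<nu> \<in> partitions n" "weight n \<nu> \<le> weight n \<mu>" "\<nu> \<noteq> \<mu>" for \<nu>
  proof (cases "0 < \<nu> n")
    case True
    note rc' = remove_column[OF \<nu>(1) \<mu>(2) True]
    have "(\<lambda>i. \<nu> i - 1) \<noteq> (\<lambda>i. \<mu> i - 1)"
    proof
      assume eq: "(\<lambda>i. \<nu> i - 1) = (\<lambda>i. \<mu> i - 1)"
      have "\<nu> i = \<mu> i" for i
      proof (cases "i \<in> {1..n}")
        case True
        then show ?thesis using rc(3)[OF True] rc'(3)[OF True] fun_cong[OF eq, of i] by simp
      next
        case False
        then show ?thesis using \<nu>(1) \<mu>(1) partitions_outside by metis
      qed
      then show False using \<nu>(3) by auto
    qed
    moreover have "?g (grid_point n Y \<nu>) = (\<Prod>i=1..n. Y (\<nu> i) (n - i) - Y 0 0) *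
        f (grid_point n (\<lambda>k m. Y (k + 1) m) (\<lambda>i. \<nu> i - 1))"
      by (rule shifted) (rule rc'(3))
    ultimately show ?thesis using f rc' rc \<nu> by (simp add: interpolates_def dual_at_def)
  next
    case False
    then have "(\<Prod>i=1..n. grid_point n Y \<nu> i - Y 0 0) = 0"
      using \<mu>(2) by (intro prod_zero bexI[of _ n]) (auto simp: grid_point_def)
    then show ?thesis by simp
  qed
  moreover have "monic_at n \<mu> ?g"
  proof -
    have "\<mu> = (\<lambda>i. if i \<in> {1..n} then Suc (\<mu> i - 1) else 0)"
      using rc(3) partitions_outside[OF \<mu>(1)] by fastforce
    moreover have "monic_at n (\<lambda>i. \<mu> i - 1) f" using f by (simp add: interpolates_def)
    ultimately show ?thesis
      using monic_at_add_column[of n "\<lambda>i. \<mu> i - 1" f "Y 0 0"] \<mu>(2) partitions_outside[OF \<mu>(1)] by auto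
  qed
  ultimately show ?thesis using 1 by (simp add: interpolates_def dual_at_def)
qed

lemma add_column_value:
  assumes "\<And>i. i \<in> {1..n} \<Longrightarrow> 0 < \<nu> i" "symfun n d f"
  shows "(\<Prod>i=1..n. grid_point n Y \<nu> i - Y 0 0) * f (grid_point n Y \<nu>) =
    (\<Prod>i=1..n. Y (\<nu> i) (n - i) - Y 0 0) * f (grid_point n (\<lambda>k m. Y (k + 1) m) (\<lambda>i. \<nu> i - 1))"
  using symfun_cong[OF assms(2), of "grid_point n Y \<nu>" "grid_point n (\<lambda>k m. Y (k + 1) m) (\<lambda>i. \<nu> i - 1)"] assms(1)
  by (auto simp: grid_point_def)

text \<open>Setting the last variable to \<open>a\<close> makes the coefficient at \<mu> a sum over
  \<open>k\<close> of \<open>a ^ k\<close> times the coefficient at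
  \<open>\<mu>(Suc n := k)\<close>. The degree bound \<open>weight n \<mu>\<close> leaves only
  \<open>k = 0\<close>.\<close>

lemma monic_at_restrict:
  fixes f :: "(nat \<Rightarrow> 'a::field_char_0) \<Rightarrow> 'a"
  assumes f: "polyfun (Suc n) (weight n \<mu>) f" and f': "monic_at n \<mu> f'"
    and \<mu>: "\<forall>i. i \<notin> {1..n} \<longrightarrow> \<mu> i = 0"
    and eq: "\<And>y. y (Suc n) = a \<Longrightarrow> f y = f' y"
  shows "monic_at (Suc n) \<mu> f"
proof -
  let ?d = "weight n \<mu>"
  have wt: "weight (Suc n) \<mu> = ?d" using \<mu> by (simp add: weight_def)
  obtain c where c: "f = expansion (Suc n) ?d c" using polyfun_expansion[OF f] by blast
  obtain c' where c': "f' = expansion n ?d c'" "c' \<mu> = 1" using f' by (auto simp: monic_at_def)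
  define c'' where "c'' b = (\<Sum>k\<le>?d. if weight n b \<le> ?d - k then c (b(Suc n := k)) * a ^ k else 0)" for b
  have "expansion n ?d c' y = expansion n ?d c'' y" for y
  proof -
    let ?y = "y(Suc n := a)"
    have m: "monomial n b ?y = monomial n b y" for b
      unfolding monomial_def by (rule prod.cong) auto
    have "expansion n ?d c' y = f' ?y" by (simp add: c' expansion_def m)
    also have "\<dots> = f ?y" using eq by simp
    also have "\<dots> = (\<Sum>k\<le>?d. \<Sum>b\<in>exponents n (?d - k). c (b(Suc n := k)) * a ^ k * monomial n b y)"
      unfolding c expansion_Suc by (simp add: m sum_distrib_left sum_distrib_right mult_ac)
    also have "\<dots> = (\<Sum>k\<le>?d. \<Sum>b\<in>exponents n ?d.
        (if weight n b \<le> ?d - k then c (b(Suc n := k)) * a ^ k else 0) * monomial n b y)"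
      by (rule sum.cong[OF refl], rule sum.mono_neutral_cong_left[OF finite_exponents]) (auto simp: exponents_def)
    also have "\<dots> = expansion n ?d c'' y"
      unfolding expansion_def c''_def sum_distrib_right by (rule sum.swap)
    finally show ?thesis .
  qed
  then have "c' \<mu> = c'' \<mu>"
    by (intro expansion_inject[of n ?d c' c'' \<mu>] ext) (use \<mu> in \<open>auto simp: exponents_def\<close>)
  also have "c'' \<mu> = (\<Sum>k\<in>{0}. c (\<mu>(Suc n := k)) * a ^ k)"
    unfolding c''_def by (rule sum.mono_neutral_cong_right) (auto split: if_splits)
  also have "\<dots> = c \<mu>"
    using \<mu> by (simp add: fun_upd_idem)
  finally show ?thesis using c c'(2) by (auto simp: monic_at_def wt)
qed

lemma partitions_Suc:
  "\<nu> \<in> partitions (Suc n) \<Longrightarrow> \<nu> (Suc n) = 0 \<Longrightarrow> \<nu> \<in> partitions n \<and> weight n \<nu> = weight (Suc n) \<nu>"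
  by (auto simp: partitions_def weight_def not_le le_Suc_eq)

text \<open>Any lift of \<open>f'\<close> has the right values at partitions with empty last row.
  The other values are corrected by dual functions that vanish on \<open>y (Suc n) = Y 0 0\<close>,
  hence without changing the restriction. Existence of these is a hypothesis, so that the lemma can
  be applied inside the induction that proves existence.\<close>

lemma interpolates_extend:
  fixes Y :: "nat \<Rightarrow> nat \<Rightarrow> 'a::field_char_0"
  assumes Y: "inj_grid Y" and \<mu>: "\<mu> \<in> partitions n"
    and f': "interpolates n (\<lambda>k m. Y k (m + 1)) \<mu> f'"
    and columns: "\<And>\<nu>. \<nu> \<in> partitions (Suc n) \<Longrightarrow> 0 < \<nu> (Suc n) \<Longrightarrow> weight (Suc n) \<nu> \<le> weight n \<mu> \<Longrightarrow>
      \<exists>h. dual_at (Suc n) Y \<nu> h \<and> (\<forall>y. y (Suc n) = Y 0 0 \<longrightarrow> h y = 0)"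
  shows "\<exists>f. interpolates (Suc n) Y \<mu> f \<and> (\<forall>y. y (Suc n) = Y 0 0 \<longrightarrow> f y = f' y)"
proof -
  let ?N = "Suc n" and ?d = "weight n \<mu>"
  have \<mu>_last: "\<mu> ?N = 0" using partitions_outside[OF \<mu>] by simp
  have wt: "weight ?N \<mu> = ?d" using \<mu>_last by (simp add: weight_def)
  have f'_sym: "symfun n ?d f'" using f' by (simp add: interpolates_def dual_at_def)
  define Q where "Q = {\<nu> \<in> partitions ?N. 0 < \<nu> ?N \<and> weight ?N \<nu> \<le> ?d}"
  have fin: "finite Q" unfolding Q_def by (rule finite_subset[OF _ finite_partitions[of ?N ?d]]) auto
  obtain h where h: "\<And>\<nu>. \<nu> \<in> Q \<Longrightarrow> dual_at ?N Y \<nu> (h \<nu>)"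
    "\<And>\<nu> y. \<nu> \<in> Q \<Longrightarrow> y ?N = Y 0 0 \<Longrightarrow> h \<nu> y = 0"
    using columns unfolding Q_def by (simp only: mem_Collect_eq) metis
  \<comment> \<open>The correction proceeds by weight: a dual function of weight \<open>w\<close>
    vanishes at all other partitions of weight at most \<open>w\<close>, so the zeros already
    obtained are kept.\<close>
  have "\<exists>f. symfun ?N ?d f \<and> (\<forall>y. y ?N = Y 0 0 \<longrightarrow> f y = f' y) \<and>
      (\<forall>\<nu>\<in>Q. weight ?N \<nu> < w \<longrightarrow> f (grid_point ?N Y \<nu>) = 0)" for w
  proof (induction w)
    case 0
    then show ?case using symfun_lift[OF f'_sym, of "Y 0 0"] by auto
  next
    case (Suc w)
    then obtain f where f: "symfun ?N ?d f" "\<And>y. y ?N = Y 0 0 \<Longrightarrow> f y = f' y"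
      "\<And>\<nu>. \<nu> \<in> Q \<Longrightarrow> weight ?N \<nu> < w \<Longrightarrow> f (grid_point ?N Y \<nu>) = 0" by blast
    let ?W = "{\<nu> \<in> Q. weight ?N \<nu> = w}"
    let ?a = "\<lambda>\<nu>. f (grid_point ?N Y \<nu>) / h \<nu> (grid_point ?N Y \<nu>)"
    define g where "g y = f y - (\<Sum>\<nu>\<in>?W. ?a \<nu> * h \<nu> y)" for y
    have "symfun ?N ?d g"
      unfolding g_def
    proof (intro symfun_diff symfun_sum symfun_scale f(1))
      fix \<nu> assume "\<nu> \<in> ?W"
      then have "symfun ?N (weight ?N \<nu>) (h \<nu>)" "weight ?N \<nu> \<le> ?d"
        using h(1) by (auto simp: dual_at_def Q_def)
      then show "symfun ?N ?d (h \<nu>)" by (rule symfun_weaken)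
    qed
    moreover have "g y = f' y" if "y ?N = Y 0 0" for y
      using that h(2) f(2) by (simp add: g_def)
    moreover have "g (grid_point ?N Y \<rho>) = 0" if \<rho>: "\<rho> \<in> Q" "weight ?N \<rho> < Suc w" for \<rho>
    proof -
      have off: "h \<nu> (grid_point ?N Y \<rho>) = 0" if "\<nu> \<in> ?W" "\<nu> \<noteq> \<rho>" for \<nu>
        using h(1)[of \<nu>] that \<rho> by (auto simp: dual_at_def Q_def)
      show ?thesis
      proof (cases "weight ?N \<rho> = w")
        case True
        then have "\<rho> \<in> ?W" using \<rho> by simp
        have "(\<Sum>\<nu>\<in>?W. ?a \<nu> * h \<nu> (grid_point ?N Y \<rho>)) = ?a \<rho> * h \<rho> (grid_point ?N Y \<rho>)"
          by (subst sum.remove[OF _ \<open>\<rho> \<in> ?W\<close>]) (use fin off in \<open>auto intro!: sum.neutral\<close>)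
        also have "\<dots> = f (grid_point ?N Y \<rho>)"
          using h(1)[OF \<rho>(1)] by (simp add: dual_at_def)
        finally show ?thesis by (simp add: g_def)
      next
        case False
        then have "(\<Sum>\<nu>\<in>?W. ?a \<nu> * h \<nu> (grid_point ?N Y \<rho>)) = 0"
          by (intro sum.neutral) (use off in auto)
        then show ?thesis using f(3)[OF \<rho>(1)] \<rho>(2) False by (simp add: g_def)
      qed
    qed
    ultimately show ?case by blast
  qed
  then obtain f where f: "symfun ?N ?d f" "\<And>y. y ?N = Y 0 0 \<Longrightarrow> f y = f' y"
    "\<And>\<nu>. \<nu> \<in> Q \<Longrightarrow> f (grid_point ?N Y \<nu>) = 0"
    by (metis (no_types, lifting) Q_def mem_Collect_eq order.strict_trans1 lessI)
  have low: "f (grid_point ?N Y \<nu>) = f' (grid_point n (\<lambda>k m. Y k (m + 1)) \<nu>)" if "\<nu> ?N = 0" for \<nu>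
  proof -
    have "f (grid_point ?N Y \<nu>) = f' (grid_point ?N Y \<nu>)"
      using that by (intro f(2)) (simp add: grid_point_def)
    also have "\<dots> = f' (grid_point n (\<lambda>k m. Y k (m + 1)) \<nu>)"
      by (rule symfun_cong[OF f'_sym]) (auto simp: grid_point_def Suc_diff_le)
    finally show ?thesis .
  qed
  have "f (grid_point ?N Y \<mu>) \<noteq> 0"
    using low[of \<mu>, OF \<mu>_last] f' by (simp add: interpolates_def dual_at_def)
  moreover have "f (grid_point ?N Y \<nu>) = 0"
    if \<nu>: "\<nu> \<in> partitions ?N" "weight ?N \<nu> \<le> ?d" "\<nu> \<noteq> \<mu>" for \<nu>
  proof (cases "\<nu> ?N = 0")
    case True
    then show ?thesis
      using low[of \<nu>, OF True] partitions_Suc[OF \<nu>(1) True] \<nu> f' by (auto simp: interpolates_def dual_at_def)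
  next
    case False
    then show ?thesis using f(3) \<nu> by (auto simp: Q_def)
  qed
  ultimately have "dual_at ?N Y \<mu> f" using f(1) by (simp add: dual_at_def wt)
  moreover have "monic_at ?N \<mu> f"
    by (rule monic_at_restrict[OF symfun_imp_polyfun[OF f(1)], of f' "Y 0 0"])
      (use f' f(2) partitions_outside[OF \<mu>] in \<open>auto simp: interpolates_def\<close>)
  ultimately show ?thesis using f(2) by (auto simp: interpolates_def)
qed

lemma interpolates_0: "interpolates 0 Y (\<lambda>_. 0) (\<lambda>_. 1)"
proof -
  have "exponents 0 0 = {\<lambda>_. 0}" by (auto simp: exponents_def weight_def)
  then show ?thesis
    by (auto simp: interpolates_def dual_at_def weight_def monic_at_def expansion_def monomial_def partitions_def
        intro!: symfun_const exI[of _ "\<lambda>_. 1"])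
qed

text \<open>Nested induction: on the number of variables for an empty last row, and on the weight
  for a full column. Both reductions shift the grid, which is therefore arbitrary in both
  inductions.\<close>

lemma interpolates_exists:
  fixes Y :: "nat \<Rightarrow> nat \<Rightarrow> 'a::field_char_0"
  assumes "inj_grid Y" "\<mu> \<in> partitions n"
  shows "\<exists>f. interpolates n Y \<mu> f"
  using assms
proof (induction n arbitrary: Y \<mu>)
  case 0
  then have "\<mu> = (\<lambda>_. 0)" by (auto simp: partitions_def)
  then show ?case using interpolates_0 by blast
next
  case (Suc n)
  note outer = Suc.IH
  show ?case
    using Suc.prems
  proof (induction "weight (Suc n) \<mu>" arbitrary: Y \<mu> rule: less_induct)
    case less
    have column: "\<exists>h. interpolates (Suc n) Y \<nu> h \<and> (\<forall>y. y (Suc n) = Y 0 0 \<longrightarrow> h y = 0)"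
      if \<nu>: "\<nu> \<in> partitions (Suc n)" "0 < \<nu> (Suc n)" "weight (Suc n) \<nu> \<le> weight (Suc n) \<mu>" for \<nu>
    proof -
      note rc = remove_column[OF \<nu>(1) _ \<nu>(2), simplified]
      have "inj_grid (\<lambda>k m. Y (k + 1) m)" using inj_grid_shift[OF less.prems(1), of 1 0] by simp
      then obtain f where "interpolates (Suc n) (\<lambda>k m. Y (k + 1) m) (\<lambda>i. \<nu> i - 1) f"
        using less.hyps[of "\<lambda>i. \<nu> i - 1" "\<lambda>k m. Y (k + 1) m"] rc \<nu>(3) by auto
      from interpolates_add_column[OF less.prems(1) \<nu>(1) _ \<nu>(2) this] show ?thesis by auto
    qed
    show ?case
    proof (cases "\<mu> (Suc n) = 0")
      case True
      note p = partitions_Suc[OF less.prems(2) True]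
      have "inj_grid (\<lambda>k m. Y k (m + 1))" using inj_grid_shift[OF less.prems(1), of 0 1] by simp
      then obtain f' where "interpolates n (\<lambda>k m. Y k (m + 1)) \<mu> f'" using outer p by blast
      moreover have "\<exists>h. dual_at (Suc n) Y \<nu> h \<and> (\<forall>y. y (Suc n) = Y 0 0 \<longrightarrow> h y = 0)"
        if "\<nu> \<in> partitions (Suc n)" "0 < \<nu> (Suc n)" "weight (Suc n) \<nu> \<le> weight n \<mu>" for \<nu>
        using column[of \<nu>] that p by (auto simp: interpolates_def)
      ultimately show ?thesis
        using interpolates_extend[OF less.prems(1) conjunct1[OF p], of f'] by blast
    next
      case False
      then show ?thesis using column[of \<mu>] less.prems by auto
    qed
  qed
qed

lemma interpolates_extend':
  fixes Y :: "nat \<Rightarrow> nat \<Rightarrow> 'a::field_char_0"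
  assumes Y: "inj_grid Y" and \<mu>: "\<mu> \<in> partitions n"
    and f': "interpolates n (\<lambda>k m. Y k (m + 1)) \<mu> f'"
  shows "\<exists>f. interpolates (Suc n) Y \<mu> f \<and> (\<forall>y. y (Suc n) = Y 0 0 \<longrightarrow> f y = f' y)"
proof (rule interpolates_extend[OF assms])
  fix \<nu> assume \<nu>: "\<nu> \<in> partitions (Suc n)" "0 < \<nu> (Suc n)"
  have "inj_grid (\<lambda>k m. Y (k + 1) m)" using inj_grid_shift[OF Y, of 1 0] by simp
  then obtain f where "interpolates (Suc n) (\<lambda>k m. Y (k + 1) m) (\<lambda>i. \<nu> i - 1) f"
    using interpolates_exists remove_column(1)[OF \<nu>(1) _ \<nu>(2)] by blast
  from interpolates_add_column[OF Y \<nu>(1) _ \<nu>(2) this]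
  show "\<exists>h. dual_at (Suc n) Y \<nu> h \<and> (\<forall>y. y (Suc n) = Y 0 0 \<longrightarrow> h y = 0)"
    by (auto simp: interpolates_def)
qed

section \<open>Uniqueness\<close>

lemma expansion_scale: "expansion n d (\<lambda>b. s * c b) y = s * expansion n d c y"
  by (simp add: expansion_def sum_distrib_left mult.assoc)

text \<open>Gaussian elimination: one equation is solved for an unknown \<open>i\<close>, which is
  then substituted into the others.\<close>

lemma homogeneous_system:
  fixes M :: "'j \<Rightarrow> 'q \<Rightarrow> 'a::field"
  assumes "finite Q" "finite J" "card Q < card J"
  shows "\<exists>a. (\<exists>j\<in>J. a j \<noteq> 0) \<and> (\<forall>q\<in>Q. (\<Sum>j\<in>J. a j * M j q) = 0)"
  using assms
proof (induction Q arbitrary: J M rule: finite_induct)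
  case empty
  then obtain j where "j \<in> J" by (cases "J = {}") auto
  then show ?case by (intro exI[of _ "\<lambda>_. 1"]) auto
next
  case (insert q Q)
  show ?case
  proof (cases "\<forall>j\<in>J. M j q = 0")
    case True
    obtain a where "\<exists>j\<in>J. a j \<noteq> 0" "\<forall>q\<in>Q. (\<Sum>j\<in>J. a j * M j q) = 0"
      using insert.IH[of J M] insert.prems insert.hyps by auto
    with True show ?thesis by (intro exI[of _ a]) auto
  next
    case False
    then obtain i where i: "i \<in> J" "M i q \<noteq> 0" by blast
    let ?J = "J - {i}"
    have "card Q < card ?J" using insert i by (simp add: card_Diff_singleton)
    then obtain a where a: "\<exists>j\<in>?J. a j \<noteq> 0"
      "\<And>r. r \<in> Q \<Longrightarrow> (\<Sum>j\<in>?J. a j * (M j r - M j q / M i q * M i r)) = 0"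
      using insert.IH[of ?J "\<lambda>j r. M j r - M j q / M i q * M i r"] insert.prems by auto
    define b where "b = a(i := - (\<Sum>j\<in>?J. a j * M j q) / M i q)"
    have sum_b: "(\<Sum>j\<in>J. b j * M j r) = (\<Sum>j\<in>?J. a j * (M j r - M j q / M i q * M i r))" for r
    proof -
      have "(\<Sum>j\<in>J. b j * M j r) = b i * M i r + (\<Sum>j\<in>?J. b j * M j r)"
        using insert.prems i by (simp add: sum.remove)
      also have "(\<Sum>j\<in>?J. b j * M j r) = (\<Sum>j\<in>?J. a j * M j r)"
        by (rule sum.cong) (auto simp: b_def)
      also have "b i * M i r = - (\<Sum>j\<in>?J. a j * (M j q / M i q * M i r))"
        by (simp add: b_def sum_divide_distrib sum_distrib_right mult.assoc)
      finally show ?thesis by (simp add: right_diff_distrib sum_subtractf)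
    qed
    have "(\<Sum>j\<in>J. b j * M j r) = 0" if "r \<in> insert q Q" for r
      unfolding sum_b using that a(2) i(2) by auto
    moreover have "\<exists>j\<in>J. b j \<noteq> 0" using a(1) by (auto simp: b_def)
    ultimately show ?thesis by blast
  qed
qed

text \<open>
  A dimension count: the coefficient vectors \<open>c p\<close> and \<open>c0\<close> are linearly dependent, and triangularity
  of the values \<open>e p\<close> forces the dependency to be one of \<open>c0\<close> alone.
\<close>

lemma triangular_unique:
  fixes c e :: "'p \<Rightarrow> 'p \<Rightarrow> 'a::field" and c0 e0 :: "'p \<Rightarrow> 'a" and rank :: "'p \<Rightarrow> nat"
  assumes fin: "finite P" and diag: "\<And>p. p \<in> P \<Longrightarrow> e p p \<noteq> 0"
    and tri: "\<And>p q. p \<in> P \<Longrightarrow> q \<in> P \<Longrightarrow> rank q \<le> rank p \<Longrightarrow> q \<noteq> p \<Longrightarrow> e p q = 0"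
    and e0: "\<And>q. q \<in> P \<Longrightarrow> e0 q = 0"
    and detect: "\<And>s a. (\<And>q. q \<in> P \<Longrightarrow> s * c0 q + (\<Sum>p\<in>P. a p * c p q) = 0) \<Longrightarrow>
      (\<And>q. q \<in> P \<Longrightarrow> s * e0 q + (\<Sum>p\<in>P. a p * e p q) = 0)"
    and "q \<in> P"
  shows "c0 q = 0"
proof -
  \<comment> \<open>\<open>None\<close> stands for the vector \<open>c0\<close>; with it there is
    one vector more than there are coordinates.\<close>
  let ?J = "insert None (Some ` P)"
  have "card ?J = card P + 1" using fin by (simp add: card_image)
  then obtain b where b: "\<exists>j\<in>?J. b j \<noteq> 0"
    "\<And>q. q \<in> P \<Longrightarrow> (\<Sum>j\<in>?J. b j * (case j of None \<Rightarrow> c0 q | Some p \<Rightarrow> c p q)) = 0"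
    using homogeneous_system[of P ?J "\<lambda>j q. case j of None \<Rightarrow> c0 q | Some p \<Rightarrow> c p q"] fin by auto
  define s a where "s = b None" and "a p = b (Some p)" for p
  have c_sum: "s * c0 q + (\<Sum>p\<in>P. a p * c p q) = 0" if "q \<in> P" for q
    using b(2)[OF that] fin by (simp add: s_def a_def sum.reindex)
  have e_sum: "(\<Sum>p\<in>P. a p * e p q) = 0" if "q \<in> P" for q
    using detect[OF c_sum that] e0 that by simp
  have a_0: "a q = 0" if "q \<in> P" for q
    using that
  proof (induction "rank q" arbitrary: q rule: less_induct)
    case less
    have "(\<Sum>p\<in>P. a p * e p q) = (\<Sum>p\<in>{q}. a p * e p q)"
    proof (rule sum.mono_neutral_right)
      show "\<forall>p\<in>P - {q}. a p * e p q = 0"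
      proof
        fix p assume "p \<in> P - {q}"
        then show "a p * e p q = 0"
          using less.hyps[of p] tri[of p q] less.prems by (cases "rank q \<le> rank p") auto
      qed
    qed (use fin less.prems in auto)
    then show ?case using e_sum diag less.prems by auto
  qed
  then have "s \<noteq> 0" using b(1) by (auto simp: s_def a_def)
  moreover have "(\<Sum>p\<in>P. a p * c p q) = 0"
    by (rule sum.neutral) (simp add: a_0)
  ultimately show ?thesis using c_sum[OF \<open>q \<in> P\<close>] by simp
qed

text \<open>A permutation minimising \<open>\<Sum> i * b (p i)\<close> sorts \<open>b\<close> into decreasing order.\<close>

lemma sort_exponents:
  fixes b :: "nat \<Rightarrow> nat"
  assumes "\<forall>i. i \<notin> {1..n} \<longrightarrow> b i = 0"
  obtains p where "p permutes {1..n}" "(\<lambda>i. b (p i)) \<in> partitions n"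
proof -
  let ?S = "{p. p permutes {1..n}}"
  let ?w = "\<lambda>p. \<Sum>i=1..n. i * b (p i)"
  define p where "p = arg_min_on ?w ?S"
  have fin: "finite ?S" by (simp add: finite_permutations)
  have "?S \<noteq> {}" using permutes_id[of "{1..n}"] by blast
  then have p: "p permutes {1..n}" "\<And>q. q permutes {1..n} \<Longrightarrow> ?w p \<le> ?w q"
    using arg_min_if_finite[OF fin, of ?w] unfolding p_def by (simp_all add: not_less)
  have "(\<lambda>i. b (p i)) \<in> partitions n"
  proof (rule partitionsI)
    fix i assume i: "1 \<le> i" "i < n"
    show "b (p (Suc i)) \<le> b (p i)"
    proof (rule ccontr)
      assume less: "\<not> b (p (Suc i)) \<le> b (p i)"
      define q where "q = p \<circ> Transposition.transpose i (Suc i)"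
      have "q permutes {1..n}"
        unfolding q_def using i p(1) by (intro permutes_compose[OF permutes_swap_id]) auto
      then have "?w p \<le> ?w q" by (rule p(2))
      moreover have "?w q < ?w p"
      proof -
        let ?R = "{1..n} - {i, Suc i}"
        have split: "?w r = i * b (r i) + (Suc i * b (r (Suc i)) + (\<Sum>j\<in>?R. j * b (r j)))" for r
        proof -
          have "?w r = i * b (r i) + (\<Sum>j\<in>{1..n} - {i}. j * b (r j))"
            using i by (subst sum.remove[of _ i]) auto
          also have "(\<Sum>j\<in>{1..n} - {i}. j * b (r j)) =
              Suc i * b (r (Suc i)) + (\<Sum>j\<in>{1..n} - {i} - {Suc i}. j * b (r j))"
            using i by (subst sum.remove[of _ "Suc i"]) auto
          also have "{1..n} - {i} - {Suc i} = ?R" by auto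
          finally show ?thesis .
        qed
        have "(\<Sum>j\<in>?R. j * b (q j)) = (\<Sum>j\<in>?R. j * b (p j))"
          by (rule sum.cong) (auto simp: q_def transpose_def)
        moreover have "q i = p (Suc i)" "q (Suc i) = p i" by (simp_all add: q_def)
        ultimately show ?thesis unfolding split using less by simp
      qed
      ultimately show False by simp
    qed
  next
    fix i assume "i \<notin> {1..n}"
    then show "b (p i) = 0" using p(1) assms by (metis permutes_not_in)
  qed
  with p(1) show ?thesis by (rule that)
qed

lemma weight_permutes: "p permutes {1..n} \<Longrightarrow> weight n (\<lambda>i. b (p i)) = weight n b"
  unfolding weight_def using sum.permute[of p "{1..n}" b] by (simp add: o_def)

lemma exponents_permutes:
  assumes "p permutes {1..n}" "b \<in> exponents n d"
  shows "(\<lambda>i. b (p i)) \<in> exponents n d"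
  using assms weight_permutes[OF assms(1), of b] permutes_not_in[OF assms(1)]
  by (auto simp: exponents_def)

lemma symmetric_expansion:
  fixes f :: "(nat \<Rightarrow> 'a::field_char_0) \<Rightarrow> 'a"
  assumes f: "symfun n d f" "f = expansion n d c" and p: "p permutes {1..n}" and b: "b \<in> exponents n d"
  shows "c (\<lambda>i. b (p i)) = c b"
proof -
  have "expansion n d (\<lambda>b. c (\<lambda>i. b (p i))) y = expansion n d c y" for y
  proof -
    have "expansion n d c y = expansion n d c (\<lambda>i. y (p i))"
      using symfun_permutes[OF f(1) p, of y] f(2) by simp
    also have "\<dots> = (\<Sum>b\<in>exponents n d. c (\<lambda>i. b (p i)) * monomial n (\<lambda>i. b (p i)) (\<lambda>i. y (p i)))"
      unfolding expansion_def
    proof (rule sum.reindex_bij_witness[of _ "\<lambda>b i. b (p i)" "\<lambda>b i. b (Hilbert_Choice.inv p i)"])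
      fix b assume "b \<in> exponents n d"
      then show "(\<lambda>i. b (Hilbert_Choice.inv p i)) \<in> exponents n d" "(\<lambda>i. b (p i)) \<in> exponents n d"
        using exponents_permutes p permutes_inv by blast+
    qed (use permutes_inverses[OF p] in auto)
    also have "\<dots> = expansion n d (\<lambda>b. c (\<lambda>i. b (p i))) y"
    proof -
      have "monomial n (\<lambda>i. b (p i)) (\<lambda>i. y (p i)) = monomial n b y" for b
        unfolding monomial_def using prod.permute[OF p, of "\<lambda>i. y i ^ b i"] by (simp add: o_def)
      then show ?thesis by (simp add: expansion_def)
    qed
    finally show ?thesis ..
  qed
  then show ?thesis using expansion_inject[OF _ b] by blast
qed

text \<open>The combination \<open>F\<close> vanishes at \<mu> as well, hence at all nodes in
  question. By symmetry a function is determined by its coefficients at partitions, and these are as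
  many as the nodes. So the dual functions \<open>h\<close> already exhaust the dimension, and
  \<open>triangular_unique\<close> forces \<open>F\<close> to be zero.\<close>

lemma dual_at_unique:
  fixes Y :: "nat \<Rightarrow> nat \<Rightarrow> 'a::field_char_0"
  assumes Y: "inj_grid Y" and \<mu>: "\<mu> \<in> partitions n"
    and f: "dual_at n Y \<mu> f" and g: "dual_at n Y \<mu> g"
  shows "f y * g (grid_point n Y \<mu>) = g y * f (grid_point n Y \<mu>)"
proof -
  let ?d = "weight n \<mu>"
  define P where "P = {\<nu> \<in> partitions n. weight n \<nu> \<le> ?d}"
  define F where "F y = g (grid_point n Y \<mu>) * f y - f (grid_point n Y \<mu>) * g y" for y
  have F: "symfun n ?d F"
    unfolding F_def using f g by (intro symfun_diff symfun_scale) (auto simp: dual_at_def)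
  have F_0: "F (grid_point n Y \<nu>) = 0" if "\<nu> \<in> P" for \<nu>
    using that f g by (cases "\<nu> = \<mu>") (auto simp: dual_at_def F_def P_def)
  have "\<exists>h. dual_at n Y \<nu> h" if "\<nu> \<in> P" for \<nu>
    using interpolates_exists[OF Y, of \<nu> n] that by (auto simp: P_def interpolates_def)
  then obtain h where h: "\<And>\<nu>. \<nu> \<in> P \<Longrightarrow> dual_at n Y \<nu> (h \<nu>)" by metis
  have h_sym: "symfun n ?d (h \<nu>)" if "\<nu> \<in> P" for \<nu>
    using h[OF that] that by (auto simp: dual_at_def P_def intro: symfun_weaken)
  define c where "c f = (SOME c. f = expansion n ?d c)" for f :: "(nat \<Rightarrow> 'a) \<Rightarrow> 'a"
  have c: "f = expansion n ?d (c f)" if "symfun n ?d f" for f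
    unfolding c_def using someI_ex[OF polyfun_expansion[OF symfun_imp_polyfun[OF that]]] .
  have zero: "G y = 0" if G: "symfun n ?d G" and "\<And>\<nu>. \<nu> \<in> P \<Longrightarrow> c G \<nu> = 0" for G y
  proof -
    have "c G b = 0" if b: "b \<in> exponents n ?d" for b
    proof -
      obtain p where p: "p permutes {1..n}" "(\<lambda>i. b (p i)) \<in> partitions n"
        using sort_exponents[of n b] b by (auto simp: exponents_def)
      then have "(\<lambda>i. b (p i)) \<in> P"
        using b weight_permutes[OF p(1), of b] by (auto simp: P_def exponents_def)
      with \<open>\<And>\<nu>. \<nu> \<in> P \<Longrightarrow> c G \<nu> = 0\<close> show ?thesis
        using symmetric_expansion[OF G c[OF G] p(1) b] by simp
    qed
    then have "expansion n ?d (c G) y = 0" by (simp add: expansion_def)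
    then show ?thesis using fun_cong[OF c[OF G], of y] by simp
  qed
  have "c F \<nu> = 0" if "\<nu> \<in> P" for \<nu>
  proof (rule triangular_unique[where P = P and rank = "weight n" and c = "\<lambda>\<rho>. c (h \<rho>)"
        and e = "\<lambda>\<rho> \<nu>. h \<rho> (grid_point n Y \<nu>)" and ?e0.0 = "\<lambda>\<nu>. F (grid_point n Y \<nu>)"
        and ?c0.0 = "c F" and q = \<nu>])
    fix s a \<nu> assume *: "\<And>\<nu>. \<nu> \<in> P \<Longrightarrow> s * c F \<nu> + (\<Sum>\<rho>\<in>P. a \<rho> * c (h \<rho>) \<nu>) = 0" and \<nu>: "\<nu> \<in> P"
    define G where "G y = s * F y + (\<Sum>\<rho>\<in>P. a \<rho> * h \<rho> y)" for y
    have G: "symfun n ?d G"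
      unfolding G_def by (intro symfun_add symfun_sum symfun_scale F h_sym)
    have "G = expansion n ?d (\<lambda>b. s * c F b + (\<Sum>\<rho>\<in>P. a \<rho> * c (h \<rho>) b))"
    proof
      fix y
      have "(\<Sum>\<rho>\<in>P. a \<rho> * h \<rho> y) = (\<Sum>\<rho>\<in>P. a \<rho> * expansion n ?d (c (h \<rho>)) y)"
        by (rule sum.cong) (use c[OF h_sym] in auto)
      also have "\<dots> = expansion n ?d (\<lambda>b. \<Sum>\<rho>\<in>P. a \<rho> * c (h \<rho>) b) y"
        unfolding expansion_def sum_distrib_left sum_distrib_right
        by (subst sum.swap) (simp add: mult.assoc)
      finally have A: "(\<Sum>\<rho>\<in>P. a \<rho> * h \<rho> y) = expansion n ?d (\<lambda>b. \<Sum>\<rho>\<in>P. a \<rho> * c (h \<rho>) b) y" .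
      have B: "F y = expansion n ?d (c F) y"
        using fun_cong[OF c[OF F], of y] .
      show "G y = expansion n ?d (\<lambda>b. s * c F b + (\<Sum>\<rho>\<in>P. a \<rho> * c (h \<rho>) b)) y"
        by (simp only: G_def A expansion_add expansion_scale) (simp only: B)
    qed
    then have "c G \<nu> = s * c F \<nu> + (\<Sum>\<rho>\<in>P. a \<rho> * c (h \<rho>) \<nu>)" if "\<nu> \<in> P" for \<nu>
    proof -
      have "\<nu> \<in> exponents n ?d" using that partitions_exponents by (auto simp: P_def)
      moreover have "expansion n ?d (c G) = expansion n ?d (\<lambda>b. s * c F b + (\<Sum>\<rho>\<in>P. a \<rho> * c (h \<rho>) b))"
        by (rule trans[OF c[OF G, symmetric] \<open>G = _\<close>])
      ultimately show ?thesis
        using expansion_inject[of n ?d "c G" "\<lambda>b. s * c F b + (\<Sum>\<rho>\<in>P. a \<rho> * c (h \<rho>) b)" \<nu>] by simp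
    qed
    then have "G (grid_point n Y \<nu>) = 0" using * by (intro zero[OF G]) simp
    then show "s * F (grid_point n Y \<nu>) + (\<Sum>\<rho>\<in>P. a \<rho> * h \<rho> (grid_point n Y \<nu>)) = 0"
      by (simp add: G_def)
  qed (use that F_0 h in \<open>auto simp: P_def dual_at_def\<close>)
  then have "F y = 0" by (intro zero[OF F])
  then show ?thesis by (simp add: F_def mult.commute)
qed

section \<open>Values at adjacent partitions\<close>

text \<open>The grid that remains after removing \<open>a\<close> columns and \<open>b\<close> empty
  rows.\<close>

definition shifted :: "(nat \<Rightarrow> nat \<Rightarrow> 'a) \<Rightarrow> nat \<Rightarrow> nat \<Rightarrow> nat \<Rightarrow> nat \<Rightarrow> 'a" where
  "shifted Y a b k m = Y (k + a) (m + b)"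

lemma shifted_Suc:
  "(\<lambda>k m. shifted Y a b (k + 1) m) = shifted Y (Suc a) b"
  "(\<lambda>k m. shifted Y a b k (m + 1)) = shifted Y a (Suc b)"
  by (simp_all add: shifted_def fun_eq_iff)

lemma inj_grid_shifted: "inj_grid Y \<Longrightarrow> inj_grid (shifted Y a b)"
  using inj_grid_shift[of Y a b] by (simp add: shifted_def[abs_def])

definition box_product :: "(nat \<Rightarrow> nat \<Rightarrow> 'a) \<Rightarrow> nat \<Rightarrow> (nat \<Rightarrow> nat) \<Rightarrow> 'a::field" where
  "box_product box n \<mu> = (\<Prod>s\<in>diagram n \<mu>. box (arm \<mu> s) (leg n \<mu> s))"

lemma finite_diagram: "finite (diagram n \<mu>)"
proof -
  have "diagram n \<mu> = Sigma {1..n} (\<lambda>i. {1..\<mu> i})" by (auto simp: diagram_def)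
  then show ?thesis by simp
qed

lemma box_product_Suc:
  assumes "\<mu> \<in> partitions n"
  shows "box_product box (Suc n) \<mu> = box_product box n \<mu>"
proof -
  have last: "\<mu> (Suc n) = 0" using partitions_outside[OF assms] by simp
  have "diagram (Suc n) \<mu> = diagram n \<mu>"
    using last by (auto simp: diagram_def le_Suc_eq)
  moreover have "leg (Suc n) \<mu> s = leg n \<mu> s" if "s \<in> diagram n \<mu>" for s
  proof -
    have "{i \<in> {1..Suc n}. snd s \<le> \<mu> i} = {i \<in> {1..n}. snd s \<le> \<mu> i}"
      using last that by (auto simp: diagram_def le_Suc_eq)
    then show ?thesis by (simp add: leg_def conj_part_def)
  qed
  ultimately show ?thesis unfolding box_product_def by (intro prod.cong) auto
qed

text \<open>All \<open>n\<close> rows meet the first column, so its box in row \<open>i\<close> has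
  arm \<open>\<mu> i - 1\<close> and leg \<open>n - i\<close>. Every other box keeps its arm and leg
  when that column is deleted.\<close>

lemma box_product_column:
  assumes \<mu>: "\<mu> \<in> partitions n" "0 < n" "0 < \<mu> n"
  shows "box_product box n \<mu> = (\<Prod>i=1..n. box (\<mu> i - 1) (n - i)) * box_product box n (\<lambda>i. \<mu> i - 1)"
proof -
  note rc = remove_column[OF \<mu>]
  let ?\<nu> = "\<lambda>i. \<mu> i - 1"
  let ?C = "(\<lambda>i. (i, 1)) ` {1..n}" and ?D = "(\<lambda>(i, j). (i, Suc j)) ` diagram n ?\<nu>"
  let ?b = "\<lambda>s. box (arm \<mu> s) (leg n \<mu> s)"
  have "diagram n \<mu> = ?C \<union> ?D"
  proof
    show "diagram n \<mu> \<subseteq> ?C \<union> ?D"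
    proof
      fix s assume "s \<in> diagram n \<mu>"
      then obtain i j where s: "s = (i, j)" "i \<in> {1..n}" "1 \<le> j" "j \<le> \<mu> i" by (auto simp: diagram_def)
      show "s \<in> ?C \<union> ?D"
      proof (cases "j = 1")
        case False
        with s have "(i, j - 1) \<in> diagram n ?\<nu>" "s = (\<lambda>(i, j). (i, Suc j)) (i, j - 1)"
          by (auto simp: diagram_def)
        then show ?thesis by blast
      qed (use s in auto)
    qed
    show "?C \<union> ?D \<subseteq> diagram n \<mu>" using rc(3) by (auto simp: diagram_def Suc_le_eq)
  qed
  moreover have "?C \<inter> ?D = {}" by (auto simp: diagram_def)
  ultimately have "box_product box n \<mu> = prod ?b ?C * prod ?b ?D"
    unfolding box_product_def by (simp add: prod.union_disjoint finite_diagram)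
  also have "prod ?b ?C = (\<Prod>i=1..n. ?b (i, 1))"
    by (subst prod.reindex) (auto simp: inj_on_def)
  also have "\<dots> = (\<Prod>i=1..n. box (\<mu> i - 1) (n - i))"
  proof -
    have "{i \<in> {1..n}. 1 \<le> \<mu> i} = {1..n}" using rc(3) by (auto simp: Suc_le_eq)
    then show ?thesis by (simp add: arm_def leg_def conj_part_def)
  qed
  also have "prod ?b ?D = (\<Prod>s\<in>diagram n ?\<nu>. ?b (fst s, Suc (snd s)))"
    by (subst prod.reindex) (auto simp: inj_on_def case_prod_unfold)
  also have "\<dots> = box_product box n ?\<nu>"
    unfolding box_product_def
  proof (rule prod.cong)
    fix s assume "s \<in> diagram n ?\<nu>"
    then have "{i \<in> {1..n}. Suc (snd s) \<le> \<mu> i} = {i \<in> {1..n}. snd s \<le> \<mu> i - 1}"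
      by (auto simp: diagram_def)
    then show "?b (fst s, Suc (snd s)) = box (arm ?\<nu> s) (leg n ?\<nu> s)"
      by (simp add: arm_def leg_def conj_part_def)
  qed simp
  finally show ?thesis .
qed

lemma covers_eq_fun_upd:
  assumes p: "lam \<in> partitions n" "\<mu> \<in> partitions n" and c: "covers n lam \<mu>" and j: "j \<in> {1..n}" "\<mu> j < lam j"
  shows "lam = \<mu>(j := Suc (\<mu> j))"
proof -
  have le: "\<mu> i \<le> lam i" if "i \<in> {1..n}" for i using c that by (simp add: covers_def)
  have "(\<Sum>i=1..n. lam i) = (\<Sum>i=1..n. \<mu> i) + 1" using c by (simp add: covers_def weight_def)
  moreover have "(\<Sum>i=1..n. lam i) = lam j + (\<Sum>i\<in>{1..n} - {j}. lam i)"
    "(\<Sum>i=1..n. \<mu> i) = \<mu> j + (\<Sum>i\<in>{1..n} - {j}. \<mu> i)"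
    using j by (simp_all add: sum.remove)
  moreover have mono: "(\<Sum>i\<in>{1..n} - {j}. \<mu> i) \<le> (\<Sum>i\<in>{1..n} - {j}. lam i)"
    by (rule sum_mono) (use le in auto)
  ultimately have eq: "lam j = Suc (\<mu> j)" "(\<Sum>i\<in>{1..n} - {j}. \<mu> i) = (\<Sum>i\<in>{1..n} - {j}. lam i)"
    using j(2) by auto
  have "lam i = \<mu> i" if "i \<noteq> j" for i
  proof (cases "i \<in> {1..n}")
    case True
    show ?thesis
    proof (rule ccontr)
      assume "lam i \<noteq> \<mu> i"
      then have "\<mu> i < lam i" using le[OF True] by simp
      then have "(\<Sum>i\<in>{1..n} - {j}. \<mu> i) < (\<Sum>i\<in>{1..n} - {j}. lam i)"
        by (intro sum_strict_mono_ex1) (use le True that in auto)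
      with eq(2) show False by simp
    qed
  next
    case False
    then show ?thesis using p partitions_outside by metis
  qed
  with eq(1) show ?thesis by auto
qed

text \<open>\<open>ratio a b k m\<close> is the factor that a row of length \<open>k\<close>, lying
  \<open>m\<close> rows above the new box, contributes to the quotient of the values with and
  without that box. In the last assumption it meets the box factor of the first box of this row, of
  arm \<open>k - 1\<close> and leg \<open>m - 1\<close>, and the factor of this row in H(\<mu>). The
  latter appears when the first column is removed after the empty last row, hence
  \<open>Suc b\<close>.\<close>

locale positive_grid =
  fixes Y :: "nat \<Rightarrow> nat \<Rightarrow> 'a::field_char_0" and box :: "nat \<Rightarrow> nat \<Rightarrow> 'a" and Good :: "'a set"
    and ratio :: "nat \<Rightarrow> nat \<Rightarrow> nat \<Rightarrow> nat \<Rightarrow> 'a"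
  assumes inj: "inj_grid Y"
    and one: "1 \<in> Good"
    and mult: "x \<in> Good \<Longrightarrow> y \<in> Good \<Longrightarrow> x * y \<in> Good"
    and box: "box i j \<in> Good"
    and diff: "0 < k \<Longrightarrow> Y (k + a) (m + b) - Y a b \<in> Good"
    and new_row: "\<mu> \<in> partitions (Suc n) \<Longrightarrow> \<mu> (Suc n) = 0 \<Longrightarrow> \<mu>(Suc n := 1) \<in> partitions (Suc n) \<Longrightarrow>
      dual_at (Suc n) (shifted Y a b) \<mu> f \<Longrightarrow>
      f (grid_point (Suc n) (shifted Y a b) (\<mu>(Suc n := 1))) =
      f (grid_point (Suc n) (shifted Y a b) \<mu>) * (\<Prod>i=1..n. ratio a b (\<mu> i) (Suc n - i))"
    and ratio: "0 < k \<Longrightarrow> 0 < m \<Longrightarrow>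
      box (k - 1) (m - 1) * (Y (k + a) (m + b) - Y a (Suc b)) * ratio a b k m \<in> Good"
begin

lemma prod_Good: "(\<And>i. i \<in> A \<Longrightarrow> f i \<in> Good) \<Longrightarrow> prod f A \<in> Good"
  by (induction A rule: infinite_finite_induct) (auto intro: one mult)

lemma box_product_Good: "box_product box n \<mu> \<in> Good"
  unfolding box_product_def by (intro prod_Good box)

lemma extend_value:
  assumes \<mu>: "\<mu> \<in> partitions n" and f': "interpolates n (shifted Y a (Suc b)) \<mu> f'"
  shows "\<exists>f. interpolates (Suc n) (shifted Y a b) \<mu> f \<and> (\<forall>\<nu>. \<nu> (Suc n) = 0 \<longrightarrow>
    f (grid_point (Suc n) (shifted Y a b) \<nu>) = f' (grid_point n (shifted Y a (Suc b)) \<nu>))"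
proof -
  obtain f where f: "interpolates (Suc n) (shifted Y a b) \<mu> f"
    "\<forall>y. y (Suc n) = shifted Y a b 0 0 \<longrightarrow> f y = f' y"
    using interpolates_extend'[OF inj_grid_shifted[OF inj] \<mu>, of a b f', unfolded shifted_Suc, OF f'] by blast
  have "f (grid_point (Suc n) (shifted Y a b) \<nu>) = f' (grid_point n (shifted Y a (Suc b)) \<nu>)"
    if "\<nu> (Suc n) = 0" for \<nu>
  proof -
    have "f (grid_point (Suc n) (shifted Y a b) \<nu>) = f' (grid_point (Suc n) (shifted Y a b) \<nu>)"
      using f(2) that by (simp add: grid_point_def)
    also have "\<dots> = f' (grid_point n (shifted Y a (Suc b)) \<nu>)"
      using f' by (intro symfun_cong[of n "weight n \<mu>" f'])
        (auto simp: interpolates_def dual_at_def grid_point_def shifted_def Suc_diff_le)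
    finally show ?thesis .
  qed
  with f(1) show ?thesis by blast
qed

lemma column_value:
  assumes \<mu>: "\<mu> \<in> partitions n" "0 < n" "0 < \<mu> n"
    and f: "interpolates n (shifted Y (Suc a) b) (\<lambda>i. \<mu> i - 1) f"
  shows "\<exists>g. interpolates n (shifted Y a b) \<mu> g \<and> (\<forall>\<nu>. (\<forall>i\<in>{1..n}. 0 < \<nu> i) \<longrightarrow>
    g (grid_point n (shifted Y a b) \<nu>) = (\<Prod>i=1..n. Y (\<nu> i + a) (n - i + b) - Y a b) *
      f (grid_point n (shifted Y (Suc a) b) (\<lambda>i. \<nu> i - 1)))"
proof (intro exI conjI)
  show "interpolates n (shifted Y a b) \<mu> (\<lambda>y. (\<Prod>i=1..n. y i - shifted Y a b 0 0) * f y)"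
    by (rule interpolates_add_column[OF inj_grid_shifted[OF inj] \<mu>]) (simp only: shifted_Suc f)
  have "symfun n (weight n (\<lambda>i. \<mu> i - 1)) f" using f by (simp add: interpolates_def dual_at_def)
  from add_column_value[OF _ this, of _ "shifted Y a b"]
  show "\<forall>\<nu>. (\<forall>i\<in>{1..n}. 0 < \<nu> i) \<longrightarrow>
    (\<Prod>i=1..n. grid_point n (shifted Y a b) \<nu> i - shifted Y a b 0 0) * f (grid_point n (shifted Y a b) \<nu>) =
    (\<Prod>i=1..n. Y (\<nu> i + a) (n - i + b) - Y a b) *
      f (grid_point n (shifted Y (Suc a) b) (\<lambda>i. \<nu> i - 1))"
    by (simp only: shifted_Suc) (simp add: shifted_def)
qed

text \<open>The product formula for H(\<mu>): an empty last row does not change the value, and a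
  full column contributes one difference of grid values for each row.\<close>

lemma own_value:
  assumes "\<mu> \<in> partitions n"
  shows "\<exists>f. interpolates n (shifted Y a b) \<mu> f \<and> f (grid_point n (shifted Y a b) \<mu>) \<in> Good"
  using assms
proof (induction n arbitrary: a b \<mu>)
  case 0
  then have "\<mu> = (\<lambda>_. 0)" by (auto simp: partitions_def)
  then show ?case using interpolates_0 one by blast
next
  case (Suc n)
  note outer = Suc.IH
  show ?case
    using Suc.prems
  proof (induction "weight (Suc n) \<mu>" arbitrary: a b \<mu> rule: less_induct)
    case less
    show ?case
    proof (cases "\<mu> (Suc n) = 0")
      case True
      have \<mu>: "\<mu> \<in> partitions n" using partitions_Suc[OF less.prems True] by simp
      obtain f' where "interpolates n (shifted Y a (Suc b)) \<mu> f'"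
        "f' (grid_point n (shifted Y a (Suc b)) \<mu>) \<in> Good" using outer[OF \<mu>] by blast
      then show ?thesis using extend_value[OF \<mu>] True by metis
    next
      case False
      note rc = remove_column[OF less.prems, simplified, OF False[simplified]]
      have "\<exists>f. interpolates (Suc n) (shifted Y (Suc a) b) (\<lambda>i. \<mu> i - 1) f \<and>
        f (grid_point (Suc n) (shifted Y (Suc a) b) (\<lambda>i. \<mu> i - 1)) \<in> Good"
        by (rule less.hyps) (use rc in auto)
      then obtain f where f: "interpolates (Suc n) (shifted Y (Suc a) b) (\<lambda>i. \<mu> i - 1) f"
        "f (grid_point (Suc n) (shifted Y (Suc a) b) (\<lambda>i. \<mu> i - 1)) \<in> Good" by blast
      obtain g where "interpolates (Suc n) (shifted Y a b) \<mu> g"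
        "g (grid_point (Suc n) (shifted Y a b) \<mu>) = (\<Prod>i=1..Suc n. Y (\<mu> i + a) (Suc n - i + b) - Y a b) *
          f (grid_point (Suc n) (shifted Y (Suc a) b) (\<lambda>i. \<mu> i - 1))"
        using column_value[OF less.prems _ _ f(1)] False rc(3) by auto
      moreover have "(\<Prod>i=1..Suc n. Y (\<mu> i + a) (Suc n - i + b) - Y a b) \<in> Good"
        by (intro prod_Good diff) (use rc(3) in auto)
      ultimately show ?thesis using f(2) mult by metis
    qed
  qed
qed

text \<open>The ratios need not be good by themselves. Removing the empty last row and then the
  first column of \<mu> exposes, for every row, one factor of \<open>c\<^sub>\<mu>\<close> and one
  of H(\<mu>). These are paired with the ratio of that row, and the rest \<open>g\<close> is
  good.\<close>

lemma new_row_value: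
  assumes \<mu>: "\<mu> \<in> partitions (Suc n)" "\<mu> (Suc n) = 0" and \<mu>': "\<mu>(Suc n := 1) \<in> partitions (Suc n)"
  shows "\<exists>f. interpolates (Suc n) (shifted Y a b) \<mu> f \<and>
    box_product box (Suc n) \<mu> * f (grid_point (Suc n) (shifted Y a b) (\<mu>(Suc n := 1))) \<in> Good"
proof -
  have \<mu>_n: "\<mu> \<in> partitions n" using partitions_Suc[OF \<mu>] by simp
  have pos: "0 < \<mu> i" if "i \<in> {1..n}" for i
    using partitions_antimono[OF \<mu>', of i "Suc n"] that by auto
  have "\<exists>f' g. interpolates n (shifted Y a (Suc b)) \<mu> f' \<and> g \<in> Good \<and>
    box_product box n \<mu> * f' (grid_point n (shifted Y a (Suc b)) \<mu>) =
    (\<Prod>i=1..n. box (\<mu> i - 1) (n - i) * (Y (\<mu> i + a) (n - i + Suc b) - Y a (Suc b))) * g"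
  proof (cases "n = 0")
    case True
    then have "\<mu> = (\<lambda>_. 0)" using \<mu>_n by (auto simp: partitions_def)
    then have "interpolates n (shifted Y a (Suc b)) \<mu> (\<lambda>_. 1)" using interpolates_0 True by simp
    moreover have "box_product box n \<mu> = 1" using True by (simp add: box_product_def diagram_def)
    ultimately show ?thesis using True one by (intro exI[of _ "\<lambda>_. 1"] exI[of _ 1]) auto
  next
    case False
    then have n: "0 < n" "0 < \<mu> n" using pos[of n] by auto
    note rc = remove_column[OF \<mu>_n n]
    obtain f where f: "interpolates n (shifted Y (Suc a) (Suc b)) (\<lambda>i. \<mu> i - 1) f"
      "f (grid_point n (shifted Y (Suc a) (Suc b)) (\<lambda>i. \<mu> i - 1)) \<in> Good"
      using own_value[OF rc(1)] by blast
    obtain f' where "interpolates n (shifted Y a (Suc b)) \<mu> f'"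
      "f' (grid_point n (shifted Y a (Suc b)) \<mu>) = (\<Prod>i=1..n. Y (\<mu> i + a) (n - i + Suc b) - Y a (Suc b)) *
        f (grid_point n (shifted Y (Suc a) (Suc b)) (\<lambda>i. \<mu> i - 1))"
      using column_value[OF \<mu>_n n f(1)] pos by blast
    moreover have "box_product box n (\<lambda>i. \<mu> i - 1) * f (grid_point n (shifted Y (Suc a) (Suc b)) (\<lambda>i. \<mu> i - 1)) \<in> Good"
      by (intro mult box_product_Good f)
    ultimately show ?thesis
      unfolding box_product_column[OF \<mu>_n n]
      by (intro exI conjI) (assumption | simp add: prod.distrib mult_ac)+
  qed
  then obtain f' g where f': "interpolates n (shifted Y a (Suc b)) \<mu> f'" and g: "g \<in> Good"
    and eq: "box_product box n \<mu> * f' (grid_point n (shifted Y a (Suc b)) \<mu>) =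
    (\<Prod>i=1..n. box (\<mu> i - 1) (n - i) * (Y (\<mu> i + a) (n - i + Suc b) - Y a (Suc b))) * g" by blast
  obtain f where f: "interpolates (Suc n) (shifted Y a b) \<mu> f"
    "f (grid_point (Suc n) (shifted Y a b) \<mu>) = f' (grid_point n (shifted Y a (Suc b)) \<mu>)"
    using extend_value[OF \<mu>_n f'] \<mu>(2) by blast
  have "f (grid_point (Suc n) (shifted Y a b) (\<mu>(Suc n := 1))) =
      f (grid_point (Suc n) (shifted Y a b) \<mu>) * (\<Prod>i=1..n. ratio a b (\<mu> i) (Suc n - i))"
    by (rule new_row[OF \<mu> \<mu>']) (use f in \<open>simp add: interpolates_def\<close>)
  then have "box_product box (Suc n) \<mu> * f (grid_point (Suc n) (shifted Y a b) (\<mu>(Suc n := 1))) =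
      (box_product box n \<mu> * f' (grid_point n (shifted Y a (Suc b)) \<mu>)) * (\<Prod>i=1..n. ratio a b (\<mu> i) (Suc n - i))"
    by (simp add: f(2) box_product_Suc[OF \<mu>_n])
  also have "\<dots> = (\<Prod>i=1..n. box (\<mu> i - 1) (Suc n - i - 1) *
      (Y (\<mu> i + a) (Suc n - i + b) - Y a (Suc b)) * ratio a b (\<mu> i) (Suc n - i)) * g"
  proof -
    have "(\<Prod>i=1..n. box (\<mu> i - 1) (n - i) * (Y (\<mu> i + a) (n - i + Suc b) - Y a (Suc b))) =
      (\<Prod>i=1..n. box (\<mu> i - 1) (Suc n - i - 1) * (Y (\<mu> i + a) (Suc n - i + b) - Y a (Suc b)))"
      by (rule prod.cong) (auto simp: Suc_diff_le)
    then show ?thesis unfolding eq by (simp only: prod.distrib mult_ac)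
  qed
  also have "\<dots> \<in> Good"
    by (intro mult prod_Good ratio g) (use pos in auto)
  finally show ?thesis using f(1) by blast
qed

text \<open>Either both partitions allow the same reduction, a column or an empty row, or the last
  row is empty in \<mu> only, and then the new box must lie in it.\<close>

theorem adjacent_value:
  assumes "lam \<in> partitions n" "\<mu> \<in> partitions n" "covers n lam \<mu>"
  shows "\<exists>f. interpolates n (shifted Y a b) \<mu> f \<and>
    box_product box n \<mu> * f (grid_point n (shifted Y a b) lam) \<in> Good"
  using assms
proof (induction n arbitrary: a b \<mu> lam)
  case 0
  then show ?case by (simp add: covers_def weight_def)
next
  case (Suc n)
  note outer = Suc.IH
  show ?case
    using Suc.prems
  proof (induction "weight (Suc n) \<mu>" arbitrary: a b \<mu> lam rule: less_induct)
    case less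
    note p = less.prems(1,2) and c = less.prems(3)
    have le: "\<mu> i \<le> lam i" if "i \<in> {1..Suc n}" for i using c that by (simp add: covers_def)
    consider "0 < \<mu> (Suc n)" | "\<mu> (Suc n) = 0" "lam (Suc n) = 0" | "\<mu> (Suc n) = 0" "0 < lam (Suc n)"
      by auto
    then show ?case
    proof cases
      case 1
      then have 2: "0 < lam (Suc n)" using le[of "Suc n"] by simp
      note rc = remove_column[OF p(2) _ 1, simplified] and rc' = remove_column[OF p(1) _ 2, simplified]
      have "covers (Suc n) (\<lambda>i. lam i - 1) (\<lambda>i. \<mu> i - 1)"
        using c rc(2) rc'(2) by (auto simp: covers_def diff_le_mono)
      then have "\<exists>f. interpolates (Suc n) (shifted Y (Suc a) b) (\<lambda>i. \<mu> i - 1) f \<and>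
        box_product box (Suc n) (\<lambda>i. \<mu> i - 1) * f (grid_point (Suc n) (shifted Y (Suc a) b) (\<lambda>i. lam i - 1)) \<in> Good"
        by (intro less.hyps) (use rc rc' in auto)
      then obtain f where f: "interpolates (Suc n) (shifted Y (Suc a) b) (\<lambda>i. \<mu> i - 1) f"
        "box_product box (Suc n) (\<lambda>i. \<mu> i - 1) * f (grid_point (Suc n) (shifted Y (Suc a) b) (\<lambda>i. lam i - 1)) \<in> Good"
        by blast
      obtain g where g: "interpolates (Suc n) (shifted Y a b) \<mu> g"
        "g (grid_point (Suc n) (shifted Y a b) lam) = (\<Prod>i=1..Suc n. Y (lam i + a) (Suc n - i + b) - Y a b) *
          f (grid_point (Suc n) (shifted Y (Suc a) b) (\<lambda>i. lam i - 1))"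
        using column_value[OF p(2) _ 1 f(1)] rc'(3) by auto
      have "box_product box (Suc n) \<mu> * g (grid_point (Suc n) (shifted Y a b) lam) =
        (\<Prod>i=1..Suc n. box (\<mu> i - 1) (Suc n - i)) * (\<Prod>i=1..Suc n. Y (lam i + a) (Suc n - i + b) - Y a b) *
        (box_product box (Suc n) (\<lambda>i. \<mu> i - 1) * f (grid_point (Suc n) (shifted Y (Suc a) b) (\<lambda>i. lam i - 1)))"
        unfolding g(2) box_product_column[OF p(2) zero_less_Suc 1] by (simp only: mult_ac)
      also have "\<dots> \<in> Good"
        by (intro mult prod_Good box diff f(2)) (use rc'(3) in auto)
      finally show ?thesis using g(1) by blast
    next
      case 2
      note \<mu> = partitions_Suc[OF p(2) 2(1)] and l = partitions_Suc[OF p(1) 2(2)]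
      have "covers n lam \<mu>" using c \<mu> l by (auto simp: covers_def)
      then obtain f' where f': "interpolates n (shifted Y a (Suc b)) \<mu> f'"
        "box_product box n \<mu> * f' (grid_point n (shifted Y a (Suc b)) lam) \<in> Good"
        using outer \<mu> l by blast
      then show ?thesis
        using extend_value[OF _ f'(1)] \<mu> 2 box_product_Suc[of \<mu> n box] by metis
    next
      case 3
      then have "lam = \<mu>(Suc n := 1)"
        using covers_eq_fun_upd[OF p c, of "Suc n"] by simp
      then show ?thesis using new_row_value[OF p(2) 3(1)] p(1) by simp
    qed
  qed
qed

end

section \<open>Realization by Laurent polynomials\<close>

abbreviation (input) "lkp \<equiv> Poly_Mapping.lookup"
abbreviation (input) "sngl \<equiv> Poly_Mapping.single"
abbreviation (input) "kys \<equiv> Poly_Mapping.keys"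

definition expo_size :: "expo \<Rightarrow> nat" where
  "expo_size \<alpha> = (\<Sum>i\<in>kys \<alpha>. nat \<bar>lkp \<alpha> i\<bar>)"

definition expo_sum :: "expo \<Rightarrow> int" where
  "expo_sum \<alpha> = (\<Sum>i\<in>kys \<alpha>. lkp \<alpha> i)"

definition expo_value :: "(nat \<Rightarrow> 'a::field) \<Rightarrow> expo \<Rightarrow> 'a" where
  "expo_value x \<alpha> = (\<Prod>i\<in>kys \<alpha>. x i powi lkp \<alpha> i)"

lemma expo_size_superset: "finite S \<Longrightarrow> kys \<alpha> \<subseteq> S \<Longrightarrow> expo_size \<alpha> = (\<Sum>i\<in>S. nat \<bar>lkp \<alpha> i\<bar>)"
  unfolding expo_size_def by (rule sum.mono_neutral_left) (auto simp: in_keys_iff)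

lemma expo_sum_superset: "finite S \<Longrightarrow> kys \<alpha> \<subseteq> S \<Longrightarrow> expo_sum \<alpha> = (\<Sum>i\<in>S. lkp \<alpha> i)"
  unfolding expo_sum_def by (rule sum.mono_neutral_left) (auto simp: in_keys_iff)

lemma expo_value_superset: "finite S \<Longrightarrow> kys \<alpha> \<subseteq> S \<Longrightarrow> expo_value x \<alpha> = (\<Prod>i\<in>S. x i powi lkp \<alpha> i)"
  unfolding expo_value_def by (rule prod.mono_neutral_left) (auto simp: in_keys_iff)

lemma expo_size_add: "expo_size (\<alpha> + \<beta>) \<le> expo_size \<alpha> + expo_size \<beta>"
proof -
  let ?S = "kys \<alpha> \<union> kys \<beta>"
  have "expo_size (\<alpha> + \<beta>) = (\<Sum>i\<in>?S. nat \<bar>lkp (\<alpha> + \<beta>) i\<bar>)"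
    by (rule expo_size_superset) (auto dest: set_mp[OF Poly_Mapping.keys_add])
  also have "\<dots> \<le> (\<Sum>i\<in>?S. nat \<bar>lkp \<alpha> i\<bar> + nat \<bar>lkp \<beta> i\<bar>)"
    by (rule sum_mono) (auto simp: lookup_add)
  also have "\<dots> = expo_size \<alpha> + expo_size \<beta>"
    by (simp add: sum.distrib expo_size_superset[of ?S])
  finally show ?thesis .
qed

lemma expo_sum_add: "expo_sum (\<alpha> + \<beta>) = expo_sum \<alpha> + expo_sum \<beta>"
proof -
  let ?S = "kys \<alpha> \<union> kys \<beta>"
  have "expo_sum (\<alpha> + \<beta>) = (\<Sum>i\<in>?S. lkp (\<alpha> + \<beta>) i)"
    by (rule expo_sum_superset) (auto dest: set_mp[OF Poly_Mapping.keys_add])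
  then show ?thesis
    by (simp add: sum.distrib lookup_add expo_sum_superset[of ?S])
qed

lemma expo_value_add:
  assumes "\<And>i. x i \<noteq> 0 \<or> 0 \<le> lkp \<alpha> i \<and> 0 \<le> lkp \<beta> i"
  shows "expo_value x (\<alpha> + \<beta>) = expo_value x \<alpha> * expo_value x \<beta>"
proof -
  let ?S = "kys \<alpha> \<union> kys \<beta>"
  have *: "x i powi (lkp \<alpha> i + lkp \<beta> i) = x i powi lkp \<alpha> i * x i powi lkp \<beta> i" for i
  proof (cases "x i = 0")
    case True
    then have "0 \<le> lkp \<alpha> i" "0 \<le> lkp \<beta> i" using assms[of i] by auto
    then show ?thesis by (simp add: power_int_def nat_add_distrib power_add)
  qed (simp add: power_int_add)
  have "expo_value x (\<alpha> + \<beta>) = (\<Prod>i\<in>?S. x i powi lkp (\<alpha> + \<beta>) i)"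
    by (rule expo_value_superset) (auto dest: set_mp[OF Poly_Mapping.keys_add])
  then show ?thesis
    by (simp add: prod.distrib lookup_add expo_value_superset[of ?S] *)
qed

lemma laurent_eq_sum: "f = (\<Sum>\<alpha>\<in>kys f. sngl \<alpha> (lkp f \<alpha>))"
  by (rule poly_mapping_eqI)
    (simp add: lookup_sum lookup_single when_def sum.delta in_keys_iff)

lemma lookup_const_mult: "lkp (const c * f) \<alpha> = c * lkp f \<alpha>"
proof -
  have "const c * f = Poly_Mapping.map ((*) c) f"
    by (simp add: const_def mult_map_scale_conv_mult)
  then show ?thesis by (simp add: Poly_Mapping.map.rep_eq when_def)
qed

lemma leval_superset: "finite S \<Longrightarrow> kys f \<subseteq> S \<Longrightarrow> leval f x = (\<Sum>\<alpha>\<in>S. lkp f \<alpha> * expo_value x \<alpha>)"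
  unfolding leval_def expo_value_def[symmetric]
  by (rule sum.mono_neutral_left) (auto simp: in_keys_iff)

lemma leval_add: "leval (f + g) x = leval f x + leval g x"
proof -
  let ?S = "kys f \<union> kys g"
  have "leval (f + g) x = (\<Sum>\<alpha>\<in>?S. lkp (f + g) \<alpha> * expo_value x \<alpha>)"
    by (rule leval_superset) (auto dest: set_mp[OF Poly_Mapping.keys_add])
  then show ?thesis
    by (simp add: sum.distrib lookup_add distrib_right leval_superset[of ?S])
qed

lemma leval_0 [simp]: "leval 0 x = 0"
  by (simp add: leval_def)

lemma leval_sum: "leval (\<Sum>a\<in>A. f a) x = (\<Sum>a\<in>A. leval (f a) x)"
  by (induction A rule: infinite_finite_induct) (auto simp: leval_add)

lemma leval_const_mult: "leval (const c * f) x = c * leval f x"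
proof -
  have "kys (const c * f) \<subseteq> kys f" by (auto simp: in_keys_iff lookup_const_mult)
  then show ?thesis
    by (simp add: leval_superset[of "kys f"] lookup_const_mult sum_distrib_left mult.assoc)
qed

lemma leval_single: "leval (sngl \<alpha> c) x = c * expo_value x \<alpha>"
  by (simp add: leval_superset[of "{\<alpha>}"])

text \<open>Evaluation is multiplicative only where no negative power of 0 occurs: since
  \<open>0 powi (- 1) = 0\<close>, a variable and its inverse both evaluate to 0, but their product
  to 1. Zero coordinates do occur: for \<open>AJ\<close>, the last coordinate is 0 whenever
  \<open>\<nu> n = 0\<close>.\<close>

definition regular_at :: "(nat \<Rightarrow> 'a::field) \<Rightarrow> 'a laurent \<Rightarrow> bool" where
  "regular_at x f \<longleftrightarrow> (\<forall>\<alpha>\<in>kys f. \<forall>i. x i \<noteq> 0 \<or> 0 \<le> lkp \<alpha> i)"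

lemma leval_mult:
  assumes "regular_at x f" "regular_at x g"
  shows "leval (f * g) x = leval f x * leval g x"
proof -
  have "f * g = (\<Sum>\<alpha>\<in>kys f. \<Sum>\<beta>\<in>kys g. sngl \<alpha> (lkp f \<alpha>) * sngl \<beta> (lkp g \<beta>))"
    by (subst (1) laurent_eq_sum, subst (2) laurent_eq_sum) (rule sum_product)
  then have "leval (f * g) x =
      (\<Sum>\<alpha>\<in>kys f. \<Sum>\<beta>\<in>kys g. lkp f \<alpha> * lkp g \<beta> * expo_value x (\<alpha> + \<beta>))"
    by (simp add: leval_sum mult_single leval_single)
  also have "\<dots> = (\<Sum>\<alpha>\<in>kys f. \<Sum>\<beta>\<in>kys g. (lkp f \<alpha> * expo_value x \<alpha>) * (lkp g \<beta> * expo_value x \<beta>))"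
    by (intro sum.cong refl) (use assms in \<open>auto simp: regular_at_def expo_value_add mult_ac\<close>)
  also have "\<dots> = leval f x * leval g x"
    unfolding leval_superset[OF finite_keys subset_refl] by (rule sum_product[symmetric])
  finally show ?thesis .
qed

lemma regular_at_mult: "regular_at x f \<Longrightarrow> regular_at x g \<Longrightarrow> regular_at x (f * g)"
  unfolding regular_at_def using Poly_Mapping.keys_mult[of f g] by (fastforce simp: lookup_add)

lemma leval_one [simp]: "leval 1 x = 1"
  using leval_single[of 0 1 x] by (simp add: expo_value_def)

lemma regular_at_one: "regular_at x 1"
  by (simp add: regular_at_def)

lemma regular_at_prod: "(\<And>a. a \<in> A \<Longrightarrow> regular_at x (f a)) \<Longrightarrow> regular_at x (\<Prod>a\<in>A. f a)"
  by (induction A rule: infinite_finite_induct) (auto intro: regular_at_mult regular_at_one)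

lemma leval_prod:
  "(\<And>a. a \<in> A \<Longrightarrow> regular_at x (f a)) \<Longrightarrow> leval (\<Prod>a\<in>A. f a) x = (\<Prod>a\<in>A. leval (f a) x)"
  by (induction A rule: infinite_finite_induct) (auto simp: leval_mult regular_at_prod)

text \<open>The linear extension of a map of exponents, a ring endomorphism when
  \<open>\<pi>\<close> is additive. It serves for permuting variables and for inverting a single
  variable.\<close>

definition push :: "(expo \<Rightarrow> expo) \<Rightarrow> 'a::field laurent \<Rightarrow> 'a laurent" where
  "push \<pi> f = (\<Sum>\<alpha>\<in>kys f. sngl (\<pi> \<alpha>) (lkp f \<alpha>))"

lemma push_superset: "finite S \<Longrightarrow> kys f \<subseteq> S \<Longrightarrow> push \<pi> f = (\<Sum>\<alpha>\<in>S. sngl (\<pi> \<alpha>) (lkp f \<alpha>))"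
  unfolding push_def by (rule sum.mono_neutral_left) (auto simp: in_keys_iff)

lemma push_single: "push \<pi> (sngl \<alpha> c) = sngl (\<pi> \<alpha>) c"
  by (simp add: push_superset[of "{\<alpha>}"])

lemma push_add: "push \<pi> (f + g) = push \<pi> f + push \<pi> g"
proof -
  let ?S = "kys f \<union> kys g"
  have "push \<pi> (f + g) = (\<Sum>\<alpha>\<in>?S. sngl (\<pi> \<alpha>) (lkp (f + g) \<alpha>))"
    by (rule push_superset) (auto dest: set_mp[OF Poly_Mapping.keys_add])
  then show ?thesis
    by (simp add: sum.distrib lookup_add single_add push_superset[of ?S])
qed

lemma push_0: "push \<pi> 0 = 0"
  by (simp add: push_def)

lemma push_sum: "push \<pi> (\<Sum>a\<in>A. f a) = (\<Sum>a\<in>A. push \<pi> (f a))"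
  by (induction A rule: infinite_finite_induct) (auto simp: push_add push_0)

lemma push_mult:
  assumes "\<And>\<alpha> \<beta>. \<pi> (\<alpha> + \<beta>) = \<pi> \<alpha> + \<pi> \<beta>"
  shows "push \<pi> (f * g) = push \<pi> f * push \<pi> g"
proof -
  have "f * g = (\<Sum>\<alpha>\<in>kys f. \<Sum>\<beta>\<in>kys g. sngl \<alpha> (lkp f \<alpha>) * sngl \<beta> (lkp g \<beta>))"
    by (subst (1) laurent_eq_sum, subst (2) laurent_eq_sum) (rule sum_product)
  then have "push \<pi> (f * g) = (\<Sum>\<alpha>\<in>kys f. \<Sum>\<beta>\<in>kys g. sngl (\<pi> \<alpha>) (lkp f \<alpha>) * sngl (\<pi> \<beta>) (lkp g \<beta>))"
    by (simp add: push_sum mult_single push_single assms)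
  also have "\<dots> = push \<pi> f * push \<pi> g"
    unfolding push_def by (rule sum_product[symmetric])
  finally show ?thesis .
qed

lemma push_prod:
  assumes "\<And>\<alpha> \<beta>. \<pi> (\<alpha> + \<beta>) = \<pi> \<alpha> + \<pi> \<beta>"
  shows "push \<pi> (\<Prod>a\<in>A. f a) = (\<Prod>a\<in>A. push \<pi> (f a))"
proof -
  have "\<pi> 0 = 0" using assms[of 0 0] by simp
  then have "push \<pi> (1 :: 'a laurent) = 1" using push_single[of \<pi> 0 1] by simp
  then show ?thesis
    by (induction A rule: infinite_finite_induct) (auto simp: push_mult[OF assms])
qed

lemma push_power:
  assumes "\<And>\<alpha> \<beta>. \<pi> (\<alpha> + \<beta>) = \<pi> \<alpha> + \<pi> \<beta>"
  shows "push \<pi> (f ^ k) = push \<pi> f ^ k"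
  using push_prod[OF assms, where A = "{..<k}" and f = "\<lambda>_. f"] by simp

lemma push_fixed_lookup:
  assumes "inj \<pi>" "push \<pi> f = f"
  shows "lkp f (\<pi> \<alpha>) = lkp f \<alpha>"
proof -
  have "lkp f (\<pi> \<alpha>) = lkp (push \<pi> f) (\<pi> \<alpha>)" using assms(2) by simp
  also have "\<dots> = (\<Sum>\<beta>\<in>insert \<alpha> (kys f). lkp (sngl (\<pi> \<beta>) (lkp f \<beta>)) (\<pi> \<alpha>))"
    by (subst push_superset[of "insert \<alpha> (kys f)"]) (auto simp: lookup_sum)
  also have "\<dots> = (\<Sum>\<beta>\<in>{\<alpha>}. lkp (sngl (\<pi> \<beta>) (lkp f \<beta>)) (\<pi> \<alpha>))"
    by (rule sum.mono_neutral_right) (use assms(1) in \<open>auto simp: lookup_single when_def dest: injD\<close>)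
  finally show ?thesis by simp
qed

section \<open>Permutations of the variables and generated rings\<close>

lemma permutes_map_key_add:
  "\<sigma> permutes S \<Longrightarrow> Poly_Mapping.map_key \<sigma> (\<alpha> + \<beta>) = Poly_Mapping.map_key \<sigma> \<alpha> + Poly_Mapping.map_key \<sigma> (\<beta> :: expo)"
  by (rule map_key_plus) (rule permutes_inj)

lemma lookup_map_key: "\<sigma> permutes S \<Longrightarrow> lkp (Poly_Mapping.map_key \<sigma> \<alpha>) i = lkp \<alpha> (\<sigma> i)"
  by (simp add: map_key.rep_eq permutes_inj)

lemma inj_map_key: "\<sigma> permutes S \<Longrightarrow> inj (Poly_Mapping.map_key \<sigma> :: expo \<Rightarrow> expo)"
proof (rule injI)
  fix \<alpha> \<beta> :: expo assume \<sigma>: "\<sigma> permutes S" and eq: "Poly_Mapping.map_key \<sigma> \<alpha> = Poly_Mapping.map_key \<sigma> \<beta>"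
  show "\<alpha> = \<beta>"
  proof (rule poly_mapping_eqI)
    fix i
    have "lkp (Poly_Mapping.map_key \<sigma> \<alpha>) (Hilbert_Choice.inv \<sigma> i) = lkp (Poly_Mapping.map_key \<sigma> \<beta>) (Hilbert_Choice.inv \<sigma> i)"
      using eq by simp
    then show "lkp \<alpha> i = lkp \<beta> i" using \<sigma> by (simp add: lookup_map_key permutes_inverses)
  qed
qed

lemma map_key_single_permutes:
  assumes "\<sigma> permutes S"
  shows "Poly_Mapping.map_key \<sigma> (sngl (\<sigma> j) k) = sngl j (k :: int)"
  by (rule map_key_single) (rule permutes_inj[OF assms])

lemma lsymmetricI: "(\<And>\<sigma>. \<sigma> permutes {1..n} \<Longrightarrow> push (Poly_Mapping.map_key \<sigma>) f = f) \<Longrightarrow> lsymmetric n f"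
  unfolding lsymmetric_def using push_fixed_lookup inj_map_key by blast

lemma lsymmetric_add: "lsymmetric n f \<Longrightarrow> lsymmetric n g \<Longrightarrow> lsymmetric n (f + g)"
  by (simp add: lsymmetric_def lookup_add)

lemma lsymmetric_const_mult: "lsymmetric n f \<Longrightarrow> lsymmetric n (const c * f)"
  by (simp add: lsymmetric_def lookup_const_mult)

lemma adjoin_sum:
  "0 \<in> R \<Longrightarrow> (\<And>a. a \<in> A \<Longrightarrow> f a \<in> adjoin R G) \<Longrightarrow> (\<Sum>a\<in>A. f a) \<in> adjoin R G"
  by (induction A rule: infinite_finite_induct) (auto intro: adjoin.intros)

lemma adjoin_prod:
  "1 \<in> R \<Longrightarrow> (\<And>a. a \<in> A \<Longrightarrow> f a \<in> adjoin R G) \<Longrightarrow> (\<Prod>a\<in>A. f a) \<in> adjoin R G"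
  by (induction A rule: infinite_finite_induct) (auto intro: adjoin.intros)

lemma adjoin_power: "1 \<in> R \<Longrightarrow> f \<in> adjoin R G \<Longrightarrow> f ^ k \<in> adjoin R G"
  by (induction k) (auto intro: adjoin.intros)

lemma const_0 [simp]: "const 0 = 0" and const_1 [simp]: "const 1 = 1"
  by (simp_all add: const_def)

lemma ldegree_le_iff: "ldegree f \<le> m \<longleftrightarrow> (\<forall>\<alpha>\<in>kys f. expo_size \<alpha> \<le> m)"
  by (simp add: ldegree_def expo_size_def)

text \<open>
  All four families have generators of the form \<open>y\<^sub>i = \<Sum>k\<in>K. x\<^sub>i\<^sup>k\<close>, where \<open>K\<close> is \<open>{D}\<close> or \<open>{D, -D}\<close> and
  \<open>D\<close> is the degree factor.
\<close>

locale laurent_family =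
  fixes F :: "'a::field_char_0 family" and K :: "int set" and n :: nat and Y :: "nat \<Rightarrow> nat \<Rightarrow> 'a"
  assumes D_pos: "0 < deg_factor F"
    and K: "K = {int (deg_factor F)} \<or> K = {int (deg_factor F), - int (deg_factor F)}"
    and generator: "generator F i = (\<Sum>k\<in>K. var_pow i k)"
    and Y: "inj_grid Y"
    and shift_value: "\<nu> \<in> partitions n \<Longrightarrow> i \<in> {1..n} \<Longrightarrow>
      (\<Sum>k\<in>K. shift F n \<nu> i powi k) = Y (\<nu> i) (n - i)"
    and shift_nonzero: "K = {int (deg_factor F)} \<or> (\<forall>\<nu>\<in>partitions n. \<forall>i. shift F n \<nu> i \<noteq> 0)"
begin

abbreviation D :: nat where "D \<equiv> deg_factor F"

definition gen_monomial :: "(nat \<Rightarrow> nat) \<Rightarrow> 'a laurent" where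
  "gen_monomial b = (\<Prod>i=1..n. generator F i ^ b i)"

text \<open>The counterpart of \<open>expansion\<close> with the generators substituted for the
  variables.\<close>

definition realize :: "nat \<Rightarrow> ((nat \<Rightarrow> nat) \<Rightarrow> 'a) \<Rightarrow> 'a laurent" where
  "realize d c = (\<Sum>b\<in>exponents n d. const (c b) * gen_monomial b)"

definition exponent :: "(nat \<Rightarrow> nat) \<Rightarrow> expo" where
  "exponent b = (\<Sum>i=1..n. sngl i (int (D * b i)))"

lemma finite_K: "finite K" using K by auto

lemma K_bound: "k \<in> K \<Longrightarrow> nat \<bar>k\<bar> = D \<and> k \<le> int D" using K by auto

lemma keys_generator: "\<alpha> \<in> kys (generator F i) \<Longrightarrow> \<exists>k\<in>K. \<alpha> = sngl i k"
proof -
  assume "\<alpha> \<in> kys (generator F i)"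
  then have "lkp (generator F i) \<alpha> \<noteq> 0" by (simp add: in_keys_iff)
  then have "(\<Sum>k\<in>K. lkp (var_pow i k :: 'a laurent) \<alpha>) \<noteq> 0"
    by (simp add: generator lookup_sum)
  then obtain k where "k \<in> K" "lkp (var_pow i k :: 'a laurent) \<alpha> \<noteq> 0"
    by (meson sum.neutral)
  then show ?thesis by (auto simp: var_pow_def lookup_single when_def split: if_splits)
qed

lemma expo_single:
  "expo_size (sngl i k) = nat \<bar>k\<bar>" "expo_sum (sngl i k) = k"
  by (simp_all add: expo_size_superset[of "{i}"] expo_sum_superset[of "{i}"])

lemma lookup_exponent: "lkp (exponent b) i = (if i \<in> {1..n} then int (D * b i) else 0)"
  unfolding exponent_def lookup_sum lookup_single when_def by (simp add: sum.delta')

lemma exponent_eq_lead: "exponent \<nu> = lead_expo F n \<nu>"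
  by (simp add: exponent_def lead_expo_def)

lemma exponent_sum_size: "expo_sum (exponent b) = int (D * weight n b)" "expo_size (exponent b) = D * weight n b"
proof -
  have "kys (exponent b) \<subseteq> {1..n}" by (auto simp: in_keys_iff lookup_exponent split: if_splits)
  then show "expo_sum (exponent b) = int (D * weight n b)" "expo_size (exponent b) = D * weight n b"
    by (simp_all add: expo_sum_superset[of "{1..n}"] expo_size_superset[of "{1..n}"] lookup_exponent
        weight_def sum_distrib_left del: of_nat_mult)
qed

lemma expo_size_mult_le:
  assumes "\<forall>\<alpha>\<in>kys f. expo_size \<alpha> \<le> l" "\<forall>\<alpha>\<in>kys g. expo_size \<alpha> \<le> m"
  shows "\<forall>\<alpha>\<in>kys (f * g). expo_size \<alpha> \<le> l + m"
proof
  fix \<alpha> assume "\<alpha> \<in> kys (f * g)"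
  then obtain \<beta> \<gamma> where "\<beta> \<in> kys f" "\<gamma> \<in> kys g" "\<alpha> = \<beta> + \<gamma>" using Poly_Mapping.keys_mult by fastforce
  then show "expo_size \<alpha> \<le> l + m" using assms expo_size_add[of \<beta> \<gamma>] by fastforce
qed

lemma gen_power_size: "\<forall>\<alpha>\<in>kys (generator F i ^ m). expo_size \<alpha> \<le> D * m"
proof (induction m)
  case 0
  then show ?case by (simp add: expo_size_def)
next
  case (Suc m)
  have "\<forall>\<alpha>\<in>kys (generator F i). expo_size \<alpha> \<le> D"
    using keys_generator K_bound by (fastforce simp: expo_single)
  from expo_size_mult_le[OF this Suc] show ?case by simp
qed

lemma gen_monomial_size: "\<forall>\<alpha>\<in>kys (gen_monomial b). expo_size \<alpha> \<le> D * weight n b"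
proof -
  have "\<forall>\<alpha>\<in>kys (\<Prod>i\<in>A. generator F i ^ b i). expo_size \<alpha> \<le> (\<Sum>i\<in>A. D * b i)" if "finite A" for A
    using that
  proof (induction A rule: finite_induct)
    case (insert i A)
    then show ?case using expo_size_mult_le[OF gen_power_size insert.IH] by simp
  qed (simp add: expo_size_def)
  then show ?thesis by (simp add: gen_monomial_def weight_def sum_distrib_left)
qed

text \<open>
  The sum of the coordinates is additive on exponents, unlike the degree, and its maximum on
  the monomials of \<open>gen_monomial b\<close> is attained only at \<open>exponent b\<close>.
\<close>

definition leads_with :: "'a laurent \<Rightarrow> expo \<Rightarrow> bool" where
  "leads_with f \<alpha> \<longleftrightarrow> lkp f \<alpha> = 1 \<and> (\<forall>\<beta>\<in>kys f. \<beta> \<noteq> \<alpha> \<longrightarrow> expo_sum \<beta> < expo_sum \<alpha>)"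

lemma leads_with_decompose:
  "leads_with f \<alpha> \<longleftrightarrow> (\<exists>r. f = sngl \<alpha> 1 + r \<and> (\<forall>\<beta>\<in>kys r. expo_sum \<beta> < expo_sum \<alpha>))"
proof
  assume *: "leads_with f \<alpha>"
  have "expo_sum \<beta> < expo_sum \<alpha>" if "\<beta> \<in> kys (f - sngl \<alpha> 1)" for \<beta>
    using * that by (cases "\<beta> = \<alpha>") (auto simp: leads_with_def in_keys_iff lookup_minus lookup_single when_def)
  then show "\<exists>r. f = sngl \<alpha> 1 + r \<and> (\<forall>\<beta>\<in>kys r. expo_sum \<beta> < expo_sum \<alpha>)"
    by (intro exI[of _ "f - sngl \<alpha> 1"]) auto
next
  assume "\<exists>r. f = sngl \<alpha> 1 + r \<and> (\<forall>\<beta>\<in>kys r. expo_sum \<beta> < expo_sum \<alpha>)"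
  then obtain r where r: "f = sngl \<alpha> 1 + r" "\<And>\<beta>. \<beta> \<in> kys r \<Longrightarrow> expo_sum \<beta> < expo_sum \<alpha>" by blast
  then have "\<alpha> \<notin> kys r" by blast
  with r show "leads_with f \<alpha>"
    by (auto simp: leads_with_def in_keys_iff lookup_add lookup_single when_def)
qed

lemma leads_with_mult:
  assumes "leads_with f \<alpha>" "leads_with g \<beta>"
  shows "leads_with (f * g) (\<alpha> + \<beta>)"
proof -
  obtain r where r: "f = sngl \<alpha> 1 + r" "\<And>\<gamma>. \<gamma> \<in> kys r \<Longrightarrow> expo_sum \<gamma> < expo_sum \<alpha>"
    using assms(1) by (auto simp: leads_with_decompose)
  obtain s where s: "g = sngl \<beta> 1 + s" "\<And>\<gamma>. \<gamma> \<in> kys s \<Longrightarrow> expo_sum \<gamma> < expo_sum \<beta>"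
    using assms(2) by (auto simp: leads_with_decompose)
  have "f * g = sngl (\<alpha> + \<beta>) 1 + (sngl \<alpha> 1 * s + r * g)"
    by (simp add: r(1) s(1) distrib_left distrib_right mult_single)
  moreover have "expo_sum \<gamma> < expo_sum (\<alpha> + \<beta>)" if \<gamma>: "\<gamma> \<in> kys (sngl \<alpha> 1 * s + r * g)" for \<gamma>
  proof -
    have g: "expo_sum \<delta> \<le> expo_sum \<beta>" if "\<delta> \<in> kys g" for \<delta>
      using assms(2) that by (cases "\<delta> = \<beta>") (auto simp: leads_with_def)
    consider "\<gamma> \<in> kys (sngl \<alpha> 1 * s)" | "\<gamma> \<in> kys (r * g)"
      using \<gamma> Poly_Mapping.keys_add[of "sngl \<alpha> 1 * s" "r * g"] by blast
    then show ?thesis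
    proof cases
      case 1
      then obtain \<delta> where "\<gamma> = \<alpha> + \<delta>" "\<delta> \<in> kys s"
        using Poly_Mapping.keys_mult[of "sngl \<alpha> 1" s] by fastforce
      then show ?thesis using s(2) by (simp add: expo_sum_add)
    next
      case 2
      then obtain \<delta> \<epsilon> where "\<gamma> = \<delta> + \<epsilon>" "\<delta> \<in> kys r" "\<epsilon> \<in> kys g"
        using Poly_Mapping.keys_mult[of r g] by fastforce
      then show ?thesis using r(2)[of \<delta>] g[of \<epsilon>] by (simp add: expo_sum_add)
    qed
  qed
  ultimately show ?thesis unfolding leads_with_decompose by blast
qed

lemma leads_with_one: "leads_with 1 0"
  by (simp add: leads_with_def)

lemma leads_with_generator: "leads_with (generator F i) (sngl i (int D))"
proof -
  have "lkp (generator F i) (sngl i (int D)) = (\<Sum>k\<in>K. lkp (var_pow i k :: 'a laurent) (sngl i (int D)))"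
    by (simp add: generator lookup_sum)
  also have "\<dots> = (\<Sum>k\<in>{int D}. lkp (var_pow i k :: 'a laurent) (sngl i (int D)))"
  proof (rule sum.mono_neutral_right)
    show "\<forall>k\<in>K - {int D}. lkp (var_pow i k :: 'a laurent) (sngl i (int D)) = 0"
    proof
      fix k assume "k \<in> K - {int D}"
      then have "sngl i k \<noteq> sngl i (int D)" by (metis DiffD2 insertI1 lookup_single_eq)
      then show "lkp (var_pow i k :: 'a laurent) (sngl i (int D)) = 0"
        by (simp add: var_pow_def lookup_single when_def)
    qed
  qed (use K finite_K in auto)
  also have "\<dots> = 1" by (simp add: var_pow_def)
  finally have "lkp (generator F i) (sngl i (int D)) = 1" .
  moreover have "expo_sum \<beta> < int D" if \<beta>: "\<beta> \<in> kys (generator F i)" "\<beta> \<noteq> sngl i (int D)" for \<beta>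
  proof -
    obtain k where "k \<in> K" "\<beta> = sngl i k" using keys_generator \<beta>(1) by blast
    then show ?thesis using \<beta>(2) K_bound[of k] by (auto simp: expo_single le_less)
  qed
  ultimately show ?thesis by (auto simp: leads_with_def expo_single)
qed

lemma leads_with_gen_power: "leads_with (generator F i ^ m) (sngl i (int (D * m)))"
proof (induction m)
  case 0
  then show ?case by (simp add: leads_with_one)
next
  case (Suc m)
  have "sngl i (int D) + sngl i (int (D * m)) = sngl i (int (D * Suc m))"
    by (simp add: algebra_simps flip: single_add)
  with leads_with_mult[OF leads_with_generator[of i] Suc] show ?case by simp
qed

lemma leads_with_gen_monomial: "leads_with (gen_monomial b) (exponent b)"
proof -
  have "leads_with (\<Prod>i\<in>A. generator F i ^ b i) (\<Sum>i\<in>A. sngl i (int (D * b i)))" if "finite A" for A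
    using that
    by (induction A rule: finite_induct)
      (simp_all add: leads_with_one leads_with_mult leads_with_gen_power del: of_nat_mult)
  then show ?thesis by (simp add: gen_monomial_def exponent_def)
qed

text \<open>The leading exponent of \<open>gen_monomial b\<close> has coordinate sum at most
  \<open>D * d\<close>, which is the sum for \<mu>. Hence the exponent of \<mu> can only occur as a
  leading one, that is for \<open>b = \<mu>\<close>.\<close>

lemma lookup_gen_monomial:
  assumes b: "b \<in> exponents n d" and \<mu>: "\<mu> \<in> exponents n d" "weight n \<mu> = d"
  shows "lkp (gen_monomial b) (exponent \<mu>) = (if b = \<mu> then 1 else 0)"
proof (cases "b = \<mu>")
  case True
  then show ?thesis using leads_with_gen_monomial[of \<mu>] by (simp add: leads_with_def)
next
  case False
  have "exponent b \<noteq> exponent \<mu>"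
  proof
    assume eq: "exponent b = exponent \<mu>"
    have "b i = \<mu> i" for i
    proof (cases "i \<in> {1..n}")
      case True
      then have "int (D * b i) = int (D * \<mu> i)"
        using arg_cong[OF eq, of "\<lambda>\<alpha>. lkp \<alpha> i"] by (simp add: lookup_exponent)
      then show ?thesis using D_pos by simp
    next
      case False
      then show ?thesis using b \<mu> by (auto simp: exponents_def)
    qed
    with False show False by auto
  qed
  moreover have "\<not> expo_sum (exponent \<mu>) < expo_sum (exponent b)"
    using b \<mu>(2) by (simp add: exponent_sum_size exponents_def del: of_nat_mult)
  ultimately have "exponent \<mu> \<notin> kys (gen_monomial b)"
    using leads_with_gen_monomial[of b] unfolding leads_with_def by metis
  then show ?thesis using False by (simp add: in_keys_iff)
qed

lemma lookup_realize:
  assumes "\<mu> \<in> exponents n d" "weight n \<mu> = d"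
  shows "lkp (realize d c) (exponent \<mu>) = c \<mu>"
  unfolding realize_def lookup_sum lookup_const_mult
  using assms by (simp add: lookup_gen_monomial[OF _ assms] if_distrib cong: sum.cong if_cong)

lemma realize_degree: "ldegree (realize d c) \<le> D * d"
proof -
  have "expo_size \<alpha> \<le> D * d" if "\<alpha> \<in> kys (realize d c)" for \<alpha>
  proof -
    have "lkp (realize d c) \<alpha> \<noteq> 0" using that by (simp add: in_keys_iff)
    then obtain b where b: "b \<in> exponents n d" "lkp (gen_monomial b) \<alpha> \<noteq> 0"
      unfolding realize_def lookup_sum lookup_const_mult by (metis (no_types, lifting) mult_zero_right sum.neutral)
    then have "expo_size \<alpha> \<le> D * weight n b" using gen_monomial_size by (simp add: in_keys_iff)
    also have "\<dots> \<le> D * d" using b(1) by (simp add: exponents_def)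
    finally show ?thesis .
  qed
  then show ?thesis by (simp add: ldegree_le_iff)
qed

lemma realize_adjoin: "realize d c \<in> adjoin (range const) (generator F ` {1..n})"
proof -
  have one: "1 \<in> range (const :: 'a \<Rightarrow> _)" and zero: "0 \<in> range (const :: 'a \<Rightarrow> _)"
    using const_0 const_1 by (metis rangeI)+
  show ?thesis
    unfolding realize_def gen_monomial_def
    by (intro adjoin_sum zero adjoin.mult adjoin_prod one adjoin_power adjoin.base adjoin.gen) auto
qed

lemma push_generator:
  assumes "\<sigma> permutes {1..n}"
  shows "push (Poly_Mapping.map_key \<sigma>) (generator F (\<sigma> i)) = generator F i"
  unfolding generator push_sum var_pow_def push_single map_key_single_permutes[OF assms] ..

lemma realize_symmetric:
  assumes c: "\<And>\<sigma> b. \<sigma> permutes {1..n} \<Longrightarrow> b \<in> exponents n d \<Longrightarrow> c (\<lambda>i. b (\<sigma> i)) = c b"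
  shows "lsymmetric n (realize d c)"
proof (rule lsymmetricI)
  fix \<sigma> assume \<sigma>: "\<sigma> permutes {1..n}"
  let ?\<pi> = "Poly_Mapping.map_key \<sigma> :: expo \<Rightarrow> expo"
  note add = permutes_map_key_add[OF \<sigma>]
  have "push ?\<pi> (gen_monomial b) = gen_monomial (\<lambda>i. b (\<sigma> i))" for b
  proof -
    have "push ?\<pi> (gen_monomial b) = (\<Prod>i=1..n. push ?\<pi> (generator F i) ^ b i)"
      by (simp add: gen_monomial_def push_prod[OF add] push_power[OF add])
    also have "\<dots> = (\<Prod>i=1..n. push ?\<pi> (generator F (\<sigma> i)) ^ b (\<sigma> i))"
      using prod.permute[OF \<sigma>, of "\<lambda>i. push ?\<pi> (generator F i) ^ b i"] by (simp add: o_def)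
    finally show ?thesis by (simp add: push_generator[OF \<sigma>] gen_monomial_def)
  qed
  moreover have "push ?\<pi> (const a) = const a" for a :: 'a
  proof -
    have "?\<pi> 0 = 0" by (rule map_key_zero) (rule permutes_inj[OF \<sigma>])
    then show ?thesis by (simp add: const_def push_single)
  qed
  ultimately have "push ?\<pi> (realize d c) = (\<Sum>b\<in>exponents n d. const (c b) * gen_monomial (\<lambda>i. b (\<sigma> i)))"
    by (simp add: realize_def push_sum push_mult[OF add])
  also have "\<dots> = (\<Sum>b\<in>exponents n d. const (c (\<lambda>i. b (\<sigma> i))) * gen_monomial (\<lambda>i. b (\<sigma> i)))"
    by (rule sum.cong) (auto simp: c[OF \<sigma>])
  also have "\<dots> = realize d c"
    unfolding realize_def
  proof (rule sum.reindex_bij_witness[of _ "\<lambda>b i. b (Hilbert_Choice.inv \<sigma> i)" "\<lambda>b i. b (\<sigma> i)"])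
    fix b assume "b \<in> exponents n d"
    then show "(\<lambda>i. b (Hilbert_Choice.inv \<sigma> i)) \<in> exponents n d" "(\<lambda>i. b (\<sigma> i)) \<in> exponents n d"
      using exponents_permutes \<sigma> permutes_inv by blast+
  qed (use permutes_inverses[OF \<sigma>] in auto)
  finally show "push ?\<pi> (realize d c) = realize d c" .
qed

lemma leval_generator:
  "leval (generator F i) x = (\<Sum>k\<in>K. x i powi k)"
  by (simp add: generator leval_sum var_pow_def leval_single expo_value_superset[of "{i}"])

lemma regular_generator:
  assumes "\<nu> \<in> partitions n"
  shows "regular_at (shift F n \<nu>) (generator F i)"
  unfolding regular_at_def
proof (intro ballI allI)
  fix \<alpha> j assume "\<alpha> \<in> kys (generator F i)"
  then obtain k where k: "k \<in> K" "\<alpha> = sngl i k" using keys_generator by blast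
  show "shift F n \<nu> j \<noteq> 0 \<or> 0 \<le> lkp \<alpha> j"
    using shift_nonzero assms k by (auto simp: lookup_single when_def)
qed

lemma leval_realize:
  assumes \<nu>: "\<nu> \<in> partitions n"
  shows "leval (realize d c) (shift F n \<nu>) = expansion n d c (grid_point n Y \<nu>)"
proof -
  have "leval (gen_monomial b) (shift F n \<nu>) = monomial n b (grid_point n Y \<nu>)" for b
  proof -
    have pw: "regular_at (shift F n \<nu>) (generator F i ^ m)" "leval (generator F i ^ m) (shift F n \<nu>) = leval (generator F i) (shift F n \<nu>) ^ m" for i m
      by (induction m) (auto simp: leval_mult regular_generator[OF \<nu>] regular_at_one regular_at_mult)
    have "leval (gen_monomial b) (shift F n \<nu>) = (\<Prod>i=1..n. leval (generator F i) (shift F n \<nu>) ^ b i)"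
      unfolding gen_monomial_def by (subst leval_prod) (simp_all add: pw)
    also have "\<dots> = monomial n b (grid_point n Y \<nu>)"
      unfolding monomial_def grid_point_def
      by (rule prod.cong) (simp_all add: leval_generator shift_value[OF \<nu>])
    finally show ?thesis .
  qed
  then show ?thesis by (simp add: realize_def leval_sum leval_const_mult expansion_def)
qed


lemma Lam_combination:
  assumes "f \<in> Lam F n" "g \<in> Lam F n"
  shows "const s * f + g \<in> Lam F n"
proof -
  have "const s \<in> adjoin (range const) (generator F ` {1..n})" by (rule adjoin.base) simp
  then show ?thesis
    using assms by (auto simp: Lam_def intro: adjoin.add adjoin.mult lsymmetric_add lsymmetric_const_mult)
qed

lemma ldegree_combination:
  assumes "ldegree f \<le> m" "ldegree g \<le> m"
  shows "ldegree (const s * f + g) \<le> m"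
  using assms unfolding ldegree_le_iff
  by (auto simp: in_keys_iff lookup_add lookup_const_mult)

lemma zero_Lam: "0 \<in> Lam F n"
proof -
  have "(0 :: 'a laurent) \<in> range const" using const_0 by (metis rangeI)
  then show ?thesis by (auto simp: Lam_def lsymmetric_def intro: adjoin.base)
qed

lemma Lam_sum:
  assumes "finite A" "\<And>a. a \<in> A \<Longrightarrow> f a \<in> Lam F n \<and> ldegree (f a) \<le> m"
  shows "(\<Sum>a\<in>A. const (s a) * f a) \<in> Lam F n \<and> ldegree (\<Sum>a\<in>A. const (s a) * f a) \<le> m"
  using assms
proof (induction A rule: finite_induct)
  case empty
  then show ?case by (simp add: zero_Lam ldegree_def)
next
  case (insert a A)
  then show ?case by (simp add: Lam_combination ldegree_combination)
qed

section \<open>Invariance under inverting a variable\<close>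

definition flip :: "nat \<Rightarrow> expo \<Rightarrow> expo" where
  "flip i \<alpha> = \<alpha> - sngl i (2 * lkp \<alpha> i)"

lemma lookup_flip: "lkp (flip i \<alpha>) j = (if j = i then - lkp \<alpha> i else lkp \<alpha> j)"
  by (simp add: flip_def lookup_minus lookup_single when_def)

lemma flip_add: "flip i (\<alpha> + \<beta>) = flip i \<alpha> + flip i \<beta>"
  by (rule poly_mapping_eqI) (simp add: lookup_flip lookup_add)

lemma inj_flip: "inj (flip i)"
proof (rule injI)
  fix \<alpha> \<beta> assume "flip i \<alpha> = flip i \<beta>"
  then have eq: "lkp (flip i \<alpha>) j = lkp (flip i \<beta>) j" for j by simp
  show "\<alpha> = \<beta>"
  proof (rule poly_mapping_eqI)
    fix j show "lkp \<alpha> j = lkp \<beta> j"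
      using eq[of j] by (auto simp: lookup_flip split: if_splits)
  qed
qed

lemma flip_single: "flip i (sngl j k) = (if i = j then sngl j (- k) else sngl j k)"
  by (rule poly_mapping_eqI) (simp add: lookup_flip lookup_single when_def)

lemma adjoin_flip:
  assumes K2: "K = {int D, - int D}" and f: "f \<in> adjoin (range const) (generator F ` {1..n})"
  shows "push (flip i) f = f"
  using f
proof (induction rule: adjoin.induct)
  case (base r)
  then obtain c where "r = const c" by blast
  moreover have "flip i 0 = 0" by (simp add: flip_def)
  ultimately show ?case by (simp add: const_def push_single)
next
  case (gen g)
  then obtain j where g: "g = generator F j" by blast
  have "(\<Sum>k\<in>K. push (flip i) (var_pow j k :: 'a laurent)) = (\<Sum>k\<in>K. var_pow j k)"
    by (rule sum.reindex_bij_witness[of _ "\<lambda>k. if i = j then - k else k" "\<lambda>k. if i = j then - k else k"])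
      (auto simp: K2 var_pow_def push_single flip_single)
  then show ?case by (simp add: g generator push_sum)
qed (simp_all add: push_add push_mult[OF flip_add])

lemma adjoin_keys:
  assumes "f \<in> adjoin (range const) (generator F ` {1..n})" "\<alpha> \<in> kys f"
  shows "(\<forall>i. int D dvd lkp \<alpha> i) \<and> kys \<alpha> \<subseteq> {1..n} \<and> (K = {int D} \<longrightarrow> (\<forall>i. 0 \<le> lkp \<alpha> i))"
  using assms
proof (induction arbitrary: \<alpha> rule: adjoin.induct)
  case (base r)
  then show ?case by (auto simp: const_def split: if_splits)
next
  case (gen g)
  then obtain i where i: "i \<in> {1..n}" "g = generator F i" by blast
  then obtain k where "k \<in> K" "\<alpha> = sngl i k" using keys_generator gen by blast
  then show ?case using i(1) K by (auto simp: lookup_single when_def)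
next
  case (add f g)
  then show ?case using Poly_Mapping.keys_add[of f g] by blast
next
  case (mult f g)
  obtain \<beta> \<gamma> where \<beta>: "\<beta> \<in> kys f" and \<gamma>: "\<gamma> \<in> kys g" and \<alpha>: "\<alpha> = \<beta> + \<gamma>"
    using mult.prems Poly_Mapping.keys_mult[of f g] by blast
  show ?case
    using mult.IH(1)[OF \<beta>] mult.IH(2)[OF \<gamma>] Poly_Mapping.keys_add[of \<beta> \<gamma>]
    unfolding \<alpha> by (auto simp: lookup_add)
qed

text \<open>
  An element of \<open>\<Lambda>\<close> is determined by its coefficients at the partitions: signs are removed by the
  reflections \<open>flip\<close> and the coordinates are sorted by a permutation.
\<close>

lemma Lam_eq_0:
  assumes f: "f \<in> Lam F n" "ldegree f \<le> D * d"
    and z: "\<And>\<nu>. \<nu> \<in> partitions n \<Longrightarrow> weight n \<nu> \<le> d \<Longrightarrow> lkp f (exponent \<nu>) = 0"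
  shows "f = 0"
proof (rule poly_mapping_eqI)
  fix \<alpha>
  have ad: "f \<in> adjoin (range const) (generator F ` {1..n})" and sym: "lsymmetric n f"
    using f by (auto simp: Lam_def)
  show "lkp f \<alpha> = lkp 0 \<alpha>"
  proof (rule ccontr)
    assume "lkp f \<alpha> \<noteq> lkp 0 \<alpha>"
    then have \<alpha>: "\<alpha> \<in> kys f" by (simp add: in_keys_iff)
    note key = adjoin_keys[OF ad \<alpha>]
    \<comment> \<open>The division is exact: by \<open>adjoin_keys\<close> all exponents occurring
      in \<open>f\<close> are divisible by \<open>D\<close>.\<close>
    define b where "b i = nat \<bar>lkp \<alpha> i\<bar> div D" for i
    have Db: "int (D * b i) = \<bar>lkp \<alpha> i\<bar>" for i
    proof -
      have "int D dvd \<bar>lkp \<alpha> i\<bar>" using key by simp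
      then have "D dvd nat \<bar>lkp \<alpha> i\<bar>" by (simp add: int_dvd_int_iff[symmetric])
      then show ?thesis by (simp add: b_def)
    qed
    have outside: "lkp \<alpha> i = 0" if "i \<notin> {1..n}" for i
      using key that by (auto simp: in_keys_iff subset_iff)
    have "\<exists>\<beta>. lkp f \<beta> = lkp f \<alpha> \<and> (\<forall>i. lkp \<beta> i = (if i \<in> A then \<bar>lkp \<alpha> i\<bar> else lkp \<alpha> i))"
      if "finite A" for A
    proof (cases "K = {int D}")
      case True
      then show ?thesis using key by (intro exI[of _ \<alpha>]) auto
    next
      case False
      then have K2: "K = {int D, - int D}" using K by auto
      show ?thesis
        using that
      proof (induction A rule: finite_induct)
        case empty
        then show ?case by auto
      next
        case (insert i A)
        then obtain \<beta> where \<beta>: "lkp f \<beta> = lkp f \<alpha>"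
          "\<And>i. lkp \<beta> i = (if i \<in> A then \<bar>lkp \<alpha> i\<bar> else lkp \<alpha> i)" by blast
        show ?case
        proof (cases "0 \<le> lkp \<alpha> i")
          case True
          then show ?thesis using \<beta> by (intro exI[of _ \<beta>]) auto
        next
          case False
          have "lkp f (flip i \<beta>) = lkp f \<beta>"
            by (rule push_fixed_lookup[OF inj_flip adjoin_flip[OF K2 ad]])
          then show ?thesis
            using \<beta> False insert.hyps by (intro exI[of _ "flip i \<beta>"]) (auto simp: lookup_flip)
        qed
      qed
    qed
    then obtain \<beta> where \<beta>: "lkp f \<beta> = lkp f \<alpha>" "\<And>i. lkp \<beta> i = (if i \<in> {1..n} then \<bar>lkp \<alpha> i\<bar> else lkp \<alpha> i)"
      by (meson finite_atLeastAtMost)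
    have "\<forall>i. i \<notin> {1..n} \<longrightarrow> b i = 0" using outside by (simp add: b_def)
    then obtain \<sigma> where \<sigma>: "\<sigma> permutes {1..n}" "(\<lambda>i. b (\<sigma> i)) \<in> partitions n"
      by (rule sort_exponents)
    have "exponent (\<lambda>i. b (\<sigma> i)) = Poly_Mapping.map_key \<sigma> \<beta>"
    proof (rule poly_mapping_eqI)
      fix i
      have "\<sigma> i \<in> {1..n} \<longleftrightarrow> i \<in> {1..n}" using \<sigma>(1) by (simp only: permutes_in_image)
      then show "lkp (exponent (\<lambda>i. b (\<sigma> i))) i = lkp (Poly_Mapping.map_key \<sigma> \<beta>) i"
        unfolding lookup_exponent lookup_map_key[OF \<sigma>(1)] \<beta>(2) Db using outside[of "\<sigma> i"] by presburger
    qed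
    then have "lkp f (exponent (\<lambda>i. b (\<sigma> i))) = lkp f \<alpha>"
      using sym \<sigma>(1) \<beta>(1) by (simp add: lsymmetric_def)
    moreover have "weight n (\<lambda>i. b (\<sigma> i)) \<le> d"
    proof -
      have "D * weight n b = (\<Sum>i=1..n. nat \<bar>lkp \<alpha> i\<bar>)"
        unfolding weight_def sum_distrib_left by (rule sum.cong) (use Db nat_int in \<open>metis, metis\<close>)
      also have "\<dots> = expo_size \<alpha>"
        using key by (simp add: expo_size_superset[of "{1..n}"])
      also have "\<dots> \<le> D * d" using f(2) \<alpha> by (simp add: ldegree_le_iff)
      finally show ?thesis using D_pos weight_permutes[OF \<sigma>(1), of b] by simp
    qed
    ultimately show False using z[OF \<sigma>(2)] \<alpha> by (simp add: in_keys_iff)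
  qed
qed

lemma realization:
  assumes "interpolates n Y \<mu> \<phi>" and \<mu>: "\<mu> \<in> partitions n"
  shows "\<exists>L\<in>Lam F n. ldegree L \<le> D * weight n \<mu> \<and> lkp L (lead_expo F n \<mu>) = 1 \<and>
    (\<forall>\<nu>\<in>partitions n. leval L (shift F n \<nu>) = \<phi> (grid_point n Y \<nu>))"
proof -
  let ?d = "weight n \<mu>"
  obtain c where c: "\<phi> = expansion n ?d c" "c \<mu> = 1"
    using assms(1) by (auto simp: interpolates_def monic_at_def)
  have sf: "symfun n ?d \<phi>" using assms(1) by (simp add: interpolates_def dual_at_def)
  have "realize ?d c \<in> Lam F n"
    using realize_adjoin realize_symmetric[of ?d c] symmetric_expansion[OF sf c(1)] by (auto simp: Lam_def)
  then show ?thesis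
    using realize_degree[of ?d c] lookup_realize[of \<mu> ?d c] leval_realize[of _ ?d c] c \<mu>
    by (intro bexI[of _ "realize ?d c"]) (auto simp: exponent_eq_lead partitions_exponents)
qed

text \<open>The dimension count is repeated inside \<open>Lam\<close>, with the coefficients at the
  exponents of partitions. With \<open>Lam_eq_0\<close> as the detecting property, elements of
  \<open>Lam\<close> never have to be rewritten as symmetric polynomials in the generators.\<close>

lemma Lam_vanishing:
  assumes f: "f \<in> Lam F n" "ldegree f \<le> D * d"
    and z: "\<And>\<nu>. \<nu> \<in> partitions n \<Longrightarrow> weight n \<nu> \<le> d \<Longrightarrow> leval f (shift F n \<nu>) = 0"
  shows "f = 0"
proof -
  define P where "P = {\<nu> \<in> partitions n. weight n \<nu> \<le> d}"
  have "\<exists>L \<phi>. interpolates n Y \<nu> \<phi> \<and> L \<in> Lam F n \<and> ldegree L \<le> D * weight n \<nu> \<and>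
    (\<forall>\<rho>\<in>partitions n. leval L (shift F n \<rho>) = \<phi> (grid_point n Y \<rho>))" if "\<nu> \<in> P" for \<nu>
    using interpolates_exists[OF Y, of \<nu> n] realization that unfolding P_def by blast
  then obtain L \<phi> where L: "\<And>\<nu>. \<nu> \<in> P \<Longrightarrow> interpolates n Y \<nu> (\<phi> \<nu>)" "\<And>\<nu>. \<nu> \<in> P \<Longrightarrow> L \<nu> \<in> Lam F n"
    "\<And>\<nu>. \<nu> \<in> P \<Longrightarrow> ldegree (L \<nu>) \<le> D * weight n \<nu>"
    "\<And>\<nu> \<rho>. \<nu> \<in> P \<Longrightarrow> \<rho> \<in> partitions n \<Longrightarrow> leval (L \<nu>) (shift F n \<rho>) = \<phi> \<nu> (grid_point n Y \<rho>)"
    by metis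
  have fin: "finite P" by (simp add: P_def)
  have L_deg: "ldegree (L \<nu>) \<le> D * d" if "\<nu> \<in> P" for \<nu>
    using L(3)[OF that] that by (auto simp: P_def intro: order_trans)
  have "lkp f (exponent \<nu>) = 0" if "\<nu> \<in> P" for \<nu>
  proof (rule triangular_unique[where P = P and rank = "weight n" and c = "\<lambda>\<rho> \<nu>. lkp (L \<rho>) (exponent \<nu>)"
        and e = "\<lambda>\<rho> \<nu>. leval (L \<rho>) (shift F n \<nu>)" and ?e0.0 = "\<lambda>\<nu>. leval f (shift F n \<nu>)"
        and ?c0.0 = "\<lambda>\<nu>. lkp f (exponent \<nu>)" and q = \<nu>])
    fix s a \<nu>
    assume *: "\<And>\<nu>. \<nu> \<in> P \<Longrightarrow> s * lkp f (exponent \<nu>) + (\<Sum>\<rho>\<in>P. a \<rho> * lkp (L \<rho>) (exponent \<nu>)) = 0"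
      and \<nu>: "\<nu> \<in> P"
    let ?g = "const s * f + (\<Sum>\<rho>\<in>P. const (a \<rho>) * L \<rho>)"
    have "?g = 0"
    proof (rule Lam_eq_0)
      show "?g \<in> Lam F n" "ldegree ?g \<le> D * d"
        using Lam_sum[OF fin, of L "D * d" a] L(2) L_deg f by (auto intro: Lam_combination ldegree_combination)
      show "lkp ?g (exponent \<nu>) = 0" if "\<nu> \<in> partitions n" "weight n \<nu> \<le> d" for \<nu>
        using *[of \<nu>] that by (simp add: P_def lookup_add lookup_sum lookup_const_mult)
    qed
    then have "leval ?g (shift F n \<nu>) = 0" by simp
    then show "s * leval f (shift F n \<nu>) + (\<Sum>\<rho>\<in>P. a \<rho> * leval (L \<rho>) (shift F n \<nu>)) = 0"
      by (simp add: leval_add leval_sum leval_const_mult)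
  next
    fix \<nu> assume "\<nu> \<in> P"
    then show "leval (L \<nu>) (shift F n \<nu>) \<noteq> 0"
      using L(1)[of \<nu>] L(4)[of \<nu> \<nu>] by (auto simp: P_def interpolates_def dual_at_def)
  next
    fix \<nu> \<rho> assume "\<nu> \<in> P" "\<rho> \<in> P" "weight n \<rho> \<le> weight n \<nu>" "\<rho> \<noteq> \<nu>"
    then show "leval (L \<nu>) (shift F n \<rho>) = 0"
      using L(1)[of \<nu>] L(4)[of \<nu> \<rho>] by (auto simp: P_def interpolates_def dual_at_def)
  qed (use that z fin in \<open>auto simp: P_def\<close>)
  then show ?thesis using f by (intro Lam_eq_0[of f d]) (auto simp: P_def)
qed

text \<open>Resolves both definite descriptions: \<open>h_unital\<close> is \<open>L\<close> divided
  by H(\<mu>), unique by \<open>Lam_vanishing\<close>, and its multiple with leading coefficient 1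
  is \<open>L\<close>.\<close>

theorem adj_coeff_eq:
  assumes \<mu>: "\<mu> \<in> partitions n" and lam: "lam \<in> partitions n" and \<phi>: "interpolates n Y \<mu> \<phi>"
  shows "adj_coeff F n lam \<mu> = c_coeff F n \<mu> * \<phi> (grid_point n Y lam)"
proof -
  let ?d = "weight n \<mu>" and ?H = "\<phi> (grid_point n Y \<mu>)"
  obtain L where L: "L \<in> Lam F n" "ldegree L \<le> D * ?d" "lkp L (lead_expo F n \<mu>) = 1"
    "\<And>\<nu>. \<nu> \<in> partitions n \<Longrightarrow> leval L (shift F n \<nu>) = \<phi> (grid_point n Y \<nu>)"
    using realization[OF \<phi> \<mu>] by blast
  have H: "?H \<noteq> 0" using \<phi> by (simp add: interpolates_def dual_at_def)
  let ?h = "const (1 / ?H) * L"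
  have h_Lam: "?h \<in> Lam F n" "ldegree ?h \<le> D * ?d"
    using Lam_combination[OF L(1) zero_Lam, of "1 / ?H"] ldegree_combination[OF L(2), of 0 "1 / ?H"]
    by (simp_all add: ldegree_def)
  have h_val: "leval ?h (shift F n \<nu>) = (if \<nu> = \<mu> then 1 else 0)"
    if "\<nu> \<in> partitions n" "weight n \<nu> \<le> ?d" for \<nu>
    using that \<phi> H by (auto simp: leval_const_mult L(4) interpolates_def dual_at_def)
  have "h_unital F n \<mu> = ?h"
    unfolding h_unital_def
  proof (rule the_equality)
    fix g assume g: "g \<in> Lam F n \<and> ldegree g \<le> D * ?d \<and>
      (\<forall>\<nu>\<in>partitions n. weight n \<nu> \<le> ?d \<longrightarrow> leval g (shift F n \<nu>) = (if \<nu> = \<mu> then 1 else 0))"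
    have "const (- 1) * ?h + g = 0"
    proof (rule Lam_vanishing)
      show "const (- 1) * ?h + g \<in> Lam F n" "ldegree (const (- 1) * ?h + g) \<le> D * ?d"
        using g h_Lam by (auto intro: Lam_combination ldegree_combination)
    qed (use g h_val in \<open>simp add: leval_add leval_const_mult\<close>)
    moreover have "const (- 1) * ?h = - ?h"
      by (rule poly_mapping_eqI) (simp add: lookup_const_mult)
    ultimately show "g = ?h" by simp
  qed (use h_Lam h_val in auto)
  moreover have "h_monic F n \<mu> = L"
    unfolding h_monic_def
  proof (rule the_equality)
    have "L = const ?H * ?h"
      by (rule poly_mapping_eqI) (simp add: lookup_const_mult H)
    then show "(\<exists>c. L = const c * h_unital F n \<mu>) \<and> lkp L (lead_expo F n \<mu>) = 1"
      using L(3) \<open>h_unital F n \<mu> = ?h\<close> by auto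
  next
    fix g assume g: "(\<exists>c. g = const c * h_unital F n \<mu>) \<and> lkp g (lead_expo F n \<mu>) = 1"
    then obtain c where c: "g = const c * ?h" using \<open>h_unital F n \<mu> = ?h\<close> by auto
    then have "c / ?H = 1" using g L(3) by (simp add: lookup_const_mult)
    then show "g = L"
      unfolding c by (intro poly_mapping_eqI) (simp add: lookup_const_mult flip: divide_inverse)
  qed
  ultimately show ?thesis
    by (simp add: adj_coeff_def h_int_def leval_const_mult L(4)[OF lam])
qed

end

section \<open>Linear and quadratic lattices\<close>

context grid_operator
begin

text \<open>\<open>w\<close> cancels the two weights in \<open>dual_at_image\<close>, and
  \<open>R\<close> is the contribution of a single row. The operator produces just one dual function
  \<open>g\<close>; uniqueness carries the quotient over to \<open>f\<close>.\<close>

lemma new_row_ratio: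
  assumes Y': "inj_grid Y'" and w: "wt False (0, 0) = wt True (1, 0)"
    and R: "\<And>k m. 0 < m \<Longrightarrow> (row True (1, 0) - row False (k, m)) * (Y 0 0 - Y k m) =
      R k m * ((row False (0, 0) - row False (k, m)) * (Y 1 0 - Y k m))"
    and \<mu>: "\<mu> \<in> partitions (Suc n)" "\<mu> (Suc n) = 0" "\<mu>(Suc n := 1) \<in> partitions (Suc n)"
    and f: "dual_at (Suc n) Y \<mu> f"
  shows "f (grid_point (Suc n) Y (\<mu>(Suc n := 1))) =
    f (grid_point (Suc n) Y \<mu>) * (\<Prod>i=1..n. R (\<mu> i) (Suc n - i))"
proof -
  let ?lam = "\<mu>(Suc n := 1)"
  let ?P = "\<Prod>i=1..n. (row False (0, 0) - row False (\<mu> i, Suc n - i)) * (Y 1 0 - Y (\<mu> i) (Suc n - i))"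
  obtain h where "dual_at (Suc n) Y' \<mu> h"
    using interpolates_exists[OF Y' \<mu>(1)] by (auto simp: interpolates_def)
  then obtain g where g: "dual_at (Suc n) Y \<mu> g" and
    "g (grid_point (Suc n) Y ?lam) * (wt False (0, 0) * ?P) =
    g (grid_point (Suc n) Y \<mu>) * (wt True (1, 0) * (\<Prod>i=1..n.
      (row True (1, 0) - row False (\<mu> i, Suc n - i)) * (Y 0 0 - Y (\<mu> i) (Suc n - i))))"
    using dual_at_image[OF \<mu>] by blast
  moreover have "(\<Prod>i=1..n. (row True (1, 0) - row False (\<mu> i, Suc n - i)) * (Y 0 0 - Y (\<mu> i) (Suc n - i))) =
      (\<Prod>i=1..n. R (\<mu> i) (Suc n - i)) * ?P"
    unfolding prod.distrib[symmetric] by (rule prod.cong[OF refl], rule R) auto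
  moreover have "?P \<noteq> 0"
  proof -
    have "row False (0, 0) \<noteq> row False (\<mu> i, Suc n - i) \<and> Y 1 0 \<noteq> Y (\<mu> i) (Suc n - i)"
      if "i \<in> {1..n}" for i
    proof -
      have "Suc n - i \<noteq> 0" using that by simp
      then show ?thesis using row_inj inj unfolding inj_grid_def by metis
    qed
    then show ?thesis by (simp add: prod_zero_iff)
  qed
  moreover have "wt False (0, 0) \<noteq> 0" by (simp add: wt_False)
  ultimately have 1: "g (grid_point (Suc n) Y ?lam) =
      g (grid_point (Suc n) Y \<mu>) * (\<Prod>i=1..n. R (\<mu> i) (Suc n - i))"
    using w by (simp add: mult.assoc[symmetric])
  have 2: "f (grid_point (Suc n) Y ?lam) * g (grid_point (Suc n) Y \<mu>) =
      g (grid_point (Suc n) Y ?lam) * f (grid_point (Suc n) Y \<mu>)"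
    by (rule dual_at_unique[OF inj \<mu>(1) f g])
  have "g (grid_point (Suc n) Y \<mu>) \<noteq> 0" using g by (simp add: dual_at_def)
  then show ?thesis using 2 unfolding 1 by (simp add: field_simps)
qed

end

text \<open>
  With \<open>q = 1 + \<gamma>\<close>, \<open>t = 1 + \<gamma> \<tau>\<close> and \<open>X = 1 + \<gamma> x\<close>, the maps \<open>q_step\<close> and \<open>t_step\<close> of \<open>x\<close> are the
  multiplications of \<open>X\<close> by \<open>q\<close> and \<open>t\<close>, and \<open>oplus\<close> is the product of two values of \<open>X\<close>. At
  \<open>\<gamma> = 0\<close> they become the translations by \<open>1\<close> and \<open>\<tau>\<close> and the sum, which is how the rational
  families are treated together with the trigonometric ones.
\<close>

locale lattice =
  fixes \<gamma> \<tau> :: "'a::field_char_0"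
  assumes q_nonzero: "1 + \<gamma> \<noteq> 0" and t_nonzero: "1 + \<gamma> * \<tau> \<noteq> 0"
begin

definition q_step :: "'a \<Rightarrow> 'a" where "q_step x = (1 + \<gamma>) * x + 1"
definition t_step :: "'a \<Rightarrow> 'a" where "t_step x = (1 + \<gamma> * \<tau>) * x + \<tau>"
definition oplus :: "'a \<Rightarrow> 'a \<Rightarrow> 'a" where "oplus x y = x + y + \<gamma> * x * y"
definition node :: "'a \<Rightarrow> nat \<Rightarrow> nat \<Rightarrow> 'a" where "node \<beta> k m = (q_step ^^ k) ((t_step ^^ m) \<beta>)"

lemma steps_commute: "t_step (q_step x) = q_step (t_step x)"
  by (simp add: q_step_def t_step_def algebra_simps)

lemma node_0 [simp]: "node \<beta> 0 0 = \<beta>"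
  by (simp add: node_def)

lemma node_Suc_left: "node \<beta> (Suc k) m = q_step (node \<beta> k m)"
  by (simp add: node_def)

lemma node_Suc_right: "node \<beta> k (Suc m) = t_step (node \<beta> k m)"
  by (induction k) (simp_all add: node_def steps_commute)

lemma node_add: "node \<beta> (k + a) (m + b) = node (node \<beta> a b) k m"
proof (induction k)
  case 0
  then show ?case by (induction m) (simp_all add: node_Suc_right)
qed (simp add: node_Suc_left)

lemma one_plus_node: "1 + \<gamma> * node \<beta> k m = (1 + \<gamma> * \<beta>) * (1 + \<gamma>) ^ k * (1 + \<gamma> * \<tau>) ^ m"
proof (induction k)
  case 0
  have t: "1 + \<gamma> * t_step x = (1 + \<gamma> * x) * (1 + \<gamma> * \<tau>)" for x by (simp add: t_step_def algebra_simps)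
  show ?case by (induction m) (simp_all add: node_Suc_right t mult_ac)
next
  case (Suc k)
  have q: "1 + \<gamma> * q_step x = (1 + \<gamma> * x) * (1 + \<gamma>)" for x by (simp add: q_step_def algebra_simps)
  show ?case using Suc by (simp add: node_Suc_left q mult_ac)
qed

lemma one_plus_node_nonzero: "1 + \<gamma> * \<beta> \<noteq> 0 \<Longrightarrow> 1 + \<gamma> * node \<beta> k m \<noteq> 0"
  unfolding one_plus_node using q_nonzero t_nonzero by simp

text \<open>For \<gamma> \<noteq> 0 and X = 1 + \<gamma> \<beta> this is X q^k t^m - X = X (q^k t^m
  - 1) divided by \<gamma>. Every difference of nodes thus splits into a value of X and
  \<open>node 0 k m\<close>, and the latter is built from \<gamma>, \<tau> and 1 by sums and
  products only; positivity rests on this.\<close>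

lemma node_diff: "node \<beta> k m - \<beta> = (1 + \<gamma> * \<beta>) * node 0 k m"
proof (induction k)
  case 0
  show ?case
  proof (induction m)
    case (Suc m)
    then have "node \<beta> 0 m = \<beta> + (1 + \<gamma> * \<beta>) * node 0 0 m" by (simp add: algebra_simps)
    then show ?case by (simp add: node_Suc_right t_step_def algebra_simps)
  qed simp
next
  case (Suc k)
  then have "node \<beta> k m = \<beta> + (1 + \<gamma> * \<beta>) * node 0 k m" by (simp add: algebra_simps)
  then show ?case by (simp add: node_Suc_left q_step_def algebra_simps)
qed

lemma oplus_node: "oplus (node \<beta> k m) (node \<beta>' k' m') = node (oplus \<beta> \<beta>') (k + k') (m + m')"
proof -
  have q: "oplus (q_step x) y = q_step (oplus x y)" and t: "oplus (t_step x) y = t_step (oplus x y)" for x y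
    by (simp_all add: oplus_def q_step_def t_step_def algebra_simps)
  have comm: "oplus x y = oplus y x" for x y by (simp add: oplus_def algebra_simps)
  have 1: "oplus (node \<beta> k m) y = node (oplus \<beta> y) k m" for \<beta> k m y
  proof (induction k)
    case 0
    show ?case by (induction m) (simp_all add: node_Suc_right t)
  qed (simp add: node_Suc_left q)
  show ?thesis by (simp add: 1 comm[of \<beta>] node_add[symmetric])
qed

end

lemma pcompose_affine:
  fixes u v :: "'a::field"
  assumes "v \<noteq> 0"
  shows "\<exists>L'. degree L' \<le> degree L \<and> (\<forall>x. poly L' (u + v * x) = poly L x)"
  using assms by (intro exI[of _ "pcompose L [:- u / v, 1 / v:]"])
    (auto simp: poly_pcompose field_simps intro!: order_trans[OF degree_pcompose_le])

subsection \<open>Linear lattices\<close>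

locale linear_lattice = lattice +
  fixes \<beta> :: 'a and u v :: 'a
  assumes v: "v \<noteq> 0" and base: "1 + \<gamma> * \<beta> \<noteq> 0" and inj_node: "inj_grid (node \<beta>)"
begin

text \<open>
  The constant in \<open>wt False\<close> is the free parameter of the operator. It makes this weight vanish at
  \<open>node \<beta> 1 0\<close>, the node of the last row of \<open>\<lambda>\<close>.
\<close>

definition wt :: "bool \<Rightarrow> nat \<times> nat \<Rightarrow> 'a" where
  "wt e = (\<lambda>(k, m). let x = node \<beta> k m; z = q_step \<beta>; w = (x - \<beta>) / (1 + \<gamma> * x) in
    if e then w else (z - \<beta>) / (1 + \<gamma> * z) - w)"

text \<open>For \<open>True\<close> this inverts \<open>t_step\<close>, just as
  \<open>arg True\<close> inverts \<open>q_step\<close>. So shortening a row and keeping an equally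
  long row below it give the same value.\<close>

definition row :: "bool \<Rightarrow> nat \<times> nat \<Rightarrow> 'a" where
  "row e = (\<lambda>(k, m). let x = node \<beta> k m in if e then (x - \<tau>) / (1 + \<gamma> * \<tau>) else x)"

definition arg :: "bool \<Rightarrow> nat \<times> nat \<Rightarrow> 'a" where
  "arg e = (\<lambda>(k, m). let x = node \<beta> k m in if e then (x - 1) / (1 + \<gamma>) else x)"

text \<open>The inverse steps fix the point where \<open>1 + \<gamma> * x = 0\<close>. At that point
  the shifted product agrees with \<open>x ^ (p + r)\<close>, so the difference absorbs the
  denominator \<open>1 + \<gamma> * x\<close> of the weights. Using \<open>pCons 0 B\<close> bounds
  the degree of \<open>x * B\<close>, including \<open>B = 0\<close>; at \<gamma> = 0 the claim is
  that the leading terms cancel.\<close>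

lemma difference_quotient:
  "\<exists>B. degree (pCons 0 B) \<le> p + r \<and> (\<forall>x. ((x - \<tau>) / (1 + \<gamma> * \<tau>)) ^ p * ((x - 1) / (1 + \<gamma>)) ^ r - x ^ (p + r) =
    (1 + \<gamma> * x) * poly B x)"
proof -
  have step: "\<exists>B. degree (pCons 0 B) \<le> Suc d \<and> (\<forall>x. (x - a) / (1 + \<gamma> * a) * g x - x ^ Suc d = (1 + \<gamma> * x) * poly B x)"
    if a: "1 + \<gamma> * a \<noteq> 0" and IH: "\<exists>B. degree (pCons 0 B) \<le> d \<and> (\<forall>x. g x - x ^ d = (1 + \<gamma> * x) * poly B x)"
    for a d and g :: "'a \<Rightarrow> 'a"
  proof -
    define c where "c = 1 / (1 + \<gamma> * a)"
    obtain B where B: "degree (pCons 0 B) \<le> d" "\<And>x. g x - x ^ d = (1 + \<gamma> * x) * poly B x"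
      using IH by blast
    define B' where "B' = [:- a * c, c:] * B + monom (- a * c) d"
    have "degree B' \<le> d"
      unfolding B'_def
    proof (rule degree_add_le)
      show "degree ([:- a * c, c:] * B) \<le> d"
      proof (cases "B = 0")
        case False
        have "degree ([:- a * c, c:] * B) \<le> degree [:- a * c, c:] + degree B" by (rule degree_mult_le)
        also have "\<dots> \<le> 1 + degree B" by simp
        finally show ?thesis using B(1) False by simp
      qed simp
    qed (rule degree_monom_le)
    moreover have "(x - a) / (1 + \<gamma> * a) * g x - x ^ Suc d = (1 + \<gamma> * x) * poly B' x" for x
    proof -
      have xa: "(x - a) / (1 + \<gamma> * a) = (x - a) * c" by (simp add: c_def)
      have g: "g x = x ^ d + (1 + \<gamma> * x) * poly B x" using B(2)[of x] by (simp add: algebra_simps)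
      have "(x - a) * c - x = (1 + \<gamma> * x) * (- a * c)" using a by (simp add: c_def field_simps)
      moreover have "(x - a) * c * g x - x ^ Suc d =
          ((x - a) * c - x) * x ^ d + (1 + \<gamma> * x) * ((x - a) * c * poly B x)"
        unfolding g by (simp add: algebra_simps)
      ultimately have "(x - a) * c * g x - x ^ Suc d =
          (1 + \<gamma> * x) * (- a * c * x ^ d + (x - a) * c * poly B x)"
        by (simp only: distrib_left mult.assoc)
      moreover have "poly B' x = - a * c * x ^ d + (x - a) * c * poly B x"
        by (simp add: B'_def poly_monom algebra_simps)
      ultimately show ?thesis by (simp add: xa)
    qed
    ultimately show ?thesis by (intro exI[of _ B']) (auto intro: order_trans[OF degree_pCons_le])
  qed
  show ?thesis
  proof (induction p)
    case 0
    show ?case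
    proof (induction r)
      case 0
      then show ?case by (intro exI[of _ 0]) auto
    next
      case (Suc r)
      show ?case
        using step[of 1 r "\<lambda>x. ((x - 1) / (1 + \<gamma>)) ^ r"] Suc q_nonzero by simp
    qed
  next
    case (Suc p)
    show ?case
      using step[of \<tau> "p + r" "\<lambda>x. ((x - \<tau>) / (1 + \<gamma> * \<tau>)) ^ p * ((x - 1) / (1 + \<gamma>)) ^ r"] Suc t_nonzero
      by (simp add: mult.assoc)
  qed
qed

sublocale op: grid_operator "\<lambda>k m. u + v * node \<beta> k m" wt row arg "node \<beta>"
proof
  fix p r
  obtain B where B: "degree (pCons 0 B) \<le> p + r"
    "\<And>x. ((x - \<tau>) / (1 + \<gamma> * \<tau>)) ^ p * ((x - 1) / (1 + \<gamma>)) ^ r - x ^ (p + r) = (1 + \<gamma> * x) * poly B x"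
    using difference_quotient by blast
  let ?z = "q_step \<beta>"
  let ?c = "(?z - \<beta>) / (1 + \<gamma> * ?z)"
  \<comment> \<open>With \<open>w\<close> the weight for \<open>True\<close> and
    \<open>?c - w\<close> that for \<open>False\<close>, the sum is \<open>w\<close> times the
    difference of the two products, where the denominator cancels, plus
    \<open>?c * x ^ (p + r)\<close>.\<close>
  define L where "L = [:- \<beta>, 1:] * B + monom ?c (p + r)"
  have "degree L \<le> p + r"
    unfolding L_def
  proof (rule degree_add_le)
    show "degree ([:- \<beta>, 1:] * B) \<le> p + r"
    proof (cases "B = 0")
      case False
      have "degree ([:- \<beta>, 1:] * B) \<le> degree [:- \<beta>, 1:] + degree B" by (rule degree_mult_le)
      then show ?thesis using B(1) False by simp
    qed simp
  qed (rule degree_monom_le)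
  moreover obtain L' where "degree L' \<le> degree L" "\<And>x. poly L' (u + v * x) = poly L x"
    using pcompose_affine[OF v] by blast
  moreover have "poly L x = (x - \<beta>) / (1 + \<gamma> * x) * (((x - \<tau>) / (1 + \<gamma> * \<tau>)) ^ p * ((x - 1) / (1 + \<gamma>)) ^ r) +
      (?c - (x - \<beta>) / (1 + \<gamma> * x)) * (x ^ p * x ^ r)" if "1 + \<gamma> * x \<noteq> 0" for x
  proof -
    have e: "((x - \<tau>) / (1 + \<gamma> * \<tau>)) ^ p * ((x - 1) / (1 + \<gamma>)) ^ r = x ^ (p + r) + (1 + \<gamma> * x) * poly B x"
      using B(2)[of x] by (simp add: algebra_simps)
    have "(x - \<beta>) / (1 + \<gamma> * x) * ((1 + \<gamma> * x) * poly B x) = (x - \<beta>) * poly B x"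
      using that by simp
    then show ?thesis
      unfolding e power_add[symmetric] by (simp add: L_def poly_monom algebra_simps)
  qed
  ultimately show "\<exists>L. degree L \<le> p + r \<and> (\<forall>x\<in>UNIV. poly L (case x of (k, m) \<Rightarrow> u + v * node \<beta> k m) =
    wt True x * row True x ^ p * arg True x ^ r + wt False x * row False x ^ p * arg False x ^ r)"
    using one_plus_node_nonzero[OF base]
    by (intro exI[of _ L']) (auto simp: wt_def row_def arg_def Let_def mult.assoc)
next
  show "inj_grid (\<lambda>k m. u + v * node \<beta> k m)" using inj_node v by (simp add: inj_grid_def)
  show "inj_grid (\<lambda>k m. row False (k, m))" using inj_node by (simp add: row_def Let_def)
  show "wt True (0, 0) = 0" by (simp add: wt_def Let_def)
  fix k m
  show "arg False (k, m) = node \<beta> k m" by (simp add: arg_def Let_def)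
  show "arg True (Suc k, m) = node \<beta> k m" using q_nonzero by (simp add: arg_def Let_def node_Suc_left q_step_def)
  show "row True (k, Suc m) = row False (k, m)" using t_nonzero by (simp add: row_def Let_def node_Suc_right t_step_def)
  have z: "q_step \<beta> = node \<beta> 1 0" by (simp add: node_Suc_left)
  let ?x = "node \<beta> k m" and ?z = "node \<beta> 1 0"
  have "wt False (k, m) = 0 \<longleftrightarrow> (?x - \<beta>) * (1 + \<gamma> * ?z) = (?z - \<beta>) * (1 + \<gamma> * ?x)"
    using one_plus_node_nonzero[OF base, of 1 0] one_plus_node_nonzero[OF base, of k m]
    by (simp only: wt_def z case_prod_conv Let_def if_False) (auto simp: frac_eq_eq)
  also have "\<dots> \<longleftrightarrow> (?x - ?z) * (1 + \<gamma> * \<beta>) = 0" by (auto simp: algebra_simps)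
  also have "\<dots> \<longleftrightarrow> k = 1 \<and> m = 0" using base inj_node unfolding inj_grid_def by auto
  finally show "wt False (k, m) = 0 \<longleftrightarrow> k = 1 \<and> m = 0" .
qed

text \<open>Both \<open>row False\<close> and the grid are affine in the node, so the differences
  from \<beta> cancel. What remains are differences from \<open>q_step \<beta>\<close>, in the
  numerator moved back by one \<open>t_step\<close>.\<close>

lemma new_row:
  assumes "\<mu> \<in> partitions (Suc n)" "\<mu> (Suc n) = 0" "\<mu>(Suc n := 1) \<in> partitions (Suc n)"
    and "dual_at (Suc n) (\<lambda>k m. u + v * node \<beta> k m) \<mu> f"
  shows "f (grid_point (Suc n) (\<lambda>k m. u + v * node \<beta> k m) (\<mu>(Suc n := 1))) =
    f (grid_point (Suc n) (\<lambda>k m. u + v * node \<beta> k m) \<mu>) *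
    (\<Prod>i=1..n. (t_step (node \<beta> (\<mu> i) (Suc n - i)) - q_step \<beta>) /
      ((1 + \<gamma> * \<tau>) * (node \<beta> (\<mu> i) (Suc n - i) - q_step \<beta>)))"
proof (rule op.new_row_ratio[OF inj_node _ _ assms, where R = "\<lambda>k m.
    (t_step (node \<beta> k m) - q_step \<beta>) / ((1 + \<gamma> * \<tau>) * (node \<beta> k m - q_step \<beta>))"])
  show "wt False (0, 0) = wt True (1, 0)" by (simp add: wt_def Let_def node_Suc_left)
  fix k m :: nat assume "0 < m"
  let ?x = "node \<beta> k m" and ?z = "q_step \<beta>"
  have "node \<beta> k m \<noteq> node \<beta> 1 0" using inj_node \<open>0 < m\<close> unfolding inj_grid_def by blast
  then have nz: "?x - ?z \<noteq> 0" by (simp add: node_Suc_left)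
  have "(?z - \<tau>) / (1 + \<gamma> * \<tau>) - ?x = (t_step ?x - ?z) / ((1 + \<gamma> * \<tau>) * (?x - ?z)) * (?z - ?x)"
  proof -
    have "(?z - \<tau>) / (1 + \<gamma> * \<tau>) - ?x = - ((t_step ?x - ?z) / (1 + \<gamma> * \<tau>))"
      using t_nonzero by (simp add: t_step_def field_simps)
    also have "\<dots> = (t_step ?x - ?z) / ((1 + \<gamma> * \<tau>) * (?x - ?z)) * (?z - ?x)"
      using nz t_nonzero by (simp add: divide_simps) (simp add: algebra_simps)
    finally show ?thesis .
  qed
  then show "(row True (1, 0) - row False (k, m)) * ((u + v * node \<beta> 0 0) - (u + v * node \<beta> k m)) =
    (t_step (node \<beta> k m) - q_step \<beta>) / ((1 + \<gamma> * \<tau>) * (node \<beta> k m - q_step \<beta>)) *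
    ((row False (0, 0) - row False (k, m)) * ((u + v * node \<beta> 1 0) - (u + v * node \<beta> k m)))"
    by (simp add: row_def Let_def node_Suc_left) (simp add: algebra_simps)
qed

end


subsection \<open>Quadratic lattices\<close>

text \<open>By \<open>sum_nonzero\<close> the product of two values of X on the lattice is never 1
  (at \<gamma> = 0: no two nodes have sum 0). This is what makes X + 1/X separate the nodes.\<close>

locale quadratic_lattice = lattice +
  fixes \<beta> :: 'a and u v :: 'a
  assumes v: "v \<noteq> 0" and base: "1 + \<gamma> * \<beta> \<noteq> 0" and inj_node: "inj_grid (node \<beta>)"
    and sum_nonzero: "node (oplus \<beta> \<beta>) k m \<noteq> 0"
begin

text \<open>With X = 1 + \<gamma> x this is (X + 1/X - 2) / \<gamma>^2, in a form that still makes
  sense at \<gamma> = 0.\<close>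

definition square :: "'a \<Rightarrow> 'a" where
  "square x = x\<^sup>2 / (1 + \<gamma> * x)"

text \<open>The two weights are exchanged by the reflection X -> 1/X, that is \<open>x\<close> to
  \<open>- x / (1 + \<gamma> * x)\<close>, and so are the two cases of \<open>row\<close> and of
  \<open>arg\<close>. Hence the sum of both cases is invariant, as a function of
  \<open>square x\<close> has to be. The factor \<open>oplus x \<beta>\<close> reflects to one that
  vanishes at \<open>x = \<beta>\<close>, which forbids removing a box from an empty last row. The
  factor \<open>x - z\<close> holds the free parameter, set to the node of a last row of length
  1.\<close>

definition wt :: "bool \<Rightarrow> nat \<times> nat \<Rightarrow> 'a" where
  "wt e = (\<lambda>(k, m). let x = node \<beta> k m; z = q_step \<beta> in
    if e then (x - \<beta>) * (1 + \<gamma> * x) / (x * (2 + \<gamma> * x)) * (- x / (1 + \<gamma> * x) - z)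
    else oplus x \<beta> / (x * (2 + \<gamma> * x)) * (x - z))"

definition row :: "bool \<Rightarrow> nat \<times> nat \<Rightarrow> 'a" where
  "row e = (\<lambda>(k, m). let x = node \<beta> k m in (if e then x * (x - \<tau>) else x * t_step x) / (1 + \<gamma> * x))"

text \<open>For \<gamma> \<noteq> 0, \<open>x * q_step x / (1 + \<gamma> * x)\<close> is (q X + 1/X
  - q - 1) / \<gamma>^2, which is affine in q^(1/2) X + q^(-1/2) / X: a quadratic grid moved by half
  a step, without square roots. \<open>row\<close> is the same with t in place of q.\<close>

definition arg :: "bool \<Rightarrow> nat \<times> nat \<Rightarrow> 'a" where
  "arg e = (\<lambda>(k, m). let x = node \<beta> k m in (if e then x * (x - 1) else x * q_step x) / (1 + \<gamma> * x))"

lemma oplus_nonzero: "oplus (node \<beta> k m) (node \<beta> k' m') \<noteq> 0"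
  unfolding oplus_node by (rule sum_nonzero)

lemma node_nonzero: "node \<beta> k m \<noteq> 0" "2 + \<gamma> * node \<beta> k m \<noteq> 0"
proof -
  have "oplus x x = x * (2 + \<gamma> * x)" for x by (simp add: oplus_def algebra_simps)
  then have "node \<beta> k m * (2 + \<gamma> * node \<beta> k m) \<noteq> 0" using oplus_nonzero[of k m k m] by metis
  then show "node \<beta> k m \<noteq> 0" "2 + \<gamma> * node \<beta> k m \<noteq> 0" by auto
qed

lemma product_diff:
  assumes "1 + \<gamma> * x \<noteq> 0" "1 + \<gamma> * y \<noteq> 0"
  shows "x * t_step x / (1 + \<gamma> * x) - y * t_step y / (1 + \<gamma> * y) =
      (x - y) * t_step (oplus x y) / ((1 + \<gamma> * x) * (1 + \<gamma> * y))"
    "x * q_step x / (1 + \<gamma> * x) - y * q_step y / (1 + \<gamma> * y) =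
      (x - y) * q_step (oplus x y) / ((1 + \<gamma> * x) * (1 + \<gamma> * y))"
    "y * (y - \<tau>) / (1 + \<gamma> * y) - x * t_step x / (1 + \<gamma> * x) =
      - ((t_step x - y) * oplus x y / ((1 + \<gamma> * x) * (1 + \<gamma> * y)))"
    "square x - square y = (x - y) * oplus x y / ((1 + \<gamma> * x) * (1 + \<gamma> * y))"
proof -
  have frac: "a / X - b / Z = c / (X * Z)" if "X \<noteq> 0" "Z \<noteq> 0" "a * Z - b * X = c" for a b c X Z :: 'a
    using that by (simp add: field_simps)
  show "x * t_step x / (1 + \<gamma> * x) - y * t_step y / (1 + \<gamma> * y) =
      (x - y) * t_step (oplus x y) / ((1 + \<gamma> * x) * (1 + \<gamma> * y))"
    by (rule frac[OF assms]) (simp add: t_step_def oplus_def algebra_simps)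
  show "x * q_step x / (1 + \<gamma> * x) - y * q_step y / (1 + \<gamma> * y) =
      (x - y) * q_step (oplus x y) / ((1 + \<gamma> * x) * (1 + \<gamma> * y))"
    by (rule frac[OF assms]) (simp add: q_step_def oplus_def algebra_simps)
  have "x * t_step x / (1 + \<gamma> * x) - y * (y - \<tau>) / (1 + \<gamma> * y) =
      (t_step x - y) * oplus x y / ((1 + \<gamma> * x) * (1 + \<gamma> * y))"
    by (rule frac[OF assms]) (simp add: t_step_def oplus_def algebra_simps)
  then show "y * (y - \<tau>) / (1 + \<gamma> * y) - x * t_step x / (1 + \<gamma> * x) =
      - ((t_step x - y) * oplus x y / ((1 + \<gamma> * x) * (1 + \<gamma> * y)))"
    unfolding minus_diff_eq[symmetric, of "y * (y - \<tau>) / (1 + \<gamma> * y)"] by (rule arg_cong)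
  show "square x - square y = (x - y) * oplus x y / ((1 + \<gamma> * x) * (1 + \<gamma> * y))"
    unfolding square_def by (rule frac[OF assms]) (simp add: oplus_def algebra_simps power2_eq_square)
qed

text \<open>
  The reflection \<open>X \<mapsto> 1 / X\<close> exchanges the two products below, fixes \<open>square x\<close> and changes the sign of
  \<open>x (2 + \<gamma> x) / X\<close>, whose square is a polynomial in \<open>square x\<close>.
\<close>

lemma even_odd_decomposition:
  "\<exists>P R. degree P \<le> p + r \<and> degree (pCons 0 R) \<le> p + r \<and> (\<forall>x. 1 + \<gamma> * x \<noteq> 0 \<longrightarrow>
    (x * t_step x / (1 + \<gamma> * x)) ^ p * (x * q_step x / (1 + \<gamma> * x)) ^ r =
      poly P (square x) + x * (2 + \<gamma> * x) / (1 + \<gamma> * x) * poly R (square x) \<and>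
    (x * (x - \<tau>) / (1 + \<gamma> * x)) ^ p * (x * (x - 1) / (1 + \<gamma> * x)) ^ r =
      poly P (square x) - x * (2 + \<gamma> * x) / (1 + \<gamma> * x) * poly R (square x))"
proof -
  have step: "\<exists>P R. degree P \<le> Suc d \<and> degree (pCons 0 R) \<le> Suc d \<and> (\<forall>x. 1 + \<gamma> * x \<noteq> 0 \<longrightarrow>
      x * ((1 + \<gamma> * a) * x + a) / (1 + \<gamma> * x) * g x =
        poly P (square x) + x * (2 + \<gamma> * x) / (1 + \<gamma> * x) * poly R (square x) \<and>
      x * (x - a) / (1 + \<gamma> * x) * h x =
        poly P (square x) - x * (2 + \<gamma> * x) / (1 + \<gamma> * x) * poly R (square x))"
    if IH: "\<exists>P R. degree P \<le> d \<and> degree (pCons 0 R) \<le> d \<and> (\<forall>x. 1 + \<gamma> * x \<noteq> 0 \<longrightarrow>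
      g x = poly P (square x) + x * (2 + \<gamma> * x) / (1 + \<gamma> * x) * poly R (square x) \<and>
      h x = poly P (square x) - x * (2 + \<gamma> * x) / (1 + \<gamma> * x) * poly R (square x))"
    for a d and g h :: "'a \<Rightarrow> 'a"
  proof -
    obtain P R where PR: "degree P \<le> d" "degree (pCons 0 R) \<le> d"
      "\<And>x. 1 + \<gamma> * x \<noteq> 0 \<Longrightarrow> g x = poly P (square x) + x * (2 + \<gamma> * x) / (1 + \<gamma> * x) * poly R (square x)"
      "\<And>x. 1 + \<gamma> * x \<noteq> 0 \<Longrightarrow> h x = poly P (square x) - x * (2 + \<gamma> * x) / (1 + \<gamma> * x) * poly R (square x)"
      using IH by blast
    \<comment> \<open>Splits \<open>x * ((1 + \<gamma> * a) * x + a)\<close> as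
      \<open>e * x\<^sup>2\<close> plus \<open>a / 2 * (x * (2 + \<gamma> * x))\<close>; after
      division by \<open>1 + \<gamma> * x\<close> these are the even and the odd part under the
      reflection.\<close>
    define e where "e = (2 + \<gamma> * a) / 2"
    \<comment> \<open>The product of two odd parts is even: the square of
      \<open>x * (2 + \<gamma> * x) / (1 + \<gamma> * x)\<close> is
      \<open>square x * (4 + \<gamma>\<^sup>2 * square x)\<close>. The factor
      \<open>square x\<close> is supplied by \<open>pCons\<close> in \<open>P'\<close>.\<close>
    define Q where "Q = [:4, \<gamma>\<^sup>2:] * R"
    define P' where "P' = Polynomial.smult e (pCons 0 P) + Polynomial.smult (a / 2) (pCons 0 Q)"
    define R' where "R' = Polynomial.smult e (pCons 0 R) + Polynomial.smult (a / 2) P"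
    have "degree Q \<le> d"
    proof (cases "R = 0")
      case False
      have "degree Q \<le> degree [:4, \<gamma>\<^sup>2:] + degree R" unfolding Q_def by (rule degree_mult_le)
      also have "\<dots> \<le> d" using PR(2) False by simp
      finally show ?thesis .
    qed (simp add: Q_def)
    have "degree P' \<le> Suc d"
      unfolding P'_def using PR(1) \<open>degree Q \<le> d\<close>
      by (intro degree_add_le order_trans[OF degree_smult_le] order_trans[OF degree_pCons_le]) auto
    moreover have "degree (pCons 0 R') \<le> Suc d"
    proof -
      have "degree R' \<le> d"
        unfolding R'_def using PR(1,2) by (intro degree_add_le order_trans[OF degree_smult_le]) auto
      then show ?thesis by (intro order_trans[OF degree_pCons_le]) simp
    qed
    moreover have "x * ((1 + \<gamma> * a) * x + a) / (1 + \<gamma> * x) * g x =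
        poly P' (square x) + x * (2 + \<gamma> * x) / (1 + \<gamma> * x) * poly R' (square x) \<and>
      x * (x - a) / (1 + \<gamma> * x) * h x =
        poly P' (square x) - x * (2 + \<gamma> * x) / (1 + \<gamma> * x) * poly R' (square x)"
      if X: "1 + \<gamma> * x \<noteq> 0" for x
    proof -
      define D where "D = x * (2 + \<gamma> * x) / (1 + \<gamma> * x)"
      have "x * ((1 + \<gamma> * a) * x + a) = e * x\<^sup>2 + a / 2 * (x * (2 + \<gamma> * x))"
        by (simp add: e_def power2_eq_square field_simps)
      then have 1: "x * ((1 + \<gamma> * a) * x + a) / (1 + \<gamma> * x) = e * square x + a / 2 * D"
        by (simp add: D_def square_def add_divide_distrib)
      have "x * (x - a) = e * x\<^sup>2 - a / 2 * (x * (2 + \<gamma> * x))"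
        by (simp add: e_def power2_eq_square field_simps)
      then have 2: "x * (x - a) / (1 + \<gamma> * x) = e * square x - a / 2 * D"
        by (simp add: D_def square_def diff_divide_distrib)
      have "(2 + \<gamma> * x)\<^sup>2 = 4 * (1 + \<gamma> * x) + \<gamma>\<^sup>2 * x\<^sup>2"
        by (simp add: power2_eq_square algebra_simps)
      moreover have "(4 * Z + w) / Z = 4 + w / Z" if "Z \<noteq> 0" for w Z :: 'a
        using that by (simp add: add_divide_distrib)
      ultimately have sq: "(2 + \<gamma> * x)\<^sup>2 / (1 + \<gamma> * x) = 4 + \<gamma>\<^sup>2 * square x"
        using X by (simp only: square_def times_divide_eq_right)
      have "D * D = square x * ((2 + \<gamma> * x)\<^sup>2 / (1 + \<gamma> * x))"
        by (simp add: D_def square_def power2_eq_square)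
      then have D2: "D * D = square x * (4 + \<gamma>\<^sup>2 * square x)" by (simp only: sq)
      have P': "poly P' (square x) = e * (square x * poly P (square x)) + a / 2 * (D * D * poly R (square x))"
        unfolding D2 by (simp add: P'_def Q_def algebra_simps)
      have R': "poly R' (square x) = e * (square x * poly R (square x)) + a / 2 * poly P (square x)"
        by (simp add: R'_def)
      show ?thesis
        unfolding D_def[symmetric] 1 2 PR(3,4)[OF X, folded D_def] P' R' by (simp add: algebra_simps)
    qed
    ultimately show ?thesis by blast
  qed
  show ?thesis
  proof (induction p)
    case 0
    show ?case
    proof (induction r)
      case 0
      then show ?case by (intro exI[of _ 1] exI[of _ 0]) auto
    next
      case (Suc r)
      show ?case
        using step[of r "\<lambda>x. (x * q_step x / (1 + \<gamma> * x)) ^ r" "\<lambda>x. (x * (x - 1) / (1 + \<gamma> * x)) ^ r" 1] Suc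
        by (simp add: q_step_def)
    qed
  next
    case (Suc p)
    show ?case
      using step[of "p + r" "\<lambda>x. (x * t_step x / (1 + \<gamma> * x)) ^ p * (x * q_step x / (1 + \<gamma> * x)) ^ r"
          "\<lambda>x. (x * (x - \<tau>) / (1 + \<gamma> * x)) ^ p * (x * (x - 1) / (1 + \<gamma> * x)) ^ r" \<tau>] Suc
      by (simp add: t_step_def mult.assoc)
  qed
qed

text \<open>The sum of the weights multiplies the even part \<open>P\<close> and is constant. Their
  difference meets the odd part and becomes linear in \<open>square x\<close>, so \<open>R\<close>
  gains one degree, exactly what its bound allows.\<close>

lemma weights:
  fixes x z :: 'a
  assumes x: "x \<noteq> 0" "1 + \<gamma> * x \<noteq> 0" "2 + \<gamma> * x \<noteq> 0"
  defines "wT \<equiv> (x - \<beta>) * (1 + \<gamma> * x) / (x * (2 + \<gamma> * x)) * (- x / (1 + \<gamma> * x) - z)"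
    and "wF \<equiv> oplus x \<beta> / (x * (2 + \<gamma> * x)) * (x - z)"
  shows "wF + wT = \<beta> - z"
    and "(wF - wT) * (x * (2 + \<gamma> * x) / (1 + \<gamma> * x)) = (2 + \<gamma> * \<beta>) * square x - z * (2 * \<beta> - \<gamma> * square x)"
proof -
  let ?X = "1 + \<gamma> * x" and ?E = "x * (2 + \<gamma> * x)"
  have T: "wT = - ((x - \<beta>) * (x + z * ?X)) / ?E"
    using x unfolding wT_def by (simp add: divide_simps) (simp add: algebra_simps)
  have "wF + wT = (oplus x \<beta> * (x - z) - (x - \<beta>) * (x + z * ?X)) / ?E"
    unfolding T wF_def by (simp add: diff_divide_distrib)
  also have "oplus x \<beta> * (x - z) - (x - \<beta>) * (x + z * ?X) = (\<beta> - z) * ?E"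
    by (simp add: oplus_def algebra_simps)
  finally show "wF + wT = \<beta> - z" using x by simp
  have "(wF - wT) * (?E / ?X) = (oplus x \<beta> * (x - z) + (x - \<beta>) * (x + z * ?X)) / ?E * (?E / ?X)"
    unfolding T wF_def by (simp add: add_divide_distrib)
  also have "\<dots> = (oplus x \<beta> * (x - z) + (x - \<beta>) * (x + z * ?X)) / ?X" using x by simp
  also have "oplus x \<beta> * (x - z) + (x - \<beta>) * (x + z * ?X) =
      (2 + \<gamma> * \<beta>) * x\<^sup>2 - z * (2 * \<beta> * ?X - \<gamma> * x\<^sup>2)"
    by (simp add: oplus_def algebra_simps power2_eq_square)
  also have "\<dots> / ?X = (2 + \<gamma> * \<beta>) * square x - z * (2 * \<beta> - \<gamma> * square x)"
  proof -
    have "(c * s - z * (b * X - g * s)) / X = c * (s / X) - z * (b - g * (s / X))" if "X \<noteq> 0" for b c g s X :: 'a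
      using that by (simp add: field_simps)
    then show ?thesis using x by (simp add: square_def)
  qed
  finally show "(wF - wT) * (?E / ?X) = (2 + \<gamma> * \<beta>) * square x - z * (2 * \<beta> - \<gamma> * square x)" .
qed

sublocale op: grid_operator "\<lambda>k m. u + v * square (node \<beta> k m)" wt row arg "\<lambda>k m. arg False (k, m)"
proof
  fix p r
  obtain P R where PR: "degree P \<le> p + r" "degree (pCons 0 R) \<le> p + r"
    "\<And>x. 1 + \<gamma> * x \<noteq> 0 \<Longrightarrow> (x * t_step x / (1 + \<gamma> * x)) ^ p * (x * q_step x / (1 + \<gamma> * x)) ^ r =
      poly P (square x) + x * (2 + \<gamma> * x) / (1 + \<gamma> * x) * poly R (square x)"
    "\<And>x. 1 + \<gamma> * x \<noteq> 0 \<Longrightarrow> (x * (x - \<tau>) / (1 + \<gamma> * x)) ^ p * (x * (x - 1) / (1 + \<gamma> * x)) ^ r =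
      poly P (square x) - x * (2 + \<gamma> * x) / (1 + \<gamma> * x) * poly R (square x)"
    using even_odd_decomposition[of p r] by blast
  let ?z = "q_step \<beta>"
  \<comment> \<open>The linear polynomial in \<open>square x\<close> from \<open>weights(2)\<close>,
    with \<open>z = q_step \<beta>\<close>.\<close>
  let ?l = "[:- (?z * 2 * \<beta>), 2 + \<gamma> * \<beta> + ?z * \<gamma>:]"
  define L where "L = Polynomial.smult (\<beta> - ?z) P + ?l * R"
  have "degree (?l * R) \<le> p + r"
  proof (cases "R = 0")
    case False
    have "degree (?l * R) \<le> degree ?l + degree R" by (rule degree_mult_le)
    also have "\<dots> \<le> 1 + degree R" by simp
    finally show ?thesis using PR(2) False by simp
  qed simp
  then have "degree L \<le> p + r"
    unfolding L_def using PR(1) by (intro degree_add_le order_trans[OF degree_smult_le])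
  moreover obtain L' where "degree L' \<le> degree L" "\<And>x. poly L' (u + v * x) = poly L x"
    using pcompose_affine[OF v] by blast
  moreover have "poly L (square (node \<beta> k m)) =
    wt True (k, m) * row True (k, m) ^ p * arg True (k, m) ^ r + wt False (k, m) * row False (k, m) ^ p * arg False (k, m) ^ r"
    for k m
  proof -
    let ?x = "node \<beta> k m"
    let ?D = "?x * (2 + \<gamma> * ?x) / (1 + \<gamma> * ?x)" and ?wT = "wt True (k, m)" and ?wF = "wt False (k, m)"
    have X: "1 + \<gamma> * ?x \<noteq> 0" by (rule one_plus_node_nonzero[OF base])
    note w = weights[OF node_nonzero(1) X node_nonzero(2), of ?z]
    have w1: "?wF + ?wT = \<beta> - ?z" and w2: "(?wF - ?wT) * ?D = (2 + \<gamma> * \<beta>) * square ?x - ?z * (2 * \<beta> - \<gamma> * square ?x)"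
      using w by (simp_all add: wt_def Let_def)
    have "?wT * row True (k, m) ^ p * arg True (k, m) ^ r + ?wF * row False (k, m) ^ p * arg False (k, m) ^ r =
      ?wT * (poly P (square ?x) - ?D * poly R (square ?x)) + ?wF * (poly P (square ?x) + ?D * poly R (square ?x))"
      by (simp only: PR(3,4)[OF X, symmetric] row_def arg_def Let_def case_prod_conv if_True if_False mult.assoc)
    also have "\<dots> = (?wF + ?wT) * poly P (square ?x) + ((?wF - ?wT) * ?D) * poly R (square ?x)"
      by (simp only: distrib_left distrib_right left_diff_distrib right_diff_distrib mult.assoc)
        (simp only: diff_conv_add_uminus add_ac minus_mult_left)
    also have "\<dots> = poly L (square ?x)"
      unfolding w1 w2 by (simp add: L_def algebra_simps)
    finally show ?thesis ..
  qed
  ultimately show "\<exists>L. degree L \<le> p + r \<and> (\<forall>x\<in>UNIV. poly L (case x of (k, m) \<Rightarrow> u + v * square (node \<beta> k m)) =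
    wt True x * row True x ^ p * arg True x ^ r + wt False x * row False x ^ p * arg False x ^ r)"
    by (intro exI[of _ L']) auto
next
  have X: "1 + \<gamma> * node \<beta> k m \<noteq> 0" for k m by (rule one_plus_node_nonzero[OF base])
  show "inj_grid (\<lambda>k m. u + v * square (node \<beta> k m))"
    unfolding inj_grid_def
  proof (intro allI impI)
    fix k m k' m' assume "u + v * square (node \<beta> k m) = u + v * square (node \<beta> k' m')"
    then have "square (node \<beta> k m) - square (node \<beta> k' m') = 0" using v by simp
    then have "node \<beta> k m = node \<beta> k' m'"
      unfolding product_diff(4)[OF X X] using X oplus_nonzero by simp
    then show "k = k' \<and> m = m'" using inj_node by (simp add: inj_grid_def)
  qed
  show "inj_grid (\<lambda>k m. row False (k, m))"
    unfolding inj_grid_def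
  proof (intro allI impI)
    fix k m k' m' assume "row False (k, m) = row False (k', m')"
    then have "node \<beta> k m * t_step (node \<beta> k m) / (1 + \<gamma> * node \<beta> k m) -
      node \<beta> k' m' * t_step (node \<beta> k' m') / (1 + \<gamma> * node \<beta> k' m') = 0" by (simp add: row_def Let_def)
    then have "node \<beta> k m = node \<beta> k' m'"
      unfolding product_diff(1)[OF X X]
      using X sum_nonzero[of _ "Suc _"] by (simp add: oplus_node flip: node_Suc_right)
    then show "k = k' \<and> m = m'" using inj_node by (simp add: inj_grid_def)
  qed
  show "wt True (0, 0) = 0" by (simp add: wt_def Let_def)
  fix k m
  show "arg False (k, m) = arg False (k, m)" ..
  have cancel: "s * (c * x) / (c * w) = x * s / w" if "c \<noteq> 0" for s c x w :: 'a
    using that by simp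
  have "q_step x - 1 = (1 + \<gamma>) * x" "1 + \<gamma> * q_step x = (1 + \<gamma>) * (1 + \<gamma> * x)" for x
    by (simp_all add: q_step_def algebra_simps)
  then show "arg True (Suc k, m) = arg False (k, m)"
    by (simp only: arg_def case_prod_conv Let_def if_True if_False node_Suc_left cancel[OF q_nonzero])
  have "t_step x - \<tau> = (1 + \<gamma> * \<tau>) * x" "1 + \<gamma> * t_step x = (1 + \<gamma> * \<tau>) * (1 + \<gamma> * x)" for x
    by (simp_all add: t_step_def algebra_simps)
  then show "row True (k, Suc m) = row False (k, m)"
    by (simp only: row_def case_prod_conv Let_def if_True if_False node_Suc_right cancel[OF t_nonzero])
  have z: "q_step \<beta> = node \<beta> 1 0" by (simp add: node_Suc_left)
  have "wt False (k, m) = 0 \<longleftrightarrow> node \<beta> k m = node \<beta> 1 0"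
    using oplus_nonzero[of k m 0 0] node_nonzero by (simp add: wt_def Let_def z)
  also have "\<dots> \<longleftrightarrow> k = 1 \<and> m = 0" using inj_node unfolding inj_grid_def by auto
  finally show "wt False (k, m) = 0 \<longleftrightarrow> k = 1 \<and> m = 0" .
qed

lemma inj_arg: "inj_grid (\<lambda>k m. arg False (k, m))"
  unfolding inj_grid_def
proof (intro allI impI)
  have X: "1 + \<gamma> * node \<beta> k m \<noteq> 0" for k m by (rule one_plus_node_nonzero[OF base])
  fix k m k' m' assume "arg False (k, m) = arg False (k', m')"
  then have "node \<beta> k m * q_step (node \<beta> k m) / (1 + \<gamma> * node \<beta> k m) -
    node \<beta> k' m' * q_step (node \<beta> k' m') / (1 + \<gamma> * node \<beta> k' m') = 0" by (simp add: arg_def Let_def)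
  then have "node \<beta> k m = node \<beta> k' m'"
    unfolding product_diff(2)[OF X X]
    using X sum_nonzero[of "Suc _"] by (simp add: oplus_node flip: node_Suc_left)
  then show "k = k' \<and> m = m'" using inj_node by (simp add: inj_grid_def)
qed

text \<open>By \<open>product_diff\<close> all four differences factor. The factors
  \<open>x - \<beta>\<close> and \<open>oplus x (q_step \<beta>)\<close> and all denominators occur
  on both sides and cancel.\<close>

lemma new_row:
  assumes "\<mu> \<in> partitions (Suc n)" "\<mu> (Suc n) = 0" "\<mu>(Suc n := 1) \<in> partitions (Suc n)"
    and "dual_at (Suc n) (\<lambda>k m. u + v * square (node \<beta> k m)) \<mu> f"
  shows "f (grid_point (Suc n) (\<lambda>k m. u + v * square (node \<beta> k m)) (\<mu>(Suc n := 1))) =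
    f (grid_point (Suc n) (\<lambda>k m. u + v * square (node \<beta> k m)) \<mu>) *
    (\<Prod>i=1..n. (t_step (node \<beta> (\<mu> i) (Suc n - i)) - q_step \<beta>) * oplus (node \<beta> (\<mu> i) (Suc n - i)) \<beta> /
      ((node \<beta> (\<mu> i) (Suc n - i) - q_step \<beta>) * t_step (oplus (node \<beta> (\<mu> i) (Suc n - i)) \<beta>)))"
proof (rule op.new_row_ratio[OF inj_arg _ _ assms, where R = "\<lambda>k m.
    (t_step (node \<beta> k m) - q_step \<beta>) * oplus (node \<beta> k m) \<beta> /
      ((node \<beta> k m - q_step \<beta>) * t_step (oplus (node \<beta> k m) \<beta>))"])
  let ?z = "q_step \<beta>"
  have z: "?z = node \<beta> 1 0" by (simp add: node_Suc_left)
  have \<beta>: "\<beta> \<noteq> 0" "2 + \<gamma> * \<beta> \<noteq> 0" using node_nonzero[of 0 0] by simp_all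
  have zn: "?z \<noteq> 0" "2 + \<gamma> * ?z \<noteq> 0" "1 + \<gamma> * ?z \<noteq> 0"
    unfolding z by (rule node_nonzero one_plus_node_nonzero[OF base])+
  have "wt False (0, 0) = \<beta> - ?z"
  proof -
    have "oplus \<beta> \<beta> = \<beta> * (2 + \<gamma> * \<beta>)" by (simp add: oplus_def algebra_simps)
    then show ?thesis using \<beta> by (simp add: wt_def Let_def)
  qed
  moreover have "wt True (1, 0) = \<beta> - ?z"
    using weights(1)[OF zn(1,3,2), of ?z] by (simp add: wt_def Let_def z)
  ultimately show "wt False (0, 0) = wt True (1, 0)" by simp
  fix k m :: nat assume "0 < m"
  let ?x = "node \<beta> k m"
  have "node \<beta> k m \<noteq> node \<beta> 1 0" using inj_node \<open>0 < m\<close> unfolding inj_grid_def by blast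
  then have nz: "?x - ?z \<noteq> 0" by (simp add: z)
  have X: "1 + \<gamma> * ?x \<noteq> 0" by (rule one_plus_node_nonzero[OF base])
  have T: "t_step (oplus ?x \<beta>) \<noteq> 0"
    using sum_nonzero[of k "Suc m"] oplus_node[of \<beta> k m \<beta> 0 0] by (simp add: node_Suc_right)
  have cancel: "- (a * b / (X * Z)) * (v * (- (c * d / (X * W)))) =
      a * d / (e * f) * (- (c * f / (X * W)) * (v * (- (e * b / (X * Z)))))"
    if "e \<noteq> 0" "f \<noteq> 0" for a b c d e f X Z W :: 'a
    using that by (simp add: field_simps)
  have 1: "row True (1, 0) - row False (k, m) = - ((t_step ?x - ?z) * oplus ?x ?z / ((1 + \<gamma> * ?x) * (1 + \<gamma> * ?z)))"
    using product_diff(3)[OF X zn(3)] by (simp add: row_def Let_def z)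
  have 2: "(u + v * square (node \<beta> 0 0)) - (u + v * square ?x) = v * (- ((?x - \<beta>) * oplus ?x \<beta> / ((1 + \<gamma> * ?x) * (1 + \<gamma> * \<beta>))))"
    unfolding product_diff(4)[OF X base, symmetric] by (simp add: algebra_simps)
  have 3: "row False (0, 0) - row False (k, m) = - ((?x - \<beta>) * t_step (oplus ?x \<beta>) / ((1 + \<gamma> * ?x) * (1 + \<gamma> * \<beta>)))"
    unfolding product_diff(1)[OF X base, symmetric] by (simp add: row_def Let_def)
  have 4: "(u + v * square (node \<beta> 1 0)) - (u + v * square ?x) = v * (- ((?x - ?z) * oplus ?x ?z / ((1 + \<gamma> * ?x) * (1 + \<gamma> * ?z))))"
    unfolding product_diff(4)[OF X zn(3), symmetric] by (simp add: algebra_simps z)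
  show "(row True (1, 0) - row False (k, m)) * ((u + v * square (node \<beta> 0 0)) - (u + v * square ?x)) =
    (t_step ?x - ?z) * oplus ?x \<beta> / ((?x - ?z) * t_step (oplus ?x \<beta>)) *
    ((row False (0, 0) - row False (k, m)) * ((u + v * square (node \<beta> 1 0)) - (u + v * square ?x)))"
    unfolding 1 2 3 4 by (rule cancel[OF nz T])
qed

end


subsection \<open>Positivity\<close>

text \<open>Up to \<open>1 + \<gamma> * \<tau>\<close>, the ratio is
  \<open>node 0 k' (Suc (Suc m'))\<close> over \<open>node 0 k' (Suc m')\<close>. The denominator
  is, up to \<kappa>, the box factor of arm \<open>k - 1\<close> and leg \<open>m - 1\<close>, with
  which the ratio is paired. The constant \<kappa> is 1 for the rational families and
  \<open>- \<gamma>\<close> for the trigonometric ones.\<close>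

lemma (in linear_lattice) positive:
  assumes one: "1 \<in> Good" and mult: "\<And>x y. x \<in> Good \<Longrightarrow> y \<in> Good \<Longrightarrow> x * y \<in> Good"
    and \<kappa>: "\<kappa> \<in> Good" and v_Good: "v \<in> Good" and node_0_Good: "\<And>k m. node 0 k m \<in> Good"
    and X_Good: "\<And>k m. 1 + \<gamma> * node \<beta> k m \<in> Good" and t_Good: "1 / (1 + \<gamma> * \<tau>) \<in> Good"
  shows "positive_grid (\<lambda>k m. u + v * node \<beta> k m) (\<lambda>i j. \<kappa> * node 0 i (Suc j)) Good
    (\<lambda>a b k m. (t_step (node (node \<beta> a b) k m) - q_step (node \<beta> a b)) /
      ((1 + \<gamma> * \<tau>) * (node (node \<beta> a b) k m - q_step (node \<beta> a b))))"
proof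
  show "inj_grid (\<lambda>k m. u + v * node \<beta> k m)" by (rule op.inj)
  fix a b
  have shift: "shifted (\<lambda>k m. u + v * node \<beta> k m) a b = (\<lambda>k m. u + v * node (node \<beta> a b) k m)"
    by (simp add: shifted_def node_add fun_eq_iff)
  have "inj_grid (node (node \<beta> a b))"
    using inj_grid_shift[OF inj_node, of a b] by (simp add: node_add)
  then interpret L: linear_lattice \<gamma> \<tau> "node \<beta> a b" u v
    using v one_plus_node_nonzero[OF base] by unfold_locales
  show "f (grid_point (Suc n) (shifted (\<lambda>k m. u + v * node \<beta> k m) a b) (\<mu>(Suc n := 1))) =
      f (grid_point (Suc n) (shifted (\<lambda>k m. u + v * node \<beta> k m) a b) \<mu>) *
      (\<Prod>i=1..n. (t_step (node (node \<beta> a b) (\<mu> i) (Suc n - i)) - q_step (node \<beta> a b)) /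
      ((1 + \<gamma> * \<tau>) * (node (node \<beta> a b) (\<mu> i) (Suc n - i) - q_step (node \<beta> a b))))"
    if "\<mu> \<in> partitions (Suc n)" "\<mu> (Suc n) = 0" "\<mu>(Suc n := 1) \<in> partitions (Suc n)"
      "dual_at (Suc n) (shifted (\<lambda>k m. u + v * node \<beta> k m) a b) \<mu> f" for n \<mu> f
    using L.new_row[OF that(1-3)] that(4) unfolding shift .
  fix k m :: nat assume k: "0 < k"
  let ?\<beta> = "node \<beta> a b"
  have "(u + v * node \<beta> (k + a) (m + b)) - (u + v * node \<beta> a b) = v * ((1 + \<gamma> * ?\<beta>) * node 0 k m)"
    unfolding node_add node_diff[symmetric] by (simp add: algebra_simps)
  then show "(u + v * node \<beta> (k + a) (m + b)) - (u + v * node \<beta> a b) \<in> Good"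
    using mult v_Good X_Good node_0_Good by simp
  assume m: "0 < m"
  obtain k' m' where km: "k = Suc k'" "m = Suc m'" using k m by (cases k; cases m) auto
  let ?x = "node ?\<beta> k m" and ?n = "node 0 k' (Suc m')" and ?B = "1 + \<gamma> * ?\<beta>"
  have q: "q_step y - q_step ?\<beta> = (1 + \<gamma>) * (y - ?\<beta>)" for y by (simp add: q_step_def algebra_simps)
  have 1: "?x - q_step ?\<beta> = (1 + \<gamma>) * (?B * ?n)"
    unfolding node_diff[symmetric] q[symmetric] km node_Suc_left ..
  have 2: "t_step ?x - q_step ?\<beta> = (1 + \<gamma>) * (?B * node 0 k' (Suc (Suc m')))"
    unfolding node_diff[symmetric] q[symmetric] km node_Suc_left[symmetric] node_Suc_right[symmetric] ..
  have 3: "(u + v * node \<beta> (k + a) (m + b)) - (u + v * node \<beta> a (Suc b)) =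
      v * ((1 + \<gamma> * node \<beta> a (Suc b)) * node 0 k m')"
    unfolding node_diff[symmetric] km using node_add[of \<beta> "Suc k'" a m' "Suc b"] by (simp add: algebra_simps)
  have "?B * ?n \<noteq> 0"
    unfolding node_diff[symmetric] using L.inj_node unfolding inj_grid_def by (metis node_0 right_minus_eq nat.distinct(1))
  then have nz: "?B \<noteq> 0" "?n \<noteq> 0" by auto
  have "\<kappa> * node 0 (k - 1) (Suc (m - 1)) * ((u + v * node \<beta> (k + a) (m + b)) - (u + v * node \<beta> a (Suc b))) *
      ((t_step ?x - q_step ?\<beta>) / ((1 + \<gamma> * \<tau>) * (?x - q_step ?\<beta>))) =
    \<kappa> * (v * ((1 + \<gamma> * node \<beta> a (Suc b)) * node 0 k m')) * (node 0 k' (Suc (Suc m')) * (1 / (1 + \<gamma> * \<tau>)))"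
  proof -
    have "k - 1 = k'" "Suc (m - 1) = Suc m'" by (simp_all add: km)
    moreover have "\<kappa> * n * e * (q * (B * d) / (t * (q * (B * n)))) = \<kappa> * e * (d * (1 / t))"
      if "n \<noteq> 0" "t \<noteq> 0" "q \<noteq> 0" "B \<noteq> 0" for n t q B d e :: 'a
      using that by (simp add: field_simps)
    ultimately show ?thesis unfolding 1 2 3 using nz q_nonzero t_nonzero by simp
  qed
  also have "\<dots> \<in> Good" by (intro mult \<kappa> v_Good X_Good node_0_Good t_Good)
  finally show "\<kappa> * node 0 (k - 1) (Suc (m - 1)) * ((u + v * node \<beta> (k + a) (m + b)) - (u + v * node \<beta> a (Suc b))) *
      ((t_step ?x - q_step ?\<beta>) / ((1 + \<gamma> * \<tau>) * (?x - q_step ?\<beta>))) \<in> Good" .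
qed (use one mult \<kappa> node_0_Good in auto)

text \<open>The ratio has the additional denominator \<open>t_step (oplus ?x ?\<beta>)\<close>. It
  equals \<open>oplus ?x ?T\<close>, where \<open>?T\<close> is the base node once the empty last
  row is removed, and this is a factor of \<open>square ?x - square ?T\<close>, the contribution of
  the row to H(\<mu>). Only an inverse value of X is left over.\<close>

lemma (in quadratic_lattice) positive:
  assumes one: "1 \<in> Good" and mult: "\<And>x y. x \<in> Good \<Longrightarrow> y \<in> Good \<Longrightarrow> x * y \<in> Good"
    and \<kappa>: "\<kappa> \<in> Good" and v_Good: "v \<in> Good" and node_0_Good: "\<And>k m. node 0 k m \<in> Good"
    and sum_Good: "\<And>k m. node (oplus \<beta> \<beta>) k m \<in> Good"
    and X_Good: "\<And>k m. 1 / (1 + \<gamma> * node \<beta> k m) \<in> Good"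
  shows "positive_grid (\<lambda>k m. u + v * square (node \<beta> k m)) (\<lambda>i j. \<kappa> * node 0 i (Suc j)) Good
    (\<lambda>a b k m. (t_step (node (node \<beta> a b) k m) - q_step (node \<beta> a b)) * oplus (node (node \<beta> a b) k m) (node \<beta> a b) /
      ((node (node \<beta> a b) k m - q_step (node \<beta> a b)) * t_step (oplus (node (node \<beta> a b) k m) (node \<beta> a b))))"
proof
  show "inj_grid (\<lambda>k m. u + v * square (node \<beta> k m))" by (rule op.inj)
  fix a b
  have shift: "shifted (\<lambda>k m. u + v * square (node \<beta> k m)) a b = (\<lambda>k m. u + v * square (node (node \<beta> a b) k m))"
    by (simp add: shifted_def node_add fun_eq_iff)
  have "inj_grid (node (node \<beta> a b))"
    using inj_grid_shift[OF inj_node, of a b] by (simp add: node_add)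
  moreover have "node (oplus (node \<beta> a b) (node \<beta> a b)) k m \<noteq> 0" for k m
    unfolding oplus_node node_add[symmetric] by (rule sum_nonzero)
  ultimately interpret L: quadratic_lattice \<gamma> \<tau> "node \<beta> a b" u v
    using v one_plus_node_nonzero[OF base] by unfold_locales
  show "f (grid_point (Suc n) (shifted (\<lambda>k m. u + v * square (node \<beta> k m)) a b) (\<mu>(Suc n := 1))) =
      f (grid_point (Suc n) (shifted (\<lambda>k m. u + v * square (node \<beta> k m)) a b) \<mu>) *
      (\<Prod>i=1..n. (t_step (node (node \<beta> a b) (\<mu> i) (Suc n - i)) - q_step (node \<beta> a b)) *
        oplus (node (node \<beta> a b) (\<mu> i) (Suc n - i)) (node \<beta> a b) /
      ((node (node \<beta> a b) (\<mu> i) (Suc n - i) - q_step (node \<beta> a b)) *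
        t_step (oplus (node (node \<beta> a b) (\<mu> i) (Suc n - i)) (node \<beta> a b))))"
    if "\<mu> \<in> partitions (Suc n)" "\<mu> (Suc n) = 0" "\<mu>(Suc n := 1) \<in> partitions (Suc n)"
      "dual_at (Suc n) (shifted (\<lambda>k m. u + v * square (node \<beta> k m)) a b) \<mu> f" for n \<mu> f
    using L.new_row[OF that(1-3)] that(4) unfolding shift .
  let ?\<beta> = "node \<beta> a b"
  have X: "1 + \<gamma> * node \<beta> i j \<noteq> 0" for i j by (rule one_plus_node_nonzero[OF base])
  fix k m :: nat assume k: "0 < k"
  let ?x = "node ?\<beta> k m"
  have xX: "1 + \<gamma> * ?x \<noteq> 0" "1 / (1 + \<gamma> * ?x) \<in> Good" using X X_Good by (simp_all flip: node_add)
  have x\<beta>: "oplus ?x ?\<beta> = node (oplus \<beta> \<beta>) (k + a + a) (m + b + b)"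
    unfolding node_add[symmetric] oplus_node by (simp add: add.assoc)
  have "(u + v * square (node \<beta> (k + a) (m + b))) - (u + v * square ?\<beta>) = v * (square ?x - square ?\<beta>)"
    unfolding node_add by (simp add: right_diff_distrib)
  also have "\<dots> = v * (node 0 k m * oplus ?x ?\<beta> * (1 / (1 + \<gamma> * ?x)))"
    unfolding product_diff(4)[OF xX(1) X] node_diff using X[of a b] by simp
  also have "\<dots> \<in> Good"
    unfolding x\<beta> by (intro mult v_Good node_0_Good sum_Good xX)
  finally show "(u + v * square (node \<beta> (k + a) (m + b))) - (u + v * square ?\<beta>) \<in> Good" .
  assume m: "0 < m"
  obtain k' m' where km: "k = Suc k'" "m = Suc m'" using k m by (cases k; cases m) auto
  let ?n = "node 0 k' (Suc m')" and ?B = "1 + \<gamma> * ?\<beta>" and ?T = "node \<beta> a (Suc b)"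
  have q: "q_step y - q_step ?\<beta> = (1 + \<gamma>) * (y - ?\<beta>)" for y by (simp add: q_step_def algebra_simps)
  have 1: "?x - q_step ?\<beta> = (1 + \<gamma>) * (?B * ?n)"
    unfolding node_diff[symmetric] q[symmetric] km node_Suc_left ..
  have 2: "t_step ?x - q_step ?\<beta> = (1 + \<gamma>) * (?B * node 0 k' (Suc (Suc m')))"
    unfolding node_diff[symmetric] q[symmetric] km node_Suc_left[symmetric] node_Suc_right[symmetric] ..
  have xT: "?x = node ?T k m'"
    using node_add[of \<beta> k a m' "Suc b"] node_add[of \<beta> k a m b] by (simp add: km)
  have T: "oplus ?x ?T = t_step (oplus ?x ?\<beta>)"
    using oplus_node[of \<beta> "k + a" "m + b" \<beta> a "Suc b"] oplus_node[of \<beta> "k + a" "m + b" \<beta> a b]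
    by (simp add: node_add node_Suc_right)
  have Tnz: "t_step (oplus ?x ?\<beta>) \<noteq> 0"
    using sum_nonzero[of "k + a + a" "Suc (m + b + b)"] by (simp add: x\<beta> node_Suc_right)
  have 3: "(u + v * square (node \<beta> (k + a) (m + b))) - (u + v * square ?T) =
      v * (node 0 k m' * t_step (oplus ?x ?\<beta>) * (1 / (1 + \<gamma> * ?x)))"
  proof -
    have "(u + v * square (node \<beta> (k + a) (m + b))) - (u + v * square ?T) = v * (square ?x - square ?T)"
      unfolding node_add by (simp add: right_diff_distrib)
    also have "square ?x - square ?T = (?x - ?T) * t_step (oplus ?x ?\<beta>) / ((1 + \<gamma> * ?x) * (1 + \<gamma> * ?T))"
      unfolding product_diff(4)[OF xX(1) X] T ..
    also have "?x - ?T = (1 + \<gamma> * ?T) * node 0 k m'" unfolding xT by (rule node_diff)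
    finally show ?thesis using X[of a "Suc b"] by simp
  qed
  have "?B * ?n \<noteq> 0"
    unfolding node_diff[symmetric] using L.inj_node unfolding inj_grid_def by (metis node_0 right_minus_eq nat.distinct(1))
  then have nz: "?B \<noteq> 0" "?n \<noteq> 0" by auto
  have "\<kappa> * node 0 (k - 1) (Suc (m - 1)) * ((u + v * square (node \<beta> (k + a) (m + b))) - (u + v * square ?T)) *
      ((t_step ?x - q_step ?\<beta>) * oplus ?x ?\<beta> / ((?x - q_step ?\<beta>) * t_step (oplus ?x ?\<beta>))) =
    \<kappa> * (v * (node 0 k m' * (1 / (1 + \<gamma> * ?x)))) * (node 0 k' (Suc (Suc m')) * oplus ?x ?\<beta>)"
  proof -
    have "k - 1 = k'" "Suc (m - 1) = Suc m'" by (simp_all add: km)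
    moreover have "\<kappa> * n * (v * (c * t * X)) * (q * (B * d) * e / (q * (B * n) * t)) = \<kappa> * (v * (c * X)) * (d * e)"
      if "n \<noteq> 0" "t \<noteq> 0" "q \<noteq> 0" "B \<noteq> 0" for n t q B c d e X :: 'a
      using that by (simp add: field_simps)
    ultimately show ?thesis unfolding 1 2 3 using nz Tnz q_nonzero by simp
  qed
  also have "\<dots> \<in> Good" unfolding x\<beta> by (intro mult \<kappa> v_Good xX node_0_Good sum_Good)
  finally show "\<kappa> * node 0 (k - 1) (Suc (m - 1)) * ((u + v * square (node \<beta> (k + a) (m + b))) - (u + v * square ?T)) *
      ((t_step ?x - q_step ?\<beta>) * oplus ?x ?\<beta> / ((?x - q_step ?\<beta>) * t_step (oplus ?x ?\<beta>))) \<in> Good" .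
qed (use one mult \<kappa> node_0_Good in auto)

lemma (in laurent_family) adj_coeff_Good:
  assumes "positive_grid Y (box_factor F) Good ratio"
    and "lam \<in> partitions n" "\<mu> \<in> partitions n" "covers n lam \<mu>"
  shows "adj_coeff F n lam \<mu> \<in> Good"
proof -
  interpret P: positive_grid Y "box_factor F" Good ratio by fact
  have "shifted Y 0 0 = Y" by (simp add: shifted_def fun_eq_iff)
  then obtain f where "interpolates n Y \<mu> f" "box_product (box_factor F) n \<mu> * f (grid_point n Y lam) \<in> Good"
    using P.adjacent_value[OF assms(2-4), of 0 0] by auto
  then show ?thesis
    using adj_coeff_eq[OF assms(3,2)] by (simp add: c_coeff_def box_product_def)
qed

section \<open>The four families\<close>

lemma to_fract_of_nat: "to_fract (of_nat k) = of_nat k"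
  by (induction k) auto

lemma to_fract_power: "to_fract (x ^ k) = to_fract x ^ k"
  by (induction k) auto

instance fract :: ("{idom, ring_char_0}") field_char_0
proof
  show "inj (of_nat :: nat \<Rightarrow> 'a fract)"
    by (rule injI) (simp flip: to_fract_of_nat)
qed

lemma (in lattice) node_adjoin:
  assumes "\<gamma> \<in> adjoin \<nat> G" "\<tau> \<in> adjoin \<nat> G" "\<beta> \<in> adjoin \<nat> G"
  shows "node \<beta> k m \<in> adjoin \<nat> G"
proof -
  have one: "1 \<in> adjoin \<nat> G" by (rule adjoin.base) simp
  have t: "(t_step ^^ m) \<beta> \<in> adjoin \<nat> G"
    by (induction m) (auto simp: t_step_def intro!: adjoin.add adjoin.mult assms one)
  show ?thesis
    unfolding node_def
    by (induction k) (auto simp: q_step_def intro!: adjoin.add adjoin.mult assms one t)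
qed

lemma zero_adjoin: "0 \<in> adjoin \<nat> G" and one_adjoin: "1 \<in> adjoin \<nat> G"
  by (auto intro: adjoin.base)

lemma (in lattice) node_rational:
  assumes "\<gamma> = 0"
  shows "node \<beta> k m = of_nat k + of_nat m * \<tau> + \<beta>"
proof -
  have t: "t_step x = x + \<tau>" and q: "q_step x = x + 1" for x
    unfolding t_step_def q_step_def by (simp_all add: assms)
  have "(t_step ^^ m) \<beta> = of_nat m * \<tau> + \<beta>" by (induction m) (simp_all add: t algebra_simps)
  then show ?thesis
    unfolding node_def by (induction k) (simp_all add: q algebra_simps)
qed

text \<open>Allowing units gives up closure under sums, but closure under products survives if
  \<open>U\<close> and \<open>P\<close> have it, and \<open>positive_grid\<close> asks for no
  more.\<close>

definition unit_multiples :: "'a::field set \<Rightarrow> 'a set \<Rightarrow> 'a set" where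
  "unit_multiples U P = {s * u * p |s u p. s \<in> {1, -1} \<and> u \<in> U \<and> p \<in> P}"

lemma unit_multiplesI: "s \<in> {1, -1} \<Longrightarrow> u \<in> U \<Longrightarrow> p \<in> P \<Longrightarrow> s * u * p \<in> unit_multiples U P"
  unfolding unit_multiples_def by blast

lemma unit_multiples_mult:
  assumes U: "\<And>x y. x \<in> U \<Longrightarrow> y \<in> U \<Longrightarrow> x * y \<in> U" and P: "\<And>x y. x \<in> P \<Longrightarrow> y \<in> P \<Longrightarrow> x * y \<in> P"
    and xy: "x \<in> unit_multiples U P" "y \<in> unit_multiples U P"
  shows "x * y \<in> unit_multiples U P"
proof -
  obtain s u p where x: "x = s * u * p" "s \<in> {1, -1}" "u \<in> U" "p \<in> P"
    using xy(1) by (auto simp: unit_multiples_def)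
  obtain s' u' p' where y: "y = s' * u' * p'" "s' \<in> {1, -1}" "u' \<in> U" "p' \<in> P"
    using xy(2) by (auto simp: unit_multiples_def)
  have "(s * s') * (u * u') * (p * p') \<in> unit_multiples U P"
    by (rule unit_multiplesI) (use x y U P in auto)
  then show ?thesis by (simp add: x y mult_ac)
qed

lemma AJ_adj_coeff:
  assumes "lam \<in> partitions n" "\<mu> \<in> partitions n" "covers n lam \<mu>"
  shows "adj_coeff AJ n lam \<mu> \<in> adjoin \<nat> {AJ_tau}"
proof -
  interpret lattice 0 AJ_tau by unfold_locales auto
  note node = node_rational[OF refl]
  \<comment> \<open>As polynomials, nodes are compared by their coefficients, which gives
    injectivity.\<close>
  have repr: "of_nat k + of_nat m * AJ_tau = to_fract [:of_nat k, of_nat m:]" for k m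
  proof -
    have "[:of_nat k, of_nat m:] = of_nat k + of_nat m * [:0, 1 :: rat:]" by (simp add: of_nat_poly)
    then show ?thesis by (simp only: AJ_tau_def to_fract_add to_fract_mult to_fract_of_nat)
  qed
  have "inj_grid (node 0)"
    by (simp add: inj_grid_def node repr)
  then interpret linear_lattice 0 AJ_tau 0 0 1 by unfold_locales auto
  interpret laurent_family AJ "{1}" n "\<lambda>k m. 0 + 1 * node 0 k m"
  proof
    show "inj_grid (\<lambda>k m. 0 + 1 * node 0 k m)" by (rule op.inj)
  qed (simp_all add: AJ_def node)
  have "box_factor AJ = (\<lambda>i j. 1 * node 0 i (Suc j))"
    by (simp add: AJ_def node fun_eq_iff algebra_simps)
  moreover have "\<exists>ratio. positive_grid (\<lambda>k m. 0 + 1 * node 0 k m) (\<lambda>i j. 1 * node 0 i (Suc j)) (adjoin \<nat> {AJ_tau}) ratio"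
  proof (rule exI, rule positive)
    show "node 0 k m \<in> adjoin \<nat> {AJ_tau}" for k m
      by (intro node_adjoin zero_adjoin adjoin.gen) simp
  qed (simp_all add: one_adjoin adjoin.mult)
  ultimately show ?thesis using adj_coeff_Good[OF _ assms] by auto
qed

lemma BJ_adj_coeff:
  assumes "lam \<in> partitions n" "\<mu> \<in> partitions n" "covers n lam \<mu>"
  shows "adj_coeff BJ n lam \<mu> \<in> adjoin \<nat> {BJ_tau, BJ_alpha}"
proof -
  interpret lattice 0 BJ_tau by unfold_locales auto
  note node = node_rational[OF refl]
  have repr: "of_nat k + of_nat m * BJ_tau + of_nat c * BJ_alpha = to_fract [:[:of_nat k, of_nat m:], of_nat c:]" for k m c
  proof -
    have "[:[:of_nat k, of_nat m:], of_nat c:] = of_nat k + of_nat m * [:[:0, 1 :: rat:]:] + of_nat c * [:0, 1:]"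
      by (simp add: of_nat_poly)
    then show ?thesis by (simp only: BJ_tau_def BJ_alpha_def to_fract_add to_fract_mult to_fract_of_nat)
  qed
  have "inj_grid (node BJ_alpha)"
    using repr[of _ _ 1] by (simp add: inj_grid_def node)
  moreover have "node (oplus BJ_alpha BJ_alpha) k m \<noteq> 0" for k m
    using repr[of k m 2] by (simp add: node oplus_def)
  ultimately interpret quadratic_lattice 0 BJ_tau BJ_alpha 0 1 by unfold_locales auto
  interpret laurent_family BJ "{2}" n "\<lambda>k m. 0 + 1 * square (node BJ_alpha k m)"
  proof
    show "inj_grid (\<lambda>k m. 0 + 1 * square (node BJ_alpha k m))" by (rule op.inj)
  qed (simp_all add: BJ_def node square_def)
  have box: "box_factor BJ = (\<lambda>i j. 1 * node 0 i (Suc j))"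
    by (simp add: BJ_def node fun_eq_iff algebra_simps)
  have sum: "oplus BJ_alpha BJ_alpha \<in> adjoin \<nat> {BJ_tau, BJ_alpha}"
    unfolding oplus_def mult_zero_left add_0_right by (intro adjoin.add adjoin.gen) auto
  have "\<exists>ratio. positive_grid (\<lambda>k m. 0 + 1 * square (node BJ_alpha k m)) (\<lambda>i j. 1 * node 0 i (Suc j))
    (adjoin \<nat> {BJ_tau, BJ_alpha}) ratio"
  proof (rule exI, rule positive)
    show "node 0 k m \<in> adjoin \<nat> {BJ_tau, BJ_alpha}"
      "node (oplus BJ_alpha BJ_alpha) k m \<in> adjoin \<nat> {BJ_tau, BJ_alpha}" for k m
      by (rule node_adjoin; auto intro: sum zero_adjoin adjoin.gen)+
  qed (simp_all add: one_adjoin adjoin.mult)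
  then show ?thesis using adj_coeff_Good[OF _ assms] box by auto
qed

lemma AM_powers: "AM_q ^ k * AM_t ^ m = to_fract (monom (monom 1 k) m)"
proof -
  have "monom (monom 1 k) m = [:[:0, 1 :: rat:]:] ^ k * [:0, 1:] ^ m"
    by (simp add: monom_altdef poly_const_pow)
  then show ?thesis by (simp add: AM_q_def AM_t_def to_fract_power)
qed

lemma BM_powers: "BM_a ^ c * BM_q ^ k * BM_t ^ m = to_fract (monom (monom (monom 1 k) m) c)"
proof -
  have "monom (monom (monom 1 k) m) c = [:0, 1:] ^ c * [:[:[:0, 1 :: rat:]:]:] ^ k * [:[:0, 1:]:] ^ m"
    by (simp add: monom_altdef poly_const_pow mult_ac)
  then show ?thesis by (simp add: BM_a_def BM_q_def BM_t_def to_fract_power)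
qed

text \<open>The grid consists of the values X = q^k t^m themselves, hence \<open>u = 1\<close> and
  \<open>v = AM_gamma\<close>. A box factor 1 - q^i t^(j+1) is \<open>- AM_gamma\<close> times a
  node, which is the origin of the sign.\<close>

lemma AM_adj_coeff:
  assumes "lam \<in> partitions n" "\<mu> \<in> partitions n" "covers n lam \<mu>"
  shows "adj_coeff AM n lam \<mu> \<in>
    unit_multiples {AM_q powi i * AM_t powi j |i j. True} (adjoin \<nat> {AM_gamma, AM_tau})"
    (is "_ \<in> unit_multiples ?U ?P")
proof -
  have qt: "1 + AM_gamma = AM_q" "1 + AM_gamma * AM_tau = AM_t"
    using AM_reparametrization by simp_all
  have nz: "AM_q \<noteq> 0" "AM_t \<noteq> 0"
    by (simp_all add: AM_q_def AM_t_def)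
  interpret lattice AM_gamma AM_tau by unfold_locales (use qt nz in auto)
  have node: "1 + AM_gamma * node 0 k m = AM_q ^ k * AM_t ^ m" for k m
    using one_plus_node[of 0 k m] by (simp add: qt)
  have "inj_grid (node 0)"
    unfolding inj_grid_def
  proof (intro allI impI)
    fix k m k' m' assume "node 0 k m = node 0 k' m'"
    then have "AM_q ^ k * AM_t ^ m = AM_q ^ k' * AM_t ^ m'" by (simp flip: node)
    then have "monom (monom (1 :: rat) k) m = monom (monom 1 k') m'" by (simp add: AM_powers)
    then show "k = k' \<and> m = m'" by (simp add: monom_eq_iff')
  qed
  then interpret linear_lattice AM_gamma AM_tau 0 1 AM_gamma
    by unfold_locales (auto simp: AM_gamma_nonzero)
  interpret laurent_family AM "{1}" n "\<lambda>k m. 1 + AM_gamma * node 0 k m"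
  proof
    show "inj_grid (\<lambda>k m. 1 + AM_gamma * node 0 k m)" by (rule op.inj)
    show "0 < deg_factor AM" "{1} = {int (deg_factor AM)} \<or> {1} = {int (deg_factor AM), - int (deg_factor AM)}"
      "{1} = {int (deg_factor AM)} \<or> (\<forall>\<nu>\<in>partitions n. \<forall>i. shift AM n \<nu> i \<noteq> 0)"
      by (simp_all add: AM_def)
    show "generator AM i = (\<Sum>k\<in>{1}. var_pow i k)" for i by (simp add: AM_def)
    show "(\<Sum>k\<in>{1}. shift AM n \<nu> i powi k) = 1 + AM_gamma * node 0 (\<nu> i) (n - i)" for \<nu> i
      unfolding node by (simp add: AM_def)
  qed
  have "box_factor AM = (\<lambda>i j. (- AM_gamma) * node 0 i (Suc j))"
  proof (intro ext)
    fix i j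
    have "AM_q ^ i * AM_t ^ Suc j = 1 + AM_gamma * node 0 i (Suc j)" by (rule node[symmetric])
    then show "box_factor AM i j = (- AM_gamma) * node 0 i (Suc j)" by (simp add: AM_def)
  qed
  moreover have "positive_grid (\<lambda>k m. 1 + AM_gamma * node 0 k m) (\<lambda>i j. (- AM_gamma) * node 0 i (Suc j))
    (unit_multiples ?U ?P) (\<lambda>a b k m. (t_step (node (node 0 a b) k m) - q_step (node 0 a b)) /
      ((1 + AM_gamma * AM_tau) * (node (node 0 a b) k m - q_step (node 0 a b))))"
  proof (rule positive)
    have unit: "AM_q powi i * AM_t powi j \<in> ?U" for i j by blast
    have one_U: "1 \<in> ?U" using unit[of 0 0] by simp
    have P: "p \<in> unit_multiples ?U ?P" "- p \<in> unit_multiples ?U ?P" if "p \<in> ?P" for p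
      using unit_multiplesI[OF _ one_U that, of 1] unit_multiplesI[OF _ one_U that, of "-1"] by simp_all
    have U: "u \<in> unit_multiples ?U ?P" if "u \<in> ?U" for u
      using unit_multiplesI[OF _ that one_adjoin, of 1] by simp
    have gen: "AM_gamma \<in> ?P" "AM_tau \<in> ?P" by (auto intro: adjoin.gen)
    show "1 \<in> unit_multiples ?U ?P" by (rule P[OF one_adjoin])
    show "- AM_gamma \<in> unit_multiples ?U ?P" "AM_gamma \<in> unit_multiples ?U ?P" using P gen by auto
    show "node 0 k m \<in> unit_multiples ?U ?P" for k m by (intro P node_adjoin gen zero_adjoin)
    show "1 + AM_gamma * node 0 k m \<in> unit_multiples ?U ?P" for k m
      using U[OF unit[of "int k" "int m"]] by (simp add: node)
    show "1 / (1 + AM_gamma * AM_tau) \<in> unit_multiples ?U ?P"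
      using U[OF unit[of 0 "-1"]] by (simp add: qt power_int_minus divide_inverse)
    show "x * y \<in> unit_multiples ?U ?P" if "x \<in> unit_multiples ?U ?P" "y \<in> unit_multiples ?U ?P" for x y
    proof (rule unit_multiples_mult[OF _ _ that])
      fix x y assume "x \<in> ?U" "y \<in> ?U"
      then obtain i j i' j' where "x = AM_q powi i * AM_t powi j" "y = AM_q powi i' * AM_t powi j'" by blast
      then have "x * y = AM_q powi (i + i') * AM_t powi (j + j')" using nz by (simp add: power_int_add)
      then show "x * y \<in> ?U" using unit by simp
    qed (rule adjoin.mult)
  qed
  ultimately show ?thesis by (intro adj_coeff_Good[OF _ assms]) simp
qed

lemma BM_adj_coeff:
  assumes "lam \<in> partitions n" "\<mu> \<in> partitions n" "covers n lam \<mu>"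
  shows "adj_coeff BM n lam \<mu> \<in>
    unit_multiples {BM_q powi i * BM_t powi j * BM_a powi k |i j k. True}
      (adjoin \<nat> {BM_gamma, BM_tau, BM_alpha})"
    (is "_ \<in> unit_multiples ?U ?P")
proof -
  have qta: "1 + BM_gamma = BM_q" "1 + BM_gamma * BM_tau = BM_t" "1 + BM_gamma * BM_alpha = BM_a"
    using BM_reparametrization by simp_all
  have nz: "BM_q \<noteq> 0" "BM_t \<noteq> 0" "BM_a \<noteq> 0"
    by (simp_all add: BM_q_def BM_t_def BM_a_def)
  interpret lattice BM_gamma BM_tau by unfold_locales (use qta nz in auto)
  have node: "1 + BM_gamma * node BM_alpha k m = BM_a * BM_q ^ k * BM_t ^ m" for k m
    using one_plus_node[of BM_alpha k m] by (simp add: qta)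
  have node_sum: "1 + BM_gamma * node (oplus BM_alpha BM_alpha) k m = BM_a ^ 2 * BM_q ^ k * BM_t ^ m" for k m
  proof -
    have "1 + BM_gamma * oplus BM_alpha BM_alpha = (1 + BM_gamma * BM_alpha) ^ 2"
      by (simp add: oplus_def power2_eq_square algebra_simps)
    then show ?thesis using one_plus_node[of "oplus BM_alpha BM_alpha" k m] by (simp add: qta)
  qed
  have "inj_grid (node BM_alpha)"
    unfolding inj_grid_def
  proof (intro allI impI)
    fix k m k' m' assume "node BM_alpha k m = node BM_alpha k' m'"
    then have "BM_a ^ 1 * BM_q ^ k * BM_t ^ m = BM_a ^ 1 * BM_q ^ k' * BM_t ^ m'"
      by (simp only: power_one_right node[symmetric])
    then have "monom (monom (monom (1 :: rat) k) m) 1 = monom (monom (monom 1 k') m') 1"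
      by (simp only: BM_powers to_fract_eq_iff)
    then show "k = k' \<and> m = m'" by (simp add: monom_eq_iff')
  qed
  \<comment> \<open>Vanishing would mean a^2 q^k t^m = 1, which the degree in a excludes.\<close>
  moreover have "node (oplus BM_alpha BM_alpha) k m \<noteq> 0" for k m
  proof
    assume "node (oplus BM_alpha BM_alpha) k m = 0"
    then have "BM_a ^ 2 * BM_q ^ k * BM_t ^ m = BM_a ^ 0 * BM_q ^ 0 * BM_t ^ 0"
      using node_sum[of k m] by simp
    then have "monom (monom (monom (1 :: rat) k) m) 2 = monom (monom (monom 1 0) 0) 0"
      by (simp only: BM_powers to_fract_eq_iff)
    then have "degree (monom (monom (monom (1 :: rat) k) m) 2) = degree (monom (monom (monom (1 :: rat) 0) 0) 0)"
      by (rule arg_cong)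
    then show False by (simp add: degree_monom_eq)
  qed
  ultimately interpret quadratic_lattice BM_gamma BM_tau BM_alpha 2 "BM_gamma ^ 2"
    by unfold_locales (use qta nz BM_gamma_nonzero in auto)
  \<comment> \<open>X + 1/X = 2 + (X - 1)^2 / X with X - 1 equal to \<open>BM_gamma\<close> times
    the node; this is where the parameters \<open>2\<close> and \<open>BM_gamma ^ 2\<close> of the
    lattice come from.\<close>
  have y_value: "BM_a * BM_q ^ k * BM_t ^ m + inverse (BM_a * BM_q ^ k * BM_t ^ m) =
      2 + BM_gamma ^ 2 * square (node BM_alpha k m)" for k m
  proof -
    let ?x = "node BM_alpha k m"
    have nz: "1 + BM_gamma * ?x \<noteq> 0" by (rule one_plus_node_nonzero[OF base])
    have "2 * X + (X - 1)\<^sup>2 = X * X + 1" for X :: "rat poly poly poly fract"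
      by (simp add: power2_eq_square algebra_simps)
    then have "X + inverse X = 2 + (X - 1)\<^sup>2 / X" if "X \<noteq> 0" for X :: "rat poly poly poly fract"
      using that by (simp add: field_simps)
    from this[OF nz] show ?thesis by (simp add: square_def node power_mult_distrib flip: node)
  qed
  interpret laurent_family BM "{1, -1}" n "\<lambda>k m. 2 + BM_gamma ^ 2 * square (node BM_alpha k m)"
  proof
    show "inj_grid (\<lambda>k m. 2 + BM_gamma ^ 2 * square (node BM_alpha k m))" by (rule op.inj)
    show "0 < deg_factor BM" "{1, -1} = {int (deg_factor BM)} \<or> {1, -1} = {int (deg_factor BM), - int (deg_factor BM)}"
      by (simp_all add: BM_def)
    show "{1, -1} = {int (deg_factor BM)} \<or> (\<forall>\<nu>\<in>partitions n. \<forall>i. shift BM n \<nu> i \<noteq> 0)"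
      using nz by (simp add: BM_def)
    show "generator BM i = (\<Sum>k\<in>{1, -1}. var_pow i k)" for i by (simp add: BM_def)
    show "(\<Sum>k\<in>{1, -1}. shift BM n \<nu> i powi k) = 2 + BM_gamma ^ 2 * square (node BM_alpha (\<nu> i) (n - i))" for \<nu> i
      unfolding y_value[symmetric] by (simp add: BM_def power_int_minus)
  qed
  have "box_factor BM = (\<lambda>i j. (- BM_gamma) * node 0 i (Suc j))"
  proof (intro ext)
    fix i j
    have "BM_q ^ i * BM_t ^ Suc j = 1 + BM_gamma * node 0 i (Suc j)"
      using one_plus_node[of 0 i "Suc j"] by (simp add: qta)
    then show "box_factor BM i j = (- BM_gamma) * node 0 i (Suc j)" by (simp add: BM_def)
  qed
  moreover have "positive_grid (\<lambda>k m. 2 + BM_gamma ^ 2 * square (node BM_alpha k m)) (\<lambda>i j. (- BM_gamma) * node 0 i (Suc j))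
    (unit_multiples ?U ?P) (\<lambda>a b k m. (t_step (node (node BM_alpha a b) k m) - q_step (node BM_alpha a b)) *
      oplus (node (node BM_alpha a b) k m) (node BM_alpha a b) /
      ((node (node BM_alpha a b) k m - q_step (node BM_alpha a b)) *
        t_step (oplus (node (node BM_alpha a b) k m) (node BM_alpha a b))))"
  proof (rule positive)
    have unit: "BM_q powi i * BM_t powi j * BM_a powi k \<in> ?U" for i j k by blast
    have one_U: "1 \<in> ?U" using unit[of 0 0 0] by simp
    have P: "p \<in> unit_multiples ?U ?P" "- p \<in> unit_multiples ?U ?P" if "p \<in> ?P" for p
      using unit_multiplesI[OF _ one_U that, of 1] unit_multiplesI[OF _ one_U that, of "-1"] by simp_all
    have U: "u \<in> unit_multiples ?U ?P" if "u \<in> ?U" for u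
      using unit_multiplesI[OF _ that one_adjoin, of 1] by simp
    have gen: "BM_gamma \<in> ?P" "BM_tau \<in> ?P" "BM_alpha \<in> ?P" by (auto intro: adjoin.gen)
    show "1 \<in> unit_multiples ?U ?P" by (rule P[OF one_adjoin])
    show "- BM_gamma \<in> unit_multiples ?U ?P" using P gen by auto
    show "BM_gamma ^ 2 \<in> unit_multiples ?U ?P"
      unfolding power2_eq_square by (intro P adjoin.mult gen)
    show "node 0 k m \<in> unit_multiples ?U ?P" for k m by (intro P node_adjoin gen zero_adjoin)
    show "node (oplus BM_alpha BM_alpha) k m \<in> unit_multiples ?U ?P" for k m
      by (intro P node_adjoin gen) (unfold oplus_def, intro adjoin.add adjoin.mult gen)
    show "1 / (1 + BM_gamma * node BM_alpha k m) \<in> unit_multiples ?U ?P" for k m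
      using U[OF unit[of "- int k" "- int m" "-1"]] by (simp add: node power_int_minus divide_inverse mult_ac)
    show "x * y \<in> unit_multiples ?U ?P" if "x \<in> unit_multiples ?U ?P" "y \<in> unit_multiples ?U ?P" for x y
    proof (rule unit_multiples_mult[OF _ _ that])
      fix x y assume "x \<in> ?U" "y \<in> ?U"
      then obtain i j k i' j' k' where "x = BM_q powi i * BM_t powi j * BM_a powi k"
        "y = BM_q powi i' * BM_t powi j' * BM_a powi k'" by blast
      then have "x * y = BM_q powi (i + i') * BM_t powi (j + j') * BM_a powi (k + k')"
        using nz by (simp add: power_int_add mult_ac)
      then show "x * y \<in> ?U" using unit by simp
    qed (rule adjoin.mult)
  qed
  ultimately show ?thesis by (intro adj_coeff_Good[OF _ assms]) simp
qed

theorem theorem7: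
  fixes n :: nat and lam mu :: "nat \<Rightarrow> nat"
  assumes "n \<ge> 1"
    and "lam \<in> partitions n" and "mu \<in> partitions n"
    and "covers n lam mu"
  shows "adj_coeff AJ n lam mu \<in> adjoin \<nat> {AJ_tau}
    \<and> adj_coeff BJ n lam mu \<in> adjoin \<nat> {BJ_tau, BJ_alpha}
    \<and> (\<exists>s\<in>{1, -1}. \<exists>(i::int) (j::int). \<exists>P\<in>adjoin \<nat> {AM_gamma, AM_tau}.
          adj_coeff AM n lam mu = s * AM_q powi i * AM_t powi j * P)
    \<and> (\<exists>s\<in>{1, -1}. \<exists>(i::int) (j::int) (k::int). \<exists>P\<in>adjoin \<nat> {BM_gamma, BM_tau, BM_alpha}.
          adj_coeff BM n lam mu = s * BM_q powi i * BM_t powi j * BM_a powi k * P)"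
proof (intro conjI)
  show "adj_coeff AJ n lam mu \<in> adjoin \<nat> {AJ_tau}"
    by (rule AJ_adj_coeff[OF assms(2-4)])
  show "adj_coeff BJ n lam mu \<in> adjoin \<nat> {BJ_tau, BJ_alpha}"
    by (rule BJ_adj_coeff[OF assms(2-4)])
  obtain s i j P where AM: "s \<in> {1, -1}" "P \<in> adjoin \<nat> {AM_gamma, AM_tau}"
    "adj_coeff AM n lam mu = s * (AM_q powi i * AM_t powi j) * P"
    using AM_adj_coeff[OF assms(2-4)] unfolding unit_multiples_def by blast
  have "adj_coeff AM n lam mu = s * AM_q powi i * AM_t powi j * P"
    using AM(3) by (simp only: mult.assoc)
  with AM(1,2) show "\<exists>s\<in>{1, -1}. \<exists>(i::int) (j::int). \<exists>P\<in>adjoin \<nat> {AM_gamma, AM_tau}.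
      adj_coeff AM n lam mu = s * AM_q powi i * AM_t powi j * P" by blast
  obtain s i j k P where BM: "s \<in> {1, -1}" "P \<in> adjoin \<nat> {BM_gamma, BM_tau, BM_alpha}"
    "adj_coeff BM n lam mu = s * (BM_q powi i * BM_t powi j * BM_a powi k) * P"
    using BM_adj_coeff[OF assms(2-4)] unfolding unit_multiples_def by blast
  have "adj_coeff BM n lam mu = s * BM_q powi i * BM_t powi j * BM_a powi k * P"
    using BM(3) by (simp only: mult.assoc)
  with BM(1,2) show "\<exists>s\<in>{1, -1}. \<exists>(i::int) (j::int) (k::int). \<exists>P\<in>adjoin \<nat> {BM_gamma, BM_tau, BM_alpha}.
      adj_coeff BM n lam mu = s * BM_q powi i * BM_t powi j * BM_a powi k * P" by blast
qed

end
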